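(* Let $\varphi=f+g$, where $f:\mathbb R^n\to\mathbb R$ is $\mathcal C^2$-smooth and $g:\mathbb R^n\to\overline{\mathbb R}$ is proper, lower semicontinuous and prox-bounded with threshold $\lambda_g\in(0,\infty]$. Let $\bar x$ be an M-stationary point of $\varphi$ (that is, $0\in\partial\varphi(\bar x)$) such that $\nabla f+\partial g$ is metrically regular around $(\bar x,0)$ and $\partial g$ is semismooth$^*$ at $(\bar x,-\nabla f(\bar x))$. Suppose further that $g$ is continuously $r$-level prox-regular at $\bar x$ for $-\nabla f(\bar x)$ for some $r>0$, and that $\bar x$ is a $\bar\lambda$-critical point of $\varphi$ for some $\bar\lambda\in(0,1/r]$. Then for every $\lambda\in(0,\bar\lambda)$ there exists a neighborhood $U$ of $\bar x$ such that for all $x^0\in U$ the coderivative-based pure Newton algorithm with parameter $\lambda$ described in the context either stops after finitely many iterations, or produces a sequence $\{x^k\}$ that converges $Q$-superlinearly to $\bar x$.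
   Context: $\overline{\mathbb R}=(-\infty,\infty]$. For a set $\Omega\subset\mathbb R^s$ and $\bar z\in\Omega$: $\widehat N_\Omega(\bar z)=\{v:\limsup_{z\to\bar z,\,z\in\Omega}\langle v,z-\bar z\rangle/\|z-\bar z\|\le 0\}$; $N_\Omega(\bar z)=\{v:\exists z_k\to\bar z,\ z_k\in\Omega,\ v_k\to v,\ v_k\in\widehat N_\Omega(z_k)\}$; for $d\in\mathbb R^s$, $N_\Omega(\bar z;d)=\{v:\exists t_k\downarrow 0,\ d_k\to d,\ v_k\to v,\ v_k\in\widehat N_\Omega(\bar z+t_kd_k)\}$. Limiting subdifferential: $\partial\varphi(x)=\{v:(v,-1)\in N_{\mathrm{epi}\,\varphi}(x,\varphi(x))\}$ for $x\in\mathrm{dom}\,\varphi$ (empty otherwise). For $F:\mathbb R^n\rightrightarrows\mathbb R^m$ and $(\bar x,\bar y)\in\mathrm{gph}\,F$: $D^*F(\bar x,\bar y)(v)=\{u:(u,-v)\in N_{\mathrm{gph}F}(\bar x,\bar y)\}$ and $D^*F((\bar x,\bar y);(u,v))(v^* )=\{u^*:(u^*,-v^* )\in N_{\mathrm{gph}F}((\bar x,\bar y);(u,v))\}$. Second-order subdifferential: $\partial^2 g(x,v)(u)=(D^*\partial g)(x,v)(u)$ for $(x,v)\in\mathrm{gph}\,\partial g$. $F$ is metrically regular around $(\bar x,\bar y)$ if there are $\mu>0$ and neighborhoods $U$ of $\bar x$, $V$ of $\bar y$ with $\mathrm{dist}(x;F^{-1}(y))\le\mu\,\mathrm{dist}(y;F(x))$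 for all $(x,y)\in U\times V$. $F$ is semismooth$^*$ at $(\bar x,\bar y)$ if for all $(u,v)$ one has $\langle u^*,u\rangle=\langle v^*,v\rangle$ whenever $u^*\in D^*F((\bar x,\bar y);(u,v))(v^* )$. A function $\psi$ is $s$-convex if $\psi-\frac s2\|\cdot\|^2$ is convex. A proper l.s.c. $g$ is variationally $s$-convex at $\bar x$ for $\bar v\in\partial g(\bar x)$ if there are an $s$-convex function $\widehat g$, convex neighborhoods $U$ of $\bar x$ and $V$ of $\bar v$, and $\varepsilon>0$ such that $\widehat g\le g$ on $U$, $(U\times V)\cap\mathrm{gph}\,\partial\widehat g=(U_\varepsilon\times V)\cap\mathrm{gph}\,\partial g$, and $\widehat g(x)=g(x)$ at the common elements $(x,v)$, where $U_\varepsilon=\{x\in U:g(x)<g(\bar x)+\varepsilon\}$. For $r\ge0$, $g$ is $r$-level prox-regular at $\bar x$ for $\bar v$ if it is variationally $(-r)$-convex there. $g$ is subdifferentially continuous at $\bar x$ for $\bar v$ if for every $\varepsilon>0$ there is $\delta>0$ with $|g(x)-g(\bar x)|<\varepsilon$ for all $(x,v)\in\mathrm{gph}\,\partial g$ with $\|x-\bar x\|\le\delta$, $\|v-\bar v\|\le\delta$. Continuously $r$-level prox-regular = $r$-level prox-regular and subdifferentially continuous. $\mathrm{Prox}_{\lambda g}(x)=\mathrm{argmin}_y\{g(y)+\frac1{2\lambda}\|y-x\|^2\}$. The prox-boundedness threshold $\lambda_g$ is the supremum of all $\lambda>0$ for which $\inf_y\{g(y)+\frac1{2\lambda}\|y-x\|^2\}>-\infty$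 for some $x$ ($g$ is prox-bounded if such $\lambda$ exists). For $\lambda\in(0,\lambda_g)$, a point $\bar x\in\mathrm{dom}\,\varphi$ is $\lambda$-critical for $\varphi=f+g$ if $\bar x\in\mathrm{Prox}_{\lambda g}(\bar x-\lambda\nabla f(\bar x))$. Algorithm (parameter $\lambda\in(0,\lambda_g)$, starting point $x^0$). For $k=0,1,\dots$: if $x^k\in\mathrm{Prox}_{\lambda g}(x^k-\lambda\nabla f(x^k))$, stop. Otherwise take $\hat x^k\in\mathrm{Prox}_{\lambda g}(x^k-\lambda\nabla f(x^k))$ and $\hat v^k=\nabla f(\hat x^k)-\nabla f(x^k)+\frac1\lambda(x^k-\hat x^k)$; choose $d^k\in\mathbb R^n$ with $-\hat v^k-\nabla^2f(\hat x^k)d^k\in\partial^2g(\hat x^k,\hat v^k-\nabla f(\hat x^k))(d^k)$; set $x^{k+1}=\hat x^k+d^k$. $Q$-superlinear convergence $x^k\to\bar x$ means $\|x^{k+1}-\bar x\|/\|x^k-\bar x\|\to0$. *)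

theory Defs
  imports "HOL-Analysis.Analysis"
begin

text \<open>
  Extended-real-valued functions have codomain \<open>ereal\<close>; the convention that they take values in
  \<open>(-\<infinity>, \<infinity>]\<close> is imposed by \<open>proper\<close>, and explicitly in \<open>s_convex\<close>. Pairs carry the Euclidean
  structure of the library's product type, so the same normal cones serve epigraphs and graphs.
\<close>

section \<open>Normal cones\<close>

text \<open>All cones are empty at points outside the set.\<close>

definition regular_normal_cone :: "'a::real_inner set \<Rightarrow> 'a \<Rightarrow> 'a set" where
  "regular_normal_cone \<Omega> zbar =
     {v. zbar \<in> \<Omega> \<and>
         Limsup (at zbar within \<Omega>) (\<lambda>z. ereal (inner v (z - zbar) / norm (z - zbar))) \<le> 0}"

definition limiting_normal_cone :: "'a::real_inner set \<Rightarrow> 'a \<Rightarrow> 'a set" where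
  "limiting_normal_cone \<Omega> zbar =
     {v. zbar \<in> \<Omega> \<and>
         (\<exists>z w. z \<longlonglongrightarrow> zbar \<and> (\<forall>k. z k \<in> \<Omega>) \<and> w \<longlonglongrightarrow> v \<and>
                (\<forall>k::nat. w k \<in> regular_normal_cone \<Omega> (z k)))}"

definition directional_normal_cone :: "'a::real_inner set \<Rightarrow> 'a \<Rightarrow> 'a \<Rightarrow> 'a set" where
  "directional_normal_cone \<Omega> zbar d =
     {v. zbar \<in> \<Omega> \<and>
         (\<exists>(t :: nat \<Rightarrow> real) e w. (\<forall>k. 0 < t k) \<and> t \<longlonglongrightarrow> 0 \<and> e \<longlonglongrightarrow> d \<and> w \<longlonglongrightarrow> v \<and>
                (\<forall>k. w k \<in> regular_normal_cone \<Omega> (zbar + t k *\<^sub>R e k)))}"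

section \<open>Subdifferentials and coderivatives\<close>

definition edom :: "('a \<Rightarrow> ereal) \<Rightarrow> 'a set" where
  "edom \<phi> = {x. \<phi> x < \<infinity>}"

definition epi :: "('a \<Rightarrow> ereal) \<Rightarrow> ('a \<times> real) set" where
  "epi \<phi> = {(x, \<alpha>). \<phi> x \<le> ereal \<alpha>}"

definition proper :: "('a \<Rightarrow> ereal) \<Rightarrow> bool" where
  "proper \<phi> \<longleftrightarrow> (\<forall>x. \<phi> x \<noteq> -\<infinity>) \<and> edom \<phi> \<noteq> {}"

definition lsc :: "('a::topological_space \<Rightarrow> ereal) \<Rightarrow> bool" where
  "lsc \<phi> \<longleftrightarrow> (\<forall>x. \<phi> x \<le> Liminf (at x) \<phi>)"

text \<open>\<open>real_of_ereal\<close> is only meaningful at finite values; for functions that never take the value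
  \<open>-\<infinity>\<close> this is exactly the condition \<open>x \<in> edom \<phi>\<close>.\<close>

definition subdifferential :: "('a::real_inner \<Rightarrow> ereal) \<Rightarrow> 'a \<Rightarrow> 'a set" where
  "subdifferential \<phi> x =
     {v. x \<in> edom \<phi> \<and> (v, -1) \<in> limiting_normal_cone (epi \<phi>) (x, real_of_ereal (\<phi> x))}"

definition gph :: "('a \<Rightarrow> 'b set) \<Rightarrow> ('a \<times> 'b) set" where
  "gph F = {(x, y). y \<in> F x}"

definition coderivative ::
    "('a::real_inner \<Rightarrow> 'b::real_inner set) \<Rightarrow> 'a \<Rightarrow> 'b \<Rightarrow> 'b \<Rightarrow> 'a set" where
  "coderivative F x y v = {u. (u, - v) \<in> limiting_normal_cone (gph F) (x, y)}"

definition directional_coderivative ::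
    "('a::real_inner \<Rightarrow> 'b::real_inner set) \<Rightarrow> 'a \<Rightarrow> 'b \<Rightarrow> 'a \<Rightarrow> 'b \<Rightarrow> 'b \<Rightarrow> 'a set" where
  "directional_coderivative F x y u v vs =
     {us. (us, - vs) \<in> directional_normal_cone (gph F) (x, y) (u, v)}"

definition second_order_subdifferential ::
    "('a::real_inner \<Rightarrow> ereal) \<Rightarrow> 'a \<Rightarrow> 'a \<Rightarrow> 'a \<Rightarrow> 'a set" where
  "second_order_subdifferential g x v u = coderivative (subdifferential g) x v u"

section \<open>Regularity notions for set-valued maps\<close>

text \<open>Extended-valued distance, so that the distance to the empty set is \<open>\<infinity>\<close>
  (whereas \<open>infdist x {} = 0\<close>).\<close>

definition edist_set :: "'a::metric_space \<Rightarrow> 'a set \<Rightarrow> ereal" where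
  "edist_set x A = (INF a\<in>A. ereal (dist x a))"

definition metrically_regular ::
    "('a::metric_space \<Rightarrow> 'b::metric_space set) \<Rightarrow> 'a \<Rightarrow> 'b \<Rightarrow> bool" where
  "metrically_regular F xbar ybar \<longleftrightarrow>
     (\<exists>\<mu> U V. 0 < \<mu> \<and> open U \<and> xbar \<in> U \<and> open V \<and> ybar \<in> V \<and>
        (\<forall>x\<in>U. \<forall>y\<in>V. edist_set x {x'. y \<in> F x'} \<le> ereal \<mu> * edist_set y (F x)))"

definition semismooth_star ::
    "('a::real_inner \<Rightarrow> 'b::real_inner set) \<Rightarrow> 'a \<Rightarrow> 'b \<Rightarrow> bool" where
  "semismooth_star F xbar ybar \<longleftrightarrow>
     (\<forall>u v us vs. us \<in> directional_coderivative F xbar ybar u v vs \<longrightarrow> inner us u = inner vs v)"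

section \<open>Variational convexity and prox-regularity\<close>

text \<open>Convexity of an extended-real-valued function is convexity of its epigraph (the library's
  \<open>convex_on\<close> only covers real-valued functions).\<close>

definition s_convex :: "real \<Rightarrow> ('a::real_inner \<Rightarrow> ereal) \<Rightarrow> bool" where
  "s_convex s \<psi> \<longleftrightarrow>
     (\<forall>x. \<psi> x \<noteq> -\<infinity>) \<and> convex (epi (\<lambda>x. \<psi> x - ereal (s / 2 * (norm x)\<^sup>2)))"

definition variationally_s_convex ::
    "real \<Rightarrow> ('a::real_inner \<Rightarrow> ereal) \<Rightarrow> 'a \<Rightarrow> 'a \<Rightarrow> bool" where
  "variationally_s_convex s g xbar vbar \<longleftrightarrow>
     vbar \<in> subdifferential g xbar \<and>
     (\<exists>gh U V \<epsilon>. s_convex s gh \<and>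
        open U \<and> convex U \<and> xbar \<in> U \<and> open V \<and> convex V \<and> vbar \<in> V \<and> 0 < (\<epsilon>::real) \<and>
        (\<forall>x\<in>U. gh x \<le> g x) \<and>
        (U \<times> V) \<inter> gph (subdifferential gh) =
          ({x \<in> U. g x < g xbar + ereal \<epsilon>} \<times> V) \<inter> gph (subdifferential g) \<and>
        (\<forall>(x, v) \<in> (U \<times> V) \<inter> gph (subdifferential gh). gh x = g x))"

definition level_prox_regular ::
    "real \<Rightarrow> ('a::real_inner \<Rightarrow> ereal) \<Rightarrow> 'a \<Rightarrow> 'a \<Rightarrow> bool" where
  "level_prox_regular r g xbar vbar \<longleftrightarrow> 0 \<le> r \<and> variationally_s_convex (- r) g xbar vbar"

definition subdifferentially_continuous ::
    "('a::real_inner \<Rightarrow> ereal) \<Rightarrow> 'a \<Rightarrow> 'a \<Rightarrow> bool" where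
  "subdifferentially_continuous g xbar vbar \<longleftrightarrow>
     (\<forall>\<epsilon>>0. \<exists>\<delta>>0. \<forall>(x, v) \<in> gph (subdifferential g).
        norm (x - xbar) \<le> \<delta> \<longrightarrow> norm (v - vbar) \<le> \<delta> \<longrightarrow> \<bar>g x - g xbar\<bar> < ereal \<epsilon>)"

definition continuously_level_prox_regular ::
    "real \<Rightarrow> ('a::real_inner \<Rightarrow> ereal) \<Rightarrow> 'a \<Rightarrow> 'a \<Rightarrow> bool" where
  "continuously_level_prox_regular r g xbar vbar \<longleftrightarrow>
     level_prox_regular r g xbar vbar \<and> subdifferentially_continuous g xbar vbar"

section \<open>Proximal mappings\<close>

definition prox_objective :: "real \<Rightarrow> ('a::real_inner \<Rightarrow> ereal) \<Rightarrow> 'a \<Rightarrow> 'a \<Rightarrow> ereal" where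
  "prox_objective lam g x y = g y + ereal (1 / (2 * lam) * (norm (y - x))\<^sup>2)"

definition Prox :: "real \<Rightarrow> ('a::real_inner \<Rightarrow> ereal) \<Rightarrow> 'a \<Rightarrow> 'a set" where
  "Prox lam g x = {y. is_arg_min (prox_objective lam g x) (\<lambda>_. True) y}"

definition prox_bound_params :: "('a::real_inner \<Rightarrow> ereal) \<Rightarrow> real set" where
  "prox_bound_params g = {lam. 0 < lam \<and> (\<exists>x. (INF y. prox_objective lam g x y) > -\<infinity>)}"

definition prox_bounded :: "('a::real_inner \<Rightarrow> ereal) \<Rightarrow> bool" where
  "prox_bounded g \<longleftrightarrow> prox_bound_params g \<noteq> {}"

definition prox_threshold :: "('a::real_inner \<Rightarrow> ereal) \<Rightarrow> ereal" where
  "prox_threshold g = (SUP lam\<in>prox_bound_params g. ereal lam)"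

section \<open>The problem and the algorithm\<close>

text \<open>Below, \<open>gf\<close> and \<open>Hf\<close> are the gradient and the Hessian of the smooth part \<open>f\<close>; they are
  uniquely determined by \<open>f\<close> through the following predicate.\<close>

definition C2_smooth_with ::
    "('a::euclidean_space \<Rightarrow> real) \<Rightarrow> ('a \<Rightarrow> 'a) \<Rightarrow> ('a \<Rightarrow> 'a \<Rightarrow>\<^sub>L 'a) \<Rightarrow> bool" where
  "C2_smooth_with f gf Hf \<longleftrightarrow>
     (\<forall>x. GDERIV f x :> gf x) \<and>
     (\<forall>x. (gf has_derivative blinfun_apply (Hf x)) (at x)) \<and>
     continuous_on UNIV Hf"

definition lambda_critical ::
    "('a::real_inner \<Rightarrow> real) \<Rightarrow> ('a \<Rightarrow> 'a) \<Rightarrow> ('a \<Rightarrow> ereal) \<Rightarrow> real \<Rightarrow> 'a \<Rightarrow> bool" where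
  "lambda_critical f gf g lam xbar \<longleftrightarrow>
     0 < lam \<and> ereal lam < prox_threshold g \<and>
     xbar \<in> edom (\<lambda>x. ereal (f x) + g x) \<and>
     xbar \<in> Prox lam g (xbar - lam *\<^sub>R gf xbar)"

definition prox_points ::
    "('a::real_inner \<Rightarrow> 'a) \<Rightarrow> ('a \<Rightarrow> ereal) \<Rightarrow> real \<Rightarrow> 'a \<Rightarrow> 'a set" where
  "prox_points gf g lam x = Prox lam g (x - lam *\<^sub>R gf x)"

definition newton_directions ::
    "('a::euclidean_space \<Rightarrow> 'a) \<Rightarrow> ('a \<Rightarrow> 'a \<Rightarrow>\<^sub>L 'a) \<Rightarrow> ('a \<Rightarrow> ereal) \<Rightarrow> real \<Rightarrow> 'a \<Rightarrow> 'a \<Rightarrow> 'a set" where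
  "newton_directions gf Hf g lam x xh =
     (let vh = gf xh - gf x + (1 / lam) *\<^sub>R (x - xh) in
      {d. - vh - blinfun_apply (Hf xh) d \<in> second_order_subdifferential g xh (vh - gf xh) d})"

text \<open>One pass of the (nondeterministic) loop body from an iterate at which the stopping test fails.\<close>

definition newton_step ::
    "('a::euclidean_space \<Rightarrow> 'a) \<Rightarrow> ('a \<Rightarrow> 'a \<Rightarrow>\<^sub>L 'a) \<Rightarrow> ('a \<Rightarrow> ereal) \<Rightarrow> real \<Rightarrow> 'a \<Rightarrow> 'a \<Rightarrow> bool" where
  "newton_step gf Hf g lam x x' \<longleftrightarrow>
     x \<notin> prox_points gf g lam x \<and>
     (\<exists>xh \<in> prox_points gf g lam x. \<exists>d \<in> newton_directions gf Hf g lam x xh. x' = xh + d)"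

text \<open>The loop started at \<open>x0\<close> never gets stuck: at every reachable iterate that does not pass the
  stopping test, a proximal point exists and each choice of it admits a Newton direction.
  Hence every maximal run is either finite, ending with a successful stopping test, or infinite.\<close>

definition newton_well_defined ::
    "('a::euclidean_space \<Rightarrow> 'a) \<Rightarrow> ('a \<Rightarrow> 'a \<Rightarrow>\<^sub>L 'a) \<Rightarrow> ('a \<Rightarrow> ereal) \<Rightarrow> real \<Rightarrow> 'a \<Rightarrow> bool" where
  "newton_well_defined gf Hf g lam x0 \<longleftrightarrow>
     (\<forall>x. (newton_step gf Hf g lam)\<^sup>*\<^sup>* x0 x \<longrightarrow> x \<notin> prox_points gf g lam x \<longrightarrow>
        prox_points gf g lam x \<noteq> {} \<and>
        (\<forall>xh \<in> prox_points gf g lam x. newton_directions gf Hf g lam x xh \<noteq> {}))"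

text \<open>The condition \<open>X k \<noteq> xbar\<close> makes the quotient meaningful (in HOL, division by 0 yields 0).\<close>

definition Q_superlinear :: "(nat \<Rightarrow> 'a::real_normed_vector) \<Rightarrow> 'a \<Rightarrow> bool" where
  "Q_superlinear X xbar \<longleftrightarrow>
     X \<longlonglongrightarrow> xbar \<and> (\<forall>k. X k \<noteq> xbar) \<and>
     (\<lambda>k. norm (X (Suc k) - xbar) / norm (X k - xbar)) \<longlonglongrightarrow> 0"

end

theory Submission
  imports Defs
begin

text \<open>
  Write \<open>G\<close> for the graph of \<open>\<partial>g\<close> and \<open>vb = - \<nabla>f(xbar)\<close>. Level prox-regularity makes \<open>\<partial>g\<close> hypomonotone
  with modulus \<open>r\<close> near \<open>(xbar, vb)\<close>, and \<open>lam < 1/r\<close>, so near that point \<open>G\<close> is a Lipschitz manifold: it is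
  parametrised by \<open>z \<mapsto> (P z, (z - P z)/lam)\<close> for the proximal map \<open>P\<close>. Criticality of \<open>xbar\<close> with a parameter larger
  than \<open>lam\<close> makes the proximal problems grow quadratically around \<open>xbar\<close>; hence proximal points exist everywhere,
  the points \<open>z\<close> near \<open>xbar + lam vb\<close> all belong to the chart, and a proximal step moves an iterate \<open>x\<close> to a point
  of \<open>G\<close> whose distance to \<open>(xbar, vb)\<close> is at most a multiple of \<open>|x - xbar|\<close>. It remains to study
  Newton directions at points of \<open>G\<close> close to \<open>(xbar, vb)\<close>.

  For the superlinear estimate, note that the map \<open>P\<close> is a gradient, of a convex function \<open>E\<close>, and mixed second differences of \<open>E\<close> are
  symmetric. Combined with a mean value inequality this turns the scalar semismoothness relation
  \<open>\<langle>c, z - zb\<rangle> \<approx> \<langle>h, P z - P zb\<rangle>\<close>, valid for proximal subgradients \<open>c\<close> of \<open>\<langle>h, P\<rangle>\<close>, into a vector relation: up to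
  a small multiple of \<open>|z - zb|\<close>, increments of \<open>P\<close> close to \<open>z\<close> satisfy
  \<open>\<langle>z - zb, P z' - P z''\<rangle> \<approx> \<langle>P z - P zb, z' - z''\<rangle>\<close>. On \<open>G\<close> it reads
  \<open>\<langle>v - vb, \<Delta>x\<rangle> \<approx> \<langle>x - xbar, \<Delta>v\<rangle>\<close> (\<open>graph_increment\<close>). If
  \<open>d\<close> is a Newton direction at \<open>(x, v)\<close>, then \<open>(- (\<nabla>f x + v) - \<nabla>\<^sup>2f x d, - d)\<close> is a limit of regular normals of \<open>G\<close>. Metric
  regularity provides points of \<open>G\<close> along which \<open>\<nabla>f + \<partial>g\<close> changes by \<open>- t w\<close>, where \<open>w = x + d - xbar\<close>;
  testing the normals against those points and inserting the increment relation leaves \<open>t |w|\<^sup>2\<close> on one side and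
  \<open>t |w|\<close> times \<open>o(|x - xbar| + |v - vb|)\<close> on the other (\<open>newton_estimate\<close>).

  For the existence of directions, observe that in the chart, \<open>\<nabla>f + \<partial>g\<close> becomes a Lipschitz map \<open>F\<close> between spaces of equal dimension that is
  open by metric regularity, though it need not be injective. A volume count
  shows that such a map has, in every ball, a point \<open>z'\<close> isolated in its fibre
  (\<open>open_lipschitz_map_isolated_fibre_point\<close>). Near such a point the penalty \<open>K |F z - F z'|\<^sup>2\<close>, added to a linear function
  \<open>\<langle>w, P z\<rangle>\<close>, produces an interior minimiser, and optimality there is a regular normal of the required form. Metric
  regularity bounds the normals, so they have a limit (\<open>newton_direction_exists\<close>).
\<close>

section \<open>Regular normals\<close>

lemma regular_normal_cone_iff:
  "v \<in> regular_normal_cone \<Omega> z \<longleftrightarrow>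
     z \<in> \<Omega> \<and> (\<forall>\<epsilon>>0. \<exists>\<delta>>0. \<forall>y\<in>\<Omega>. dist y z < \<delta> \<longrightarrow> inner v (y - z) \<le> \<epsilon> * norm (y - z))"
proof -
  let ?q = "\<lambda>y. inner v (y - z) / norm (y - z)"
  have "Limsup (at z within \<Omega>) (\<lambda>y. ereal (?q y)) \<le> 0 \<longleftrightarrow>
      (\<forall>\<epsilon>>0. eventually (\<lambda>y. ?q y \<le> \<epsilon>) (at z within \<Omega>))"
  proof
    assume "Limsup (at z within \<Omega>) (\<lambda>y. ereal (?q y)) \<le> 0"
    then have lt: "eventually (\<lambda>y. ereal (?q y) < ereal \<epsilon>) (at z within \<Omega>)" if "\<epsilon> > 0" for \<epsilon>
      using that[THEN ereal_less(2)[THEN iffD2]] unfolding Limsup_le_iff by blast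
    show "\<forall>\<epsilon>>0. eventually (\<lambda>y. ?q y \<le> \<epsilon>) (at z within \<Omega>)"
    proof (intro allI impI)
      fix \<epsilon> :: real assume "\<epsilon> > 0"
      from lt[OF this] show "eventually (\<lambda>y. ?q y \<le> \<epsilon>) (at z within \<Omega>)"
        by eventually_elim simp
    qed
  next
    assume q: "\<forall>\<epsilon>>0. eventually (\<lambda>y. ?q y \<le> \<epsilon>) (at z within \<Omega>)"
    show "Limsup (at z within \<Omega>) (\<lambda>y. ereal (?q y)) \<le> 0"
      unfolding Limsup_le_iff
    proof (intro allI impI)
      fix b :: ereal assume "0 < b"
      then obtain e where e: "0 < ereal e" "ereal e < b" using ereal_dense2 by blast
      then have "eventually (\<lambda>y. ?q y \<le> e) (at z within \<Omega>)" using q by auto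
      then show "eventually (\<lambda>y. ereal (?q y) < b) (at z within \<Omega>)"
      proof eventually_elim
        case (elim y)
        then have "ereal (?q y) \<le> ereal e" by simp
        also have "\<dots> < b" by (rule e)
        finally show ?case .
      qed
    qed
  qed
  moreover have "(?q y \<le> \<epsilon> \<or> y = z) \<longleftrightarrow> inner v (y - z) \<le> \<epsilon> * norm (y - z)" for y \<epsilon>
    by (cases "y = z") (auto simp: divide_le_eq)
  ultimately show ?thesis
    unfolding regular_normal_cone_def eventually_at by (auto; meson)
qed

text \<open>
  A quadratic error term is \<open>o(|y - z|)\<close>; all normals that arise from quadratic minorants enter through this rule.
\<close>

lemma regular_normal_coneI_quadratic:
  assumes "z \<in> \<Omega>" "0 < \<delta>"
    and le: "\<And>y. y \<in> \<Omega> \<Longrightarrow> dist y z < \<delta> \<Longrightarrow> inner v (y - z) \<le> K * (norm (y - z))\<^sup>2"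
  shows "v \<in> regular_normal_cone \<Omega> z"
  unfolding regular_normal_cone_iff
proof (intro conjI allI impI)
  fix \<epsilon> :: real assume "\<epsilon> > 0"
  have "inner v (y - z) \<le> \<epsilon> * norm (y - z)"
    if y: "y \<in> \<Omega>" "dist y z < min \<delta> (\<epsilon> / (\<bar>K\<bar> + 1))" for y
  proof -
    have "inner v (y - z) \<le> K * (norm (y - z))\<^sup>2" using y by (intro le) auto
    also have "\<dots> \<le> ((\<bar>K\<bar> + 1) * norm (y - z)) * norm (y - z)"
      unfolding power2_eq_square mult.assoc by (intro mult_right_mono) auto
    also have "\<dots> \<le> \<epsilon> * norm (y - z)"
      using y(2) by (intro mult_right_mono) (auto simp: dist_norm field_simps)
    finally show ?thesis .
  qed
  then show "\<exists>\<delta>>0. \<forall>y\<in>\<Omega>. dist y z < \<delta> \<longrightarrow> inner v (y - z) \<le> \<epsilon> * norm (y - z)"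
    using \<open>\<epsilon> > 0\<close> \<open>0 < \<delta>\<close> by (intro exI[of _ "min \<delta> (\<epsilon> / (\<bar>K\<bar> + 1))"]) auto
qed fact

lemma regular_normal_cone_subset_limiting:
  "regular_normal_cone \<Omega> z \<subseteq> limiting_normal_cone \<Omega> z"
proof
  fix v assume v: "v \<in> regular_normal_cone \<Omega> z"
  then have "z \<in> \<Omega>" by (simp add: regular_normal_cone_iff)
  with v show "v \<in> limiting_normal_cone \<Omega> z"
    unfolding limiting_normal_cone_def mem_Collect_eq
    by (intro conjI exI[of _ "\<lambda>_. z"] exI[of _ "\<lambda>_. v"] allI tendsto_const)
qed

lemma regular_normal_cone_scaleR:
  assumes "v \<in> regular_normal_cone \<Omega> z" "0 < c"
  shows "c *\<^sub>R v \<in> regular_normal_cone \<Omega> z"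
  unfolding regular_normal_cone_iff
proof (intro conjI allI impI)
  show "z \<in> \<Omega>" using assms(1) by (simp add: regular_normal_cone_iff)
  fix \<epsilon> :: real assume "\<epsilon> > 0"
  then have "\<epsilon> / c > 0" using assms(2) by simp
  then obtain \<delta> where "\<delta> > 0"
    and \<delta>: "\<forall>y\<in>\<Omega>. dist y z < \<delta> \<longrightarrow> inner v (y - z) \<le> \<epsilon> / c * norm (y - z)"
    using assms(1) unfolding regular_normal_cone_iff by blast
  then show "\<exists>\<delta>>0. \<forall>y\<in>\<Omega>. dist y z < \<delta> \<longrightarrow> inner (c *\<^sub>R v) (y - z) \<le> \<epsilon> * norm (y - z)"
    using assms(2) by (intro exI[of _ \<delta>]) (auto simp: field_simps)
qed

text \<open>
  Vanishing of \<open>\<langle>n, d\<rangle>\<close> on all directional normals is a statement about limits. If the uniform inequality failed, then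
  normalising the points \<open>z - zb\<close> and the normals \<open>n\<close> along a sequence of failures and extracting a convergent
  subsequence from the product of the unit spheres would produce a directional normal that violates the assumption.
\<close>

lemma semismooth_uniform:
  fixes \<Omega> :: "'a::euclidean_space set"
  assumes "zb \<in> \<Omega>"
    and ss: "\<And>d n. n \<in> directional_normal_cone \<Omega> zb d \<Longrightarrow> inner n d = 0"
    and "0 < \<epsilon>"
  shows "\<exists>\<delta>>0. \<forall>z\<in>\<Omega>. dist z zb < \<delta> \<longrightarrow>
           (\<forall>n\<in>regular_normal_cone \<Omega> z. \<bar>inner n (z - zb)\<bar> \<le> \<epsilon> * norm n * norm (z - zb))"
proof (rule ccontr)
  assume neg: "\<not> ?thesis"
  have "\<exists>z n. z \<in> \<Omega> \<and> dist z zb < inverse (real (Suc k)) \<and> n \<in> regular_normal_cone \<Omega> z \<and>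
      \<epsilon> * norm n * norm (z - zb) < \<bar>inner n (z - zb)\<bar>" for k
  proof -
    have "inverse (real (Suc k)) > 0" by simp
    then show ?thesis using neg by (meson not_le)
  qed
  then obtain z n where zn: "\<And>k. z k \<in> \<Omega>" "\<And>k. dist (z k) zb < inverse (real (Suc k))"
    "\<And>k. n k \<in> regular_normal_cone \<Omega> (z k)"
    "\<And>k. \<epsilon> * norm (n k) * norm (z k - zb) < \<bar>inner (n k) (z k - zb)\<bar>"
    by metis
  have nz: "z k \<noteq> zb" "n k \<noteq> 0" for k using zn(4)[of k] by auto
  define t where "t k = norm (z k - zb)" for k
  define e where "e k = (z k - zb) /\<^sub>R t k" for k
  define w where "w k = n k /\<^sub>R norm (n k)" for k
  have tpos: "t k > 0" for k using nz by (simp add: t_def)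
  have t0: "t \<longlonglongrightarrow> 0"
    by (rule tendsto_sandwich[OF _ _ tendsto_const LIMSEQ_inverse_real_of_nat])
       (use zn(2) in \<open>simp_all add: t_def dist_norm less_imp_le\<close>)
  have big: "\<epsilon> < \<bar>inner (w k) (e k)\<bar>" for k
  proof -
    have "inner (w k) (e k) = inner (n k) (z k - zb) / (norm (n k) * norm (z k - zb))"
      by (simp add: w_def e_def t_def divide_inverse)
    moreover have "norm (n k) * norm (z k - zb) > 0" using nz by simp
    ultimately show ?thesis using zn(4)[of k]
      by (simp add: abs_divide abs_mult less_divide_eq mult.assoc)
  qed
  have mem: "\<forall>k. (e k, w k) \<in> sphere 0 1 \<times> sphere 0 1"
    using nz by (simp add: e_def w_def t_def)
  have "seq_compact (sphere 0 1 \<times> sphere 0 1 :: ('a \<times> 'a) set)"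
    by (intro compact_imp_seq_compact compact_Times compact_sphere)
  then obtain l \<rho> where \<rho>: "strict_mono \<rho>" "((\<lambda>k. (e k, w k)) \<circ> \<rho>) \<longlonglongrightarrow> l"
    using mem by (rule seq_compactE)
  have le: "(e \<circ> \<rho>) \<longlonglongrightarrow> fst l" and lw: "(w \<circ> \<rho>) \<longlonglongrightarrow> snd l"
    using tendsto_fst[OF \<rho>(2)] tendsto_snd[OF \<rho>(2)] by (simp_all add: o_def)
  have "snd l \<in> directional_normal_cone \<Omega> zb (fst l)"
    unfolding directional_normal_cone_def
  proof (intro CollectI conjI exI)
    show "\<forall>k. 0 < (t \<circ> \<rho>) k" using tpos by simp
    show "(t \<circ> \<rho>) \<longlonglongrightarrow> 0" by (rule LIMSEQ_subseq_LIMSEQ[OF t0 \<rho>(1)])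
    show "\<forall>k. (w \<circ> \<rho>) k \<in> regular_normal_cone \<Omega> (zb + (t \<circ> \<rho>) k *\<^sub>R (e \<circ> \<rho>) k)"
    proof
      fix k
      have "w (\<rho> k) \<in> regular_normal_cone \<Omega> (z (\<rho> k))"
        unfolding w_def using nz zn(3) by (intro regular_normal_cone_scaleR) auto
      moreover have "zb + t (\<rho> k) *\<^sub>R e (\<rho> k) = z (\<rho> k)"
        using tpos[of "\<rho> k"] by (simp add: e_def)
      ultimately show "(w \<circ> \<rho>) k \<in> regular_normal_cone \<Omega> (zb + (t \<circ> \<rho>) k *\<^sub>R (e \<circ> \<rho>) k)" by simp
    qed
  qed (rule assms(1) le lw)+
  then have "inner (snd l) (fst l) = 0" by (rule ss)
  moreover have "(\<lambda>k. \<bar>inner (w (\<rho> k)) (e (\<rho> k))\<bar>) \<longlonglongrightarrow> \<bar>inner (snd l) (fst l)\<bar>"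
    using le lw by (intro tendsto_rabs tendsto_inner) (simp_all add: o_def)
  ultimately have "\<epsilon> \<le> 0"
    by (intro LIMSEQ_le_const[where X = "\<lambda>k. \<bar>inner (w (\<rho> k)) (e (\<rho> k))\<bar>"])
       (use big in \<open>auto intro: less_imp_le\<close>)
  then show False using \<open>0 < \<epsilon>\<close> by simp
qed

section \<open>A mean value inequality with proximal subgradients\<close>

text \<open>
  Proximal subgradients are the convenient class here: a penalty argument produces them exactly, with a quadratic error.
\<close>

definition proximal_subgradient :: "('a::real_inner \<Rightarrow> real) \<Rightarrow> 'a \<Rightarrow> 'a \<Rightarrow> bool" where
  "proximal_subgradient \<phi> z \<xi> \<longleftrightarrow>
     (\<exists>K \<delta>. 0 < \<delta> \<and> (\<forall>y. norm (y - z) < \<delta> \<longrightarrow> \<phi> z + inner \<xi> (y - z) - K * (norm (y - z))\<^sup>2 \<le> \<phi> y))"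

text \<open>
  Minimise \<open>\<phi>(x + \<tau> q + u) - c \<tau> + K |u|\<^sup>2\<close> over \<open>\<tau> \<in> [0, 1]\<close> and small \<open>u\<close>. Large \<open>K\<close> keeps \<open>u\<close> small, so that the gain
  \<open>\<phi>(x + q) - \<phi> x > c\<close> excludes \<open>\<tau> = 1\<close>. At a minimiser, stationarity in \<open>u\<close> makes \<open>\<xi> = - 2 K u\<close> a proximal
  subgradient, and moving \<open>\<tau>\<close> upwards while keeping the point fixed gives \<open>\<langle>\<xi>, q\<rangle> \<ge> c\<close>.
\<close>

lemma mean_value_proximal_subgradient:
  fixes \<phi> :: "'a::euclidean_space \<Rightarrow> real"
  assumes "0 < \<eta>"
    and cont: "continuous_on {x + \<tau> *\<^sub>R q + u | \<tau> u. \<tau> \<in> {0..1} \<and> u \<in> cball 0 \<eta>} \<phi>"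
    and gt: "\<phi> (x + q) - \<phi> x > c"
  shows "\<exists>\<tau>\<in>{0..1}. \<exists>z \<xi>. norm (z - (x + \<tau> *\<^sub>R q)) < \<eta> \<and> c \<le> inner \<xi> q \<and> proximal_subgradient \<phi> z \<xi>"
proof -
  define T where "T = {0..1::real} \<times> cball (0::'a) \<eta>"
  define S where "S = {x + \<tau> *\<^sub>R q + u | \<tau> u. \<tau> \<in> {0..1} \<and> u \<in> cball 0 \<eta>}"
  define p where "p = (\<lambda>(\<tau>, u). x + \<tau> *\<^sub>R q + u)"
  have "p (\<tau>, u) \<in> S" if "(\<tau>, u) \<in> T" for \<tau> u
    using that unfolding p_def T_def S_def prod.case mem_Times_iff fst_conv snd_conv by blast
  then have pS: "p ` T \<subseteq> S" by auto
  have contp: "continuous_on T p" unfolding p_def case_prod_beta by (intro continuous_intros)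
  have contT: "continuous_on T (\<lambda>a. \<phi> (p a))"
    using cont contp pS unfolding S_def[symmetric] by (rule continuous_on_compose2)
  have compT: "compact T" unfolding T_def by (intro compact_Times) auto
  have "bounded ((\<lambda>a. \<phi> (p a)) ` T)"
    using compact_continuous_image[OF contT compT] by (rule compact_imp_bounded)
  then obtain B where B: "\<And>a. a \<in> T \<Longrightarrow> \<bar>\<phi> (p a)\<bar> \<le> B" unfolding bounded_iff by auto
  have "continuous_on (cball 0 \<eta>) (\<lambda>u. \<phi> (p (1, u)))"
    by (rule continuous_on_compose2[OF contT]) (auto intro!: continuous_on_Pair continuous_on_const continuous_on_id simp: T_def)
  then have "continuous_on (cball 0 \<eta>) (\<lambda>u. \<phi> (x + q + u))" by (simp add: p_def)
  moreover have "(0::'a) \<in> cball 0 \<eta>" using \<open>0 < \<eta>\<close> by simp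
  ultimately have "\<forall>e>0. \<exists>d>0. \<forall>u\<in>cball 0 \<eta>. dist u 0 < d \<longrightarrow>
      dist (\<phi> (x + q + u)) (\<phi> (x + q + 0)) < e"
    unfolding continuous_on_iff by (rule bspec)
  moreover have "\<phi> (x + q) - \<phi> x - c > 0" using gt by simp
  ultimately have "\<exists>d>0. \<forall>u\<in>cball 0 \<eta>. dist u 0 < d \<longrightarrow>
      dist (\<phi> (x + q + u)) (\<phi> (x + q + 0)) < \<phi> (x + q) - \<phi> x - c" by blast
  then obtain d where "d > 0"
    and d: "\<And>u. norm u \<le> \<eta> \<Longrightarrow> norm u < d \<Longrightarrow> \<phi> (x + q + u) - c > \<phi> x"
    by (force simp: dist_real_def)
  define \<eta>1 where "\<eta>1 = min \<eta> d"
  have \<eta>1: "\<eta>1 > 0" using \<open>d > 0\<close> \<open>0 < \<eta>\<close> by (simp add: \<eta>1_def)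
  define K where "K = (2 * B + \<bar>c\<bar> + 1) / \<eta>1\<^sup>2"
  define \<Phi> where "\<Phi> a = \<phi> (p a) - c * fst a + K * (norm (snd a))\<^sup>2" for a
  have contPhi: "continuous_on T \<Phi>"
    unfolding \<Phi>_def by (intro continuous_intros contT)
  have "T \<noteq> {}" using \<open>0 < \<eta>\<close> by (auto simp: T_def)
  then obtain a where a: "a \<in> T" "\<And>b. b \<in> T \<Longrightarrow> \<Phi> a \<le> \<Phi> b"
    using continuous_attains_inf[OF compT _ contPhi] by blast
  obtain \<tau> u where au: "a = (\<tau>, u)" by force
  have tu: "\<tau> \<in> {0..1}" "norm u \<le> \<eta>" using a(1) by (auto simp: au T_def)
  have B0: "B \<ge> 0" using B[OF a(1)] by simp
  have Kpos: "K > 0" using \<eta>1 B0 by (simp add: K_def)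
  have T0: "(0, 0) \<in> T" using \<open>0 < \<eta>\<close> by (simp add: T_def)
  have le0: "\<Phi> a \<le> \<phi> x" using a(2)[OF T0] by (simp add: \<Phi>_def p_def)
  have usmall: "norm u < \<eta>1"
  proof -
    have "K * (norm u)\<^sup>2 \<le> \<phi> x - \<phi> (p a) + c * \<tau>" using le0 by (simp add: \<Phi>_def au)
    also have "\<dots> \<le> 2 * B + \<bar>c\<bar>"
    proof -
      have "c * \<tau> \<le> \<bar>c\<bar> * 1"
        using tu(1) mult_mono[of c "\<bar>c\<bar>" \<tau> 1] by simp
      then show ?thesis using B[OF a(1)] B[OF T0] by (simp add: p_def)
    qed
    also have "\<dots> < K * \<eta>1\<^sup>2" using \<eta>1 by (simp add: K_def)
    finally have "(norm u)\<^sup>2 < \<eta>1\<^sup>2" using Kpos by simp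
    then show ?thesis using \<eta>1 by (simp add: power2_less_imp_less)
  qed
  \<comment> \<open>The endpoint is too expensive: at \<open>\<tau> = 1\<close> the objective exceeds its value \<open>\<phi> x\<close> at \<open>\<tau> = 0\<close>, \<open>u = 0\<close>.\<close>
  have tau1: "\<tau> < 1"
  proof (rule ccontr)
    assume "\<not> \<tau> < 1"
    then have "\<tau> = 1" using tu(1) by simp
    then have "\<phi> (x + q + u) - c + K * (norm u)\<^sup>2 \<le> \<phi> x" using le0 by (simp add: \<Phi>_def au p_def)
    moreover have "\<phi> (x + q + u) - c > \<phi> x" using usmall by (intro d) (auto simp: \<eta>1_def)
    ultimately show False using Kpos by (smt (verit) mult_nonneg_nonneg zero_le_power2)
  qed
  define z where "z = x + \<tau> *\<^sub>R q + u"
  define \<xi> where "\<xi> = - (2 * K) *\<^sub>R u"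
  have sub: "\<phi> y \<ge> \<phi> z + inner \<xi> (y - z) - K * (norm (y - z))\<^sup>2" if y: "norm (y - z) < \<eta> - norm u" for y
  proof -
    have "norm (u + (y - z)) \<le> \<eta>" using y norm_triangle_ineq[of u "y - z"] by simp
    then have "(\<tau>, u + (y - z)) \<in> T" using tu by (simp add: T_def)
    from a(2)[OF this] have "\<phi> z + K * (norm u)\<^sup>2 \<le> \<phi> y + K * (norm (u + (y - z)))\<^sup>2"
      by (simp add: \<Phi>_def au p_def z_def algebra_simps)
    moreover have "K * (norm (u + (y - z)))\<^sup>2
        = K * (norm u)\<^sup>2 + 2 * K * inner u (y - z) + K * (norm (y - z))\<^sup>2"
      unfolding power2_norm_eq_inner by (simp only: inner_add inner_commute[of "y - z" u] distrib_left)
    ultimately show ?thesis by (simp add: \<xi>_def)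
  qed
  have xi: "inner \<xi> q \<ge> c"
  proof (rule tendsto_le[OF trivial_limit_at_right_real])
    define s0 where "s0 = min (1 - \<tau>) ((\<eta> - norm u) / (norm q + 1))"
    have nq: "norm q + 1 > 0" by (smt (verit) norm_ge_zero)
    have s0: "s0 > 0" using tau1 usmall nq by (simp add: s0_def \<eta>1_def)
    show "\<forall>\<^sub>F s in at_right 0. c \<le> inner \<xi> q + s * (K * (norm q)\<^sup>2)"
    proof (rule eventually_at_rightI[OF _ s0])
      fix s assume "s \<in> {0<..<s0}"
      then have s: "0 < s" "s < 1 - \<tau>" "s * (norm q + 1) < \<eta> - norm u"
        using nq by (auto simp: s0_def less_divide_eq)
      have "norm (u - s *\<^sub>R q) \<le> norm u + s * norm q"
        using norm_triangle_ineq4[of u "s *\<^sub>R q"] s(1) by simp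
      also have "\<dots> \<le> \<eta>" using s by (simp add: algebra_simps)
      finally have "(\<tau> + s, u - s *\<^sub>R q) \<in> T" using s tu by (simp add: T_def)
      from a(2)[OF this] have "- c * \<tau> + K * (norm u)\<^sup>2 \<le> - c * (\<tau> + s) + K * (norm (u - s *\<^sub>R q))\<^sup>2"
        by (simp add: \<Phi>_def au p_def algebra_simps)
      moreover have "K * (norm (u - s *\<^sub>R q))\<^sup>2
          = K * (norm u)\<^sup>2 - 2 * K * (s * inner u q) + K * (s * (s * (norm q)\<^sup>2))"
        unfolding power2_norm_eq_inner
        by (simp add: inner_diff inner_commute[of q u] algebra_simps)
      moreover have "s * inner \<xi> q = - 2 * K * (s * inner u q)" by (simp add: \<xi>_def)
      ultimately have "s * c \<le> s * (inner \<xi> q + s * (K * (norm q)\<^sup>2))"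
        by (simp add: distrib_left mult.left_commute mult.commute[of s c])
      then show "c \<le> inner \<xi> q + s * (K * (norm q)\<^sup>2)" using s(1) by simp
    qed
    have "((\<lambda>s. inner \<xi> q + s * (K * (norm q)\<^sup>2)) \<longlongrightarrow> inner \<xi> q + 0 * (K * (norm q)\<^sup>2)) (at_right 0)"
      by (intro tendsto_intros)
    then show "((\<lambda>s. inner \<xi> q + s * (K * (norm q)\<^sup>2)) \<longlongrightarrow> inner \<xi> q) (at_right 0)" by simp
  qed auto
  have "proximal_subgradient \<phi> z \<xi>"
    unfolding proximal_subgradient_def
    using sub usmall by (intro exI[of _ K] exI[of _ "\<eta> - norm u"]) (auto simp: \<eta>1_def)
  moreover have "norm (z - (x + \<tau> *\<^sub>R q)) < \<eta>" using usmall by (simp add: z_def \<eta>1_def)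
  ultimately show ?thesis using tu(1) xi by blast
qed

section \<open>Isolated points in the fibres of Lipschitz open maps\<close>

text \<open>
  The balls of radius \<open>\<sigma> / 2\<close> around the points are disjoint and lie in the ball of radius \<open>2 \<rho>\<close>; compare volumes.
\<close>

lemma card_separated_le:
  fixes C :: "'a::euclidean_space set"
  assumes "finite C" "C \<subseteq> ball z0 \<rho>" "0 < \<sigma>" "\<sigma> \<le> \<rho>"
    and sep: "\<And>a b. a \<in> C \<Longrightarrow> b \<in> C \<Longrightarrow> a \<noteq> b \<Longrightarrow> \<sigma> \<le> dist a b"
  shows "real (card C) * \<sigma> ^ DIM('a) \<le> (4 * \<rho>) ^ DIM('a)"
proof -
  let ?u = "unit_ball_vol (real DIM('a))"
  let ?B = "\<lambda>c. ball c (\<sigma> / 2)"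
  have "disjoint_family_on ?B C"
    unfolding disjoint_family_on_def
  proof (intro ballI impI equals0I)
    fix a b y assume "a \<in> C" "b \<in> C" "a \<noteq> b" "y \<in> ?B a \<inter> ?B b"
    then show False
      using sep[of a b] dist_triangle[of a b y] by (simp add: dist_commute)
  qed
  then have "measure lborel (\<Union>c\<in>C. ?B c) = (\<Sum>c\<in>C. measure lborel (?B c))"
    using \<open>finite C\<close> \<open>0 < \<sigma>\<close> by (intro measure_finite_Union) (auto simp: emeasure_ball)
  also have "\<dots> = real (card C) * (?u * (\<sigma> / 2) ^ DIM('a))"
    using \<open>0 < \<sigma>\<close> by (simp add: content_ball)
  finally have "real (card C) * (?u * (\<sigma> / 2) ^ DIM('a)) = measure lborel (\<Union>c\<in>C. ?B c)" ..
  also have "\<dots> \<le> measure lborel (ball z0 (2 * \<rho>))"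
  proof (rule measure_mono_fmeasurable)
    show "(\<Union>c\<in>C. ?B c) \<subseteq> ball z0 (2 * \<rho>)"
    proof (clarsimp)
      fix c y assume "c \<in> C" "dist c y * 2 < \<sigma>"
      moreover from this have "dist z0 c < \<rho>" using assms(2) by auto
      ultimately show "dist z0 y < 2 * \<rho>"
        using dist_triangle[of z0 y c] assms(3,4) by linarith
    qed
    show "ball z0 (2 * \<rho>) \<in> fmeasurable lborel" 
      using assms(3,4) by (simp add: fmeasurable_def emeasure_ball)
    have "open (\<Union>c\<in>C. ?B c)" by auto
    then show "(\<Union>c\<in>C. ?B c) \<in> sets lborel" by simp
  qed
  also have "\<dots> = ?u * (2 * \<rho>) ^ DIM('a)" using assms(3,4) by (simp add: content_ball)
  finally have "?u * (real (card C) * (\<sigma> / 2) ^ DIM('a)) \<le> ?u * (2 * \<rho>) ^ DIM('a)"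
    by (simp add: algebra_simps)
  moreover have "?u > 0" by simp
  ultimately have le: "real (card C) * (\<sigma> / 2) ^ DIM('a) \<le> (2 * \<rho>) ^ DIM('a)" by simp
  have "real (card C) * \<sigma> ^ DIM('a) = (real (card C) * (\<sigma> / 2) ^ DIM('a)) * 2 ^ DIM('a)"
    by (simp add: power_divide)
  also have "\<dots> \<le> (2 * \<rho>) ^ DIM('a) * 2 ^ DIM('a)" using le by (rule mult_right_mono) simp
  also have "\<dots> = (4 * \<rho>) ^ DIM('a)" by (subst power_mult_distrib[symmetric]) simp
  finally show ?thesis .
qed

text \<open>
  A separated set of maximal cardinality is a net.
\<close>

lemma separated_net:
  fixes z0 :: "'a::euclidean_space"
  assumes "0 < \<sigma>" "\<sigma> \<le> \<rho>"
  obtains C where "finite C" "ball z0 \<rho> \<subseteq> (\<Union>c\<in>C. cball c \<sigma>)" "C \<subseteq> ball z0 \<rho>"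
    "real (card C) * \<sigma> ^ DIM('a) \<le> (4 * \<rho>) ^ DIM('a)"
proof -
  define Q where "Q C \<longleftrightarrow> finite C \<and> C \<subseteq> ball z0 \<rho> \<and> (\<forall>a\<in>C. \<forall>b\<in>C. a \<noteq> b \<longrightarrow> \<sigma> \<le> dist a b)" for C
  have bd: "real (card C) * \<sigma> ^ DIM('a) \<le> (4 * \<rho>) ^ DIM('a)" if "Q C" for C
    using that assms by (intro card_separated_le) (auto simp: Q_def)
  define b where "b = nat \<lceil>(4 * \<rho>) ^ DIM('a) / \<sigma> ^ DIM('a)\<rceil> + 1"
  have "card C < b" if "Q C" for C
  proof -
    have "real (card C) \<le> (4 * \<rho>) ^ DIM('a) / \<sigma> ^ DIM('a)"
      using bd[OF that] \<open>0 < \<sigma>\<close> by (simp add: field_simps)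
    also have "\<dots> \<le> real (nat \<lceil>(4 * \<rho>) ^ DIM('a) / \<sigma> ^ DIM('a)\<rceil>)" by (rule real_nat_ceiling_ge)
    finally show ?thesis by (simp add: b_def)
  qed
  moreover have "Q {}" by (simp add: Q_def)
  ultimately obtain C where C: "Q C" "\<And>D. Q D \<Longrightarrow> card D \<le> card C"
    using ex_has_greatest_nat[of Q "{}" card b] by metis
  have "ball z0 \<rho> \<subseteq> (\<Union>c\<in>C. cball c \<sigma>)"
  proof
    fix x assume x: "x \<in> ball z0 \<rho>"
    show "x \<in> (\<Union>c\<in>C. cball c \<sigma>)"
    proof (rule ccontr)
      assume "x \<notin> (\<Union>c\<in>C. cball c \<sigma>)"
      then have far: "\<sigma> < dist c x" if "c \<in> C" for c using that by force
      then have "x \<notin> C" using \<open>0 < \<sigma>\<close> by fastforce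
      moreover have "Q (insert x C)"
        using C(1) x far unfolding Q_def by (auto simp: dist_commute less_imp_le)
      ultimately show False using C(2)[of "insert x C"] C(1) by (auto simp: Q_def)
    qed
  qed
  then show thesis using that[of C] C(1) bd[OF C(1)] by (simp add: Q_def)
qed

text \<open>
  Without isolated points every fibre over the image is infinite, and openness makes the property of having \<open>m\<close> well separated
  preimages stable under perturbation of the value; by compactness one separation \<open>s\<close> then serves a whole ball \<open>B\<close> of values. Cover
  the domain by cells of diameter below \<open>s\<close>. Each value in \<open>B\<close> is taken in at least \<open>m\<close> cells, so the volumes of the images of the
  cells add up to at least \<open>m\<close> times the volume of \<open>B\<close>; but by the Lipschitz property their sum is bounded
  independently of \<open>m\<close>.
\<close>

lemma open_lipschitz_map_isolated_fibre_point:
  fixes F :: "'a::euclidean_space \<Rightarrow> 'a"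
  assumes "0 < \<rho>" "0 < L"
    and lip: "\<And>x y. x \<in> ball z0 \<rho> \<Longrightarrow> y \<in> ball z0 \<rho> \<Longrightarrow> norm (F x - F y) \<le> L * norm (x - y)"
    and openF: "\<And>S. open S \<Longrightarrow> S \<subseteq> ball z0 \<rho> \<Longrightarrow> open (F ` S)"
  shows "\<exists>z s. 0 < s \<and> cball z s \<subseteq> ball z0 \<rho> \<and> (\<forall>y\<in>cball z s. F y = F z \<longrightarrow> y = z)"
proof (rule ccontr)
  assume "\<not> ?thesis"
  then have neg: "\<exists>y\<in>cball z s. F y = F z \<and> y \<noteq> z" if "0 < s" "cball z s \<subseteq> ball z0 \<rho>" for z s
    using that by blast
  let ?n = "DIM('a)"
  have inf: "infinite {x \<in> ball z0 \<rho>. F x = F z}" if z: "z \<in> ball z0 \<rho>" for z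
  proof
    assume fin: "finite {x \<in> ball z0 \<rho>. F x = F z}"
    obtain d where "d > 0" and d: "\<And>x. x \<in> ball z0 \<rho> \<Longrightarrow> F x = F z \<Longrightarrow> x \<noteq> z \<Longrightarrow> d \<le> dist z x"
      using finite_set_avoid[OF fin, of z] by auto
    obtain e where "e > 0" "cball z e \<subseteq> ball z0 \<rho>"
      using z open_contains_cball[of "ball z0 \<rho>"] open_ball by blast
    then have s: "0 < min e (d / 2)" "cball z (min e (d / 2)) \<subseteq> ball z0 \<rho>"
      using \<open>d > 0\<close> by auto
    from neg[OF this] obtain y where "y \<in> cball z (min e (d / 2))" "F y = F z" "y \<noteq> z" by blast
    with s(2) d[of y] \<open>d > 0\<close> show False by (auto simp: subset_iff)
  qed
  \<comment> \<open>\<open>H m s y\<close>: the value \<open>y\<close> has \<open>m\<close> preimages at mutual distance at least \<open>s\<close>.\<close>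
  define H where "H m s y \<longleftrightarrow> (\<exists>Y. finite Y \<and> card Y = m \<and> Y \<subseteq> ball z0 \<rho> \<and> F ` Y \<subseteq> {y} \<and>
      (\<forall>a\<in>Y. \<forall>b\<in>Y. a \<noteq> b \<longrightarrow> s \<le> dist a b))" for m :: nat and s y
  have Hmono: "H m s' y" if Hs: "H m s y" and le: "s' \<le> s" for m s s' y
  proof -
    obtain Y where Y: "finite Y" "card Y = m" "Y \<subseteq> ball z0 \<rho>" "F ` Y \<subseteq> {y}"
      "\<forall>a\<in>Y. \<forall>b\<in>Y. a \<noteq> b \<longrightarrow> s \<le> dist a b"
      using Hs unfolding H_def by blast
    then have "\<forall>a\<in>Y. \<forall>b\<in>Y. a \<noteq> b \<longrightarrow> s' \<le> dist a b"
      using le by (meson order_trans)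
    with Y show ?thesis unfolding H_def by blast
  qed
  have loc: "\<exists>s W. 0 < s \<and> open W \<and> y \<in> W \<and> (\<forall>y'\<in>W. H m s y')" if y: "y \<in> F ` ball z0 \<rho>" for y m
  proof -
    obtain z where "z \<in> ball z0 \<rho>" "y = F z" using y by blast
    then obtain Y where Y: "finite Y" "card Y = m" "Y \<subseteq> {x \<in> ball z0 \<rho>. F x = y}"
      using infinite_arbitrarily_large[OF inf[of z]] by blast
    obtain d where d: "d > 0" "\<And>a b. a \<in> Y \<Longrightarrow> b \<in> Y \<Longrightarrow> a \<noteq> b \<Longrightarrow> d \<le> dist a b"
    proof -
      have "\<forall>a\<in>Y. \<exists>d>0. \<forall>b\<in>Y. b \<noteq> a \<longrightarrow> d \<le> dist a b"
        using finite_set_avoid[OF Y(1)] by blast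
      then obtain dd where dd: "\<And>a. a \<in> Y \<Longrightarrow> dd a > (0::real)"
        "\<And>a b. a \<in> Y \<Longrightarrow> b \<in> Y \<Longrightarrow> b \<noteq> a \<Longrightarrow> dd a \<le> dist a b" by metis
      show thesis
      proof (rule that[of "Min (insert 1 (dd ` Y))"])
        show "0 < Min (insert 1 (dd ` Y))" using dd(1) Y(1) by (subst Min_gr_iff) auto
        fix a b assume "a \<in> Y" "b \<in> Y" "a \<noteq> b"
        moreover from this have "Min (insert 1 (dd ` Y)) \<le> dd a" using Y(1) by (intro Min_le) auto
        ultimately show "Min (insert 1 (dd ` Y)) \<le> dist a b" using dd(2)[of a b] by force
      qed
    qed
    define B where "B a = ball a (d / 4) \<inter> ball z0 \<rho>" for a
    define W where "W = (\<Inter>a\<in>Y. F ` B a)"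
    have "open W" unfolding W_def using Y(1)
      by (intro open_INT) (auto simp: B_def intro!: openF)
    moreover have "y \<in> W" using Y(3) d(1) by (force simp: W_def B_def)
    moreover have "H m (d / 2) y'" if "y' \<in> W" for y'
    proof -
      have "\<forall>a\<in>Y. \<exists>x. x \<in> B a \<and> F x = y'" using that by (force simp: W_def)
      then obtain h where h: "\<And>a. a \<in> Y \<Longrightarrow> h a \<in> B a" "\<And>a. a \<in> Y \<Longrightarrow> F (h a) = y'" by metis
      have sep: "d / 2 \<le> dist (h a) (h b)" if "a \<in> Y" "b \<in> Y" "a \<noteq> b" for a b
      proof -
        have "dist a (h a) < d / 4" "dist b (h b) < d / 4" using h(1) that by (auto simp: B_def)
        then show ?thesis
          using d(2)[OF that] dist_triangle[of a b "h a"] dist_triangle[of "h a" b "h b"]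
          by (simp add: dist_commute)
      qed
      have "inj_on h Y" using sep d(1) by (force intro!: inj_onI)
      then have "card (h ` Y) = m" using Y(2) by (simp add: card_image)
      then show ?thesis unfolding H_def using Y(1) h sep
        by (intro exI[of _ "h ` Y"]) (auto simp: B_def)
    qed
    ultimately show ?thesis using d(1) by (intro exI[of _ "d / 2"] exI[of _ W]) auto
  qed
  have "open (F ` ball z0 \<rho>)" by (rule openF) auto
  moreover have "F z0 \<in> F ` ball z0 \<rho>" using \<open>0 < \<rho>\<close> by simp
  ultimately obtain \<tau> where \<tau>: "0 < \<tau>" "cball (F z0) \<tau> \<subseteq> F ` ball z0 \<rho>"
    using open_contains_cball by blast
  have bound: "real m * \<tau> ^ ?n \<le> (4 * L * \<rho>) ^ ?n" for m :: nat
  proof -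
    have "\<forall>y\<in>cball (F z0) \<tau>. \<exists>s W. 0 < s \<and> open W \<and> y \<in> W \<and> (\<forall>y'\<in>W. H m s y')"
      using loc \<tau>(2) by blast
    then obtain s W where sW: "\<And>y. y \<in> cball (F z0) \<tau> \<Longrightarrow> 0 < s y \<and> open (W y) \<and> y \<in> W y \<and> (\<forall>y'\<in>W y. H m (s y) y')"
      by metis
    obtain T where T: "T \<subseteq> cball (F z0) \<tau>" "finite T" "cball (F z0) \<tau> \<subseteq> (\<Union>y\<in>T. W y)"
      by (rule compactE_image[OF compact_cball, of "cball (F z0) \<tau>" W]) (use sW in auto)
    define s0 where "s0 = Min (insert \<rho> (s ` T))"
    have s0: "0 < s0" unfolding s0_def using T sW \<open>0 < \<rho>\<close> by (subst Min_gr_iff) auto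
    have Hs0: "H m s0 y" if "y \<in> cball (F z0) \<tau>" for y
    proof -
      obtain t where t: "t \<in> T" "y \<in> W t" using T(3) \<open>y \<in> cball (F z0) \<tau>\<close> by blast
      then have "H m (s t) y" using sW T(1) by blast
      moreover have "s0 \<le> s t" unfolding s0_def using T(2) t(1) by (intro Min_le) auto
      ultimately show ?thesis by (rule Hmono)
    qed
    \<comment> \<open>Two points in a ball of radius \<open>s0 / 3\<close> are closer than \<open>s0\<close>, so separated preimages lie in different cells.\<close>
    define \<sigma> where "\<sigma> = s0 / 3"
    have \<sigma>: "0 < \<sigma>" "\<sigma> \<le> \<rho>" "2 * \<sigma> < s0"
    proof -
      have "s0 \<le> \<rho>" unfolding s0_def using T(2) by (intro Min_le) auto
      then show "0 < \<sigma>" "\<sigma> \<le> \<rho>" "2 * \<sigma> < s0" using s0 by (auto simp: \<sigma>_def)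
    qed
    obtain C where C: "finite C" "ball z0 \<rho> \<subseteq> (\<Union>c\<in>C. cball c \<sigma>)" "C \<subseteq> ball z0 \<rho>"
      "real (card C) * \<sigma> ^ ?n \<le> (4 * \<rho>) ^ ?n"
      using separated_net[OF \<sigma>(1,2)] by metis
    let ?I = "\<lambda>c y. indicator (cball (F c) (L * \<sigma>)) y :: real"
    \<comment> \<open>Pointwise form of the count; integrating it compares the volumes.\<close>
    have count: "real m * indicator (cball (F z0) \<tau>) y \<le> (\<Sum>c\<in>C. ?I c y)" for y
    proof (cases "y \<in> cball (F z0) \<tau>")
      case True
      have "\<exists>Y. finite Y \<and> card Y = m \<and> Y \<subseteq> ball z0 \<rho> \<and> F ` Y \<subseteq> {y} \<and>
          (\<forall>a\<in>Y. \<forall>b\<in>Y. a \<noteq> b \<longrightarrow> s0 \<le> dist a b)"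
        using Hs0[OF True] unfolding H_def .
      then obtain Y where Y: "finite Y" "card Y = m" "Y \<subseteq> ball z0 \<rho>" "F ` Y \<subseteq> {y}"
        and Y5: "\<forall>a\<in>Y. \<forall>b\<in>Y. a \<noteq> b \<longrightarrow> s0 \<le> dist a b"
        by (elim exE conjE)
      have "\<forall>a\<in>Y. \<exists>c\<in>C. a \<in> cball c \<sigma>" using Y(3) C(2) by blast
      then obtain c where c: "\<And>a. a \<in> Y \<Longrightarrow> c a \<in> C" "\<And>a. a \<in> Y \<Longrightarrow> a \<in> cball (c a) \<sigma>" by metis
      have "inj_on c Y"
      proof (rule inj_onI, rule ccontr)
        fix a b assume ab: "a \<in> Y" "b \<in> Y" "c a = c b" "a \<noteq> b"
        then have "dist a b \<le> 2 * \<sigma>"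
          using c(2)[of a] c(2)[of b] dist_triangle[of a b "c a"] by (simp add: dist_commute)
        then show False using Y5 ab \<sigma>(3) by force
      qed
      moreover have "y \<in> cball (F (c a)) (L * \<sigma>)" if "a \<in> Y" for a
      proof -
        have "norm (F (c a) - F a) \<le> L * norm (c a - a)"
          using c(1)[OF that] C(3) Y(3) that by (intro lip) auto
        also have "\<dots> \<le> L * \<sigma>" using c(2)[OF that] \<open>0 < L\<close> by (simp add: dist_norm)
        finally show ?thesis using Y(4) that by (auto simp: dist_norm)
      qed
      ultimately have "real m \<le> (\<Sum>k\<in>c ` Y. ?I k y)"
        using Y(2) by (simp add: sum.reindex)
      also have "\<dots> \<le> (\<Sum>k\<in>C. ?I k y)"
        using C(1) c(1) by (intro sum_mono2) auto
      finally show ?thesis using True by simp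
    qed (simp add: sum_nonneg)
    have int: "integrable lborel (\<lambda>y. indicator (cball a t) y :: real)" for a :: 'a and t
      using emeasure_compact_finite[OF compact_cball, of a t]
      by (intro integrable_real_indicator) auto
    have "real m * measure lborel (cball (F z0) \<tau>) = (\<integral>y. real m * indicator (cball (F z0) \<tau>) y \<partial>lborel)"
      by simp
    also have "\<dots> \<le> (\<integral>y. (\<Sum>c\<in>C. ?I c y) \<partial>lborel)"
      by (intro integral_mono integrable_mult_right Bochner_Integration.integrable_sum int count)
    also have "\<dots> = (\<Sum>c\<in>C. measure lborel (cball (F c) (L * \<sigma>)))"
      by (subst Bochner_Integration.integral_sum) (auto intro: int)
    finally have "real m * (unit_ball_vol ?n * \<tau> ^ ?n) \<le> real (card C) * (unit_ball_vol ?n * (L * \<sigma>) ^ ?n)"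
      using \<tau>(1) \<sigma>(1) \<open>0 < L\<close> by (simp add: content_cball)
    then have "unit_ball_vol ?n * (real m * \<tau> ^ ?n) \<le> unit_ball_vol ?n * (real (card C) * (L * \<sigma>) ^ ?n)"
      by (simp add: algebra_simps)
    moreover have "unit_ball_vol (real ?n) > 0" by simp
    ultimately have "real m * \<tau> ^ ?n \<le> real (card C) * (L * \<sigma>) ^ ?n" by simp
    also have "\<dots> = L ^ ?n * (real (card C) * \<sigma> ^ ?n)" by (simp add: power_mult_distrib)
    also have "\<dots> \<le> L ^ ?n * (4 * \<rho>) ^ ?n" using C(4) \<open>0 < L\<close> by (intro mult_left_mono) auto
    also have "\<dots> = (4 * L * \<rho>) ^ ?n" by (simp add: power_mult_distrib)
    finally show ?thesis .
  qed
  have "\<tau> ^ ?n > 0" using \<tau>(1) by simp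
  then obtain m :: nat where "(4 * L * \<rho>) ^ ?n < real m * \<tau> ^ ?n"
    using reals_Archimedean3 by blast
  with bound[of m] show False by simp
qed

section \<open>Subgradients of weakly convex functions\<close>

lemma proximal_subgradient_in_subdifferential:
  fixes g :: "'a::real_inner \<Rightarrow> ereal"
  assumes fin: "g x = ereal \<gamma>" and "0 \<le> K"
    and low: "\<And>y. ereal (\<gamma> + inner v (y - x) - K * (norm (y - x))\<^sup>2) \<le> g y"
  shows "v \<in> subdifferential g x"
proof -
  have "(v, -1) \<in> regular_normal_cone (epi g) (x, \<gamma>)"
  proof (rule regular_normal_coneI_quadratic[where K = K])
    show "(x, \<gamma>) \<in> epi g" using fin by (simp add: epi_def)
    fix w assume "w \<in> epi g"
    then obtain y \<alpha> where w: "w = (y, \<alpha>)" "g y \<le> ereal \<alpha>" by (auto simp: epi_def)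
    have "ereal (\<gamma> + inner v (y - x) - K * (norm (y - x))\<^sup>2) \<le> ereal \<alpha>"
      by (rule order_trans[OF low w(2)])
    then have "inner (v, -1) (w - (x, \<gamma>)) \<le> K * (norm (y - x))\<^sup>2" by (simp add: w)
    also have "\<dots> \<le> K * (norm (w - (x, \<gamma>)))\<^sup>2"
      using norm_fst_le[of "y - x" "\<alpha> - \<gamma>"] \<open>0 \<le> K\<close>
      by (intro mult_left_mono power_mono) (auto simp: w)
    finally show "inner (v, -1) (w - (x, \<gamma>)) \<le> K * (norm (w - (x, \<gamma>)))\<^sup>2" .
  qed (rule zero_less_one)
  then have "(v, -1) \<in> limiting_normal_cone (epi g) (x, \<gamma>)"
    using regular_normal_cone_subset_limiting by blast
  then show ?thesis using fin by (simp add: subdifferential_def edom_def)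
qed

text \<open>
  Regular normals of the epigraph are tested along the curve that becomes a segment after subtraction of \<open>s/2 |\<cdot>|\<^sup>2\<close>; the
  resulting global inequality is stable under limits of points and normals.
\<close>

lemma s_convex_subgradient_inequality:
  fixes h :: "'a::real_inner \<Rightarrow> ereal"
  assumes cvx: "s_convex s h" and v: "v \<in> subdifferential h x" and y: "h y = ereal \<gamma>"
  shows "real_of_ereal (h x) + inner v (y - x) + s / 2 * (norm (y - x))\<^sup>2 \<le> \<gamma>"
proof -
  define q where "q z = s / 2 * (norm z)\<^sup>2" for z :: 'a
  let ?C = "epi (\<lambda>z. h z - ereal (q z))"
  have C: "convex ?C" using cvx by (simp add: s_convex_def q_def)
  have C_iff: "(z, \<alpha> - q z) \<in> ?C \<longleftrightarrow> (z, \<alpha>) \<in> epi h" for z \<alpha>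
    by (cases "h z") (auto simp: epi_def)
  let ?x = "(x, real_of_ereal (h x))"
  obtain z n where z: "z \<longlonglongrightarrow> ?x" "\<And>k. z k \<in> epi h" and n: "n \<longlonglongrightarrow> (v, -1)"
    and zn: "\<And>k. n k \<in> regular_normal_cone (epi h) (z k)"
    using v unfolding subdifferential_def limiting_normal_cone_def by auto
  have reg: "inner (fst m) (y - x') + snd m * (\<gamma> - \<alpha>' - s / 2 * (norm (y - x'))\<^sup>2) \<le> 0"
    if m: "m \<in> regular_normal_cone (epi h) (x', \<alpha>')" for m x' \<alpha>'
  proof -
    define D where "D = (norm (y - x'))\<^sup>2"
    define A where "A t = inner (fst m) (y - x') + snd m * (\<gamma> - \<alpha>' - s / 2 * (1 - t) * D)" for t
    define R where "R = norm (y - x') + \<bar>\<gamma> - \<alpha>'\<bar> + \<bar>s / 2 * D\<bar> + 1"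
    have R: "R > 0" unfolding R_def by (smt (verit) norm_ge_zero)
    have mem: "(x', \<alpha>') \<in> epi h" using m by (simp add: regular_normal_cone_iff)
    \<comment> \<open>A segment in the convex epigraph, lifted back to the epigraph of \<open>h\<close>.\<close>
    have path: "(x' + t *\<^sub>R (y - x'), \<alpha>' + t * (\<gamma> - \<alpha>' - s / 2 * (1 - t) * D)) \<in> epi h"
      if t: "0 \<le> t" "t \<le> 1" for t
    proof -
      have "(1 - t) *\<^sub>R (x', \<alpha>' - q x') + t *\<^sub>R (y, \<gamma> - q y) \<in> ?C"
      proof (rule convexD[OF C])
        show "(x', \<alpha>' - q x') \<in> ?C" using mem by (simp add: C_iff)
        have "(y, \<gamma>) \<in> epi h" using y by (simp add: epi_def)
        then show "(y, \<gamma> - q y) \<in> ?C" by (simp add: C_iff)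
      qed (use t in auto)
      moreover have "(1 - t) *\<^sub>R (x', \<alpha>' - q x') + t *\<^sub>R (y, \<gamma> - q y) =
        (x' + t *\<^sub>R (y - x'), \<alpha>' + t * (\<gamma> - \<alpha>' - s / 2 * (1 - t) * D) - q (x' + t *\<^sub>R (y - x')))"
        unfolding D_def q_def power2_norm_eq_inner
        by (simp add: algebra_simps inner_commute power2_eq_square)
           (simp add: field_simps)
      ultimately show ?thesis by (simp add: C_iff)
    qed
    have "A 0 \<le> e * R" if "e > 0" for e
    proof (rule tendsto_upperbound)
      have "(A \<longlongrightarrow> inner (fst m) (y - x') + snd m * (\<gamma> - \<alpha>' - s / 2 * (1 - 0) * D)) (at_right 0)"
        unfolding A_def by (intro tendsto_intros)
      then show "(A \<longlongrightarrow> A 0) (at_right 0)" by (simp add: A_def)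
      obtain \<delta> where "\<delta> > 0" and \<delta>: "\<And>w. w \<in> epi h \<Longrightarrow> dist w (x', \<alpha>') < \<delta> \<Longrightarrow>
          inner m (w - (x', \<alpha>')) \<le> e * norm (w - (x', \<alpha>'))"
        using m \<open>e > 0\<close> unfolding regular_normal_cone_iff by metis
      have "min 1 (\<delta> / R) > 0" using \<open>\<delta> > 0\<close> R by simp
      then show "\<forall>\<^sub>F t in at_right 0. A t \<le> e * R"
      proof (rule eventually_at_rightI[rotated])
        fix t assume "t \<in> {0<..<min 1 (\<delta> / R)}"
        then have t: "0 < t" "t < 1" "t * R < \<delta>" using R by (auto simp: less_divide_eq)
        let ?w = "(x' + t *\<^sub>R (y - x'), \<alpha>' + t * (\<gamma> - \<alpha>' - s / 2 * (1 - t) * D))"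
        have w: "?w - (x', \<alpha>') = t *\<^sub>R (y - x', \<gamma> - \<alpha>' - s / 2 * (1 - t) * D)" by simp
        have "norm (y - x', \<gamma> - \<alpha>' - s / 2 * (1 - t) * D) \<le>
            norm (y - x') + \<bar>\<gamma> - \<alpha>' - s / 2 * (1 - t) * D\<bar>"
          using norm_Pair_le[of "y - x'" "\<gamma> - \<alpha>' - s / 2 * (1 - t) * D"] by simp
        also have "\<bar>\<gamma> - \<alpha>' - s / 2 * (1 - t) * D\<bar> \<le> \<bar>\<gamma> - \<alpha>'\<bar> + \<bar>s / 2 * (1 - t) * D\<bar>"
          by (rule abs_triangle_ineq4)
        also have "\<bar>s / 2 * (1 - t) * D\<bar> = (1 - t) * \<bar>s / 2 * D\<bar>"
          using t by (simp add: abs_mult)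
        also have "\<dots> \<le> 1 * \<bar>s / 2 * D\<bar>" using t by (intro mult_right_mono) auto
        finally have "norm (y - x', \<gamma> - \<alpha>' - s / 2 * (1 - t) * D) \<le> R" by (simp add: R_def)
        then have nw: "norm (?w - (x', \<alpha>')) \<le> t * R"
          unfolding w norm_scaleR using t(1) by simp
        have "t * A t = inner m (?w - (x', \<alpha>'))"
          unfolding w by (cases m) (simp add: A_def distrib_left mult.left_commute[of t])
        also have "\<dots> \<le> e * norm (?w - (x', \<alpha>'))"
          using path[of t] t nw by (intro \<delta>) (auto simp: dist_norm)
        also have "\<dots> \<le> e * (t * R)" using nw \<open>e > 0\<close> by (intro mult_left_mono) auto
        finally have "t * A t \<le> t * (e * R)" by (simp add: mult.left_commute)
        then show "A t \<le> e * R" using t(1) by simp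
      qed
    qed simp
    from this[of "e / R" for e] have "A 0 \<le> 0 + e" if "e > 0" for e
      using that R by simp
    then have "A 0 \<le> 0" by (rule field_le_epsilon)
    then show ?thesis by (simp add: A_def D_def)
  qed
  let ?f = "\<lambda>m w. inner (fst m) (y - fst w) + snd m * (\<gamma> - snd w - s / 2 * (norm (y - fst w))\<^sup>2)"
  have "(\<lambda>k. ?f (n k) (z k)) \<longlonglongrightarrow> ?f (v, -1) ?x"
    by (intro tendsto_intros n z(1))
  moreover have "?f (n k) (z k) \<le> 0" for k
    using reg[of "n k" "fst (z k)" "snd (z k)"] zn by simp
  ultimately have "?f (v, -1) ?x \<le> 0" by (intro LIMSEQ_le_const2) auto
  then show ?thesis by simp
qed

definition hypomonotone_on :: "real \<Rightarrow> ('a::real_inner \<times> 'a) set \<Rightarrow> bool" where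
  "hypomonotone_on r A \<longleftrightarrow>
     (\<forall>x v x' v'. (x, v) \<in> A \<longrightarrow> (x', v') \<in> A \<longrightarrow> - r * (norm (x - x'))\<^sup>2 \<le> inner (v - v') (x - x'))"

lemma s_convex_subdifferential_monotone:
  fixes h :: "'a::real_inner \<Rightarrow> ereal"
  assumes cvx: "s_convex s h" and v: "v \<in> subdifferential h x" "v' \<in> subdifferential h x'"
  shows "s * (norm (x - x'))\<^sup>2 \<le> inner (v - v') (x - x')"
proof -
  have fin: "h z = ereal (real_of_ereal (h z))" if "w \<in> subdifferential h z" for w z
    using that cvx unfolding subdifferential_def edom_def s_convex_def
    by (cases "h z") auto
  have "real_of_ereal (h x) + inner v (x' - x) + s / 2 * (norm (x' - x))\<^sup>2 \<le> real_of_ereal (h x')"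
    by (rule s_convex_subgradient_inequality[OF cvx v(1) fin[OF v(2)]])
  moreover have "real_of_ereal (h x') + inner v' (x - x') + s / 2 * (norm (x - x'))\<^sup>2 \<le> real_of_ereal (h x)"
    by (rule s_convex_subgradient_inequality[OF cvx v(2) fin[OF v(1)]])
  ultimately show ?thesis
    by (simp add: norm_minus_commute inner_diff)
qed

text \<open>
  Subdifferential continuity supplies the level condition \<open>g x < g xb + \<epsilon>\<close>, so near \<open>(xb, vb)\<close> the graph of \<open>\<partial>g\<close> is
  contained in the graph of the subdifferential of a function that becomes convex after adding \<open>r/2 |\<cdot>|\<^sup>2\<close>.
\<close>

lemma level_prox_regular_hypomonotone:
  fixes g :: "'a::real_inner \<Rightarrow> ereal"
  assumes "continuously_level_prox_regular r g xb vb" and "proper g"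
  shows "\<exists>\<delta>>0. hypomonotone_on r (gph (subdifferential g) \<inter> (ball xb \<delta> \<times> ball vb \<delta>))"
proof -
  have vs: "variationally_s_convex (- r) g xb vb" and sc: "subdifferentially_continuous g xb vb"
    using assms(1) by (auto simp: continuously_level_prox_regular_def level_prox_regular_def)
  obtain gh U V \<epsilon> where gh: "s_convex (- r) gh" "open U" "xb \<in> U" "open V" "vb \<in> V" "0 < (\<epsilon>::real)"
    and eq: "(U \<times> V) \<inter> gph (subdifferential gh) =
          ({x \<in> U. g x < g xb + ereal \<epsilon>} \<times> V) \<inter> gph (subdifferential g)"
    and vb: "vb \<in> subdifferential g xb"
    using vs unfolding variationally_s_convex_def by blast
  obtain \<gamma> where \<gamma>: "g xb = ereal \<gamma>"
    using vb \<open>proper g\<close> by (cases "g xb") (auto simp: subdifferential_def edom_def proper_def)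
  obtain \<delta>1 where \<delta>1: "\<delta>1 > 0" "\<And>x v. (x, v) \<in> gph (subdifferential g) \<Longrightarrow> norm (x - xb) \<le> \<delta>1 \<Longrightarrow>
      norm (v - vb) \<le> \<delta>1 \<Longrightarrow> \<bar>g x - g xb\<bar> < ereal \<epsilon>"
    using sc gh(6) unfolding subdifferentially_continuous_def by blast
  obtain \<rho>1 where \<rho>1: "\<rho>1 > 0" "ball xb \<rho>1 \<subseteq> U" using gh open_contains_ball by metis
  obtain \<rho>2 where \<rho>2: "\<rho>2 > 0" "ball vb \<rho>2 \<subseteq> V" using gh open_contains_ball by metis
  define \<delta> where "\<delta> = min \<delta>1 (min \<rho>1 \<rho>2)"
  have \<delta>: "\<delta> > 0" "\<delta> \<le> \<delta>1" "\<delta> \<le> \<rho>1" "\<delta> \<le> \<rho>2" using \<delta>1 \<rho>1 \<rho>2 by (auto simp: \<delta>_def)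
  have mem: "v \<in> subdifferential gh x"
    if "(x, v) \<in> gph (subdifferential g)" "norm (x - xb) < \<delta>" "norm (v - vb) < \<delta>" for x v
  proof -
    have "\<bar>g x - g xb\<bar> < ereal \<epsilon>" using that \<delta>(2) by (intro \<delta>1(2)) auto
    then have "g x < g xb + ereal \<epsilon>" unfolding \<gamma> by (cases "g x") auto
    moreover have "x \<in> U" "v \<in> V" using that \<delta> \<rho>1(2) \<rho>2(2) by (auto simp: subset_iff dist_norm norm_minus_commute)
    ultimately have "(x, v) \<in> (U \<times> V) \<inter> gph (subdifferential gh)" unfolding eq using that(1) by simp
    then show ?thesis by (simp add: gph_def)
  qed
  have "hypomonotone_on r (gph (subdifferential g) \<inter> (ball xb \<delta> \<times> ball vb \<delta>))"
    unfolding hypomonotone_on_def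
    using s_convex_subdifferential_monotone[OF gh(1) mem mem]
    by (auto simp: dist_norm norm_minus_commute)
  then show ?thesis using \<delta>(1) by blast
qed

section \<open>Gradients and Hessians of twice continuously differentiable functions\<close>

text \<open>
  The left-hand side is symmetric in \<open>h\<close> and \<open>s\<close>, the right-hand side is not: this is how the symmetry of second
  derivatives is used where \<open>E\<close> is not twice differentiable. The mean value theorem is applied to
  \<open>\<tau> \<mapsto> E (a + \<tau> h + s) - E (a + \<tau> h)\<close>.
\<close>

lemma mixed_difference_mean_value:
  fixes E :: "'a::real_inner \<Rightarrow> real"
  assumes grad: "\<And>x. x \<in> S \<Longrightarrow> (E has_derivative (\<lambda>k. inner (P x) k)) (at x)"
    and S: "\<And>\<tau>. 0 \<le> \<tau> \<Longrightarrow> \<tau> \<le> 1 \<Longrightarrow> a + \<tau> *\<^sub>R h \<in> S \<and> a + \<tau> *\<^sub>R h + s \<in> S"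
  obtains \<tau> where "0 < \<tau>" "\<tau> < 1"
    "(E (a + h + s) - E (a + h)) - (E (a + s) - E a) =
       inner (P (a + \<tau> *\<^sub>R h + s) - P (a + \<tau> *\<^sub>R h)) h"
proof -
  have chain: "((\<lambda>\<tau>. E (b + \<tau> *\<^sub>R h)) has_real_derivative inner (P (b + \<tau> *\<^sub>R h)) h) (at \<tau>)"
    if "b + \<tau> *\<^sub>R h \<in> S" for b \<tau>
  proof -
    have "((\<lambda>\<tau>. b + \<tau> *\<^sub>R h) has_derivative (\<lambda>t. t *\<^sub>R h)) (at \<tau>)"
      by (auto intro!: derivative_eq_intros)
    then have "((\<lambda>\<tau>. E (b + \<tau> *\<^sub>R h)) has_derivative (\<lambda>t. inner (P (b + \<tau> *\<^sub>R h)) (t *\<^sub>R h))) (at \<tau>)"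
      by (rule has_derivative_compose) (rule grad[OF that])
    then show ?thesis
      by (rule has_derivative_imp_has_field_derivative) (simp add: mult.commute)
  qed
  let ?\<psi> = "\<lambda>\<tau>. E ((a + s) + \<tau> *\<^sub>R h) - E (a + \<tau> *\<^sub>R h)"
  let ?d = "\<lambda>\<tau>. inner (P ((a + s) + \<tau> *\<^sub>R h)) h - inner (P (a + \<tau> *\<^sub>R h)) h"
  have "(?\<psi> has_real_derivative ?d \<tau>) (at \<tau>)" if "0 \<le> \<tau>" "\<tau> \<le> 1" for \<tau>
    using S[OF that] by (intro DERIV_diff chain) (simp_all add: add_ac)
  then obtain \<tau> where \<tau>: "0 < \<tau>" "\<tau> < 1" "?\<psi> 1 - ?\<psi> 0 = (1 - 0) * ?d \<tau>"
    using MVT2[of 0 1 ?\<psi> ?d] by auto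
  show thesis
    by (rule that[OF \<tau>(1,2)]) (use \<tau>(3) in \<open>simp add: inner_diff add_ac\<close>)
qed

text \<open>
  Strict differentiability, with the Hessian taken at any nearby point instead of the centre.
\<close>

lemma C2_gradient_strict:
  assumes "C2_smooth_with f gf Hf" "0 < \<epsilon>"
  shows "\<exists>\<delta>>0. \<forall>x y z. norm (x - a) < \<delta> \<longrightarrow> norm (y - a) < \<delta> \<longrightarrow> norm (z - a) < \<delta> \<longrightarrow>
      norm (gf y - gf z - blinfun_apply (Hf x) (y - z)) \<le> \<epsilon> * norm (y - z)"
proof -
  have der: "\<And>x. (gf has_derivative blinfun_apply (Hf x)) (at x)" and cont: "isCont Hf a"
    using assms(1) by (auto simp: C2_smooth_with_def continuous_on_eq_continuous_at)
  have "\<epsilon> / 2 > 0" using \<open>0 < \<epsilon>\<close> by simp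
  then obtain \<delta> where "\<delta> > 0" and \<delta>: "\<And>x. dist x a < \<delta> \<Longrightarrow> dist (Hf x) (Hf a) < \<epsilon> / 2"
    using cont unfolding continuous_at_eps_delta by blast
  have H: "norm (Hf x - Hf a) \<le> \<epsilon> / 2" if "norm (x - a) < \<delta>" for x
    using \<delta>[of x] that by (simp add: dist_norm)
  have "norm (gf y - gf z - blinfun_apply (Hf x) (y - z)) \<le> \<epsilon> * norm (y - z)"
    if x: "norm (x - a) < \<delta>" and y: "norm (y - a) < \<delta>" and z: "norm (z - a) < \<delta>" for x y z
  proof -
    let ?g = "\<lambda>y. gf y - blinfun_apply (Hf a) y"
    have "norm (?g y - ?g z) \<le> \<epsilon> / 2 * norm (y - z)"
    proof (rule differentiable_bound[where S = "ball a \<delta>" and f' = "\<lambda>x. blinfun_apply (Hf x - Hf a)"])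
      fix p assume p: "p \<in> ball a \<delta>"
      have "(?g has_derivative (\<lambda>h. blinfun_apply (Hf p) h - blinfun_apply (Hf a) h)) (at p within ball a \<delta>)"
        by (intro has_derivative_diff has_derivative_at_withinI[OF der] bounded_linear_imp_has_derivative
            blinfun.bounded_linear_right)
      moreover have "blinfun_apply (Hf p - Hf a) = (\<lambda>h. blinfun_apply (Hf p) h - blinfun_apply (Hf a) h)"
        by (rule ext) (simp add: blinfun.diff_left)
      ultimately show "(?g has_derivative blinfun_apply (Hf p - Hf a)) (at p within ball a \<delta>)"
        by simp
      show "onorm (blinfun_apply (Hf p - Hf a)) \<le> \<epsilon> / 2"
        using H[of p] p by (simp add: norm_blinfun.rep_eq[symmetric] dist_norm norm_minus_commute)
    qed (use y z in \<open>auto simp: dist_norm norm_minus_commute\<close>)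
    moreover have "norm (blinfun_apply (Hf x - Hf a) (y - z)) \<le> \<epsilon> / 2 * norm (y - z)"
      by (rule order_trans[OF norm_blinfun mult_right_mono[OF H[OF x]]]) simp
    moreover have eq: "gf y - gf z - blinfun_apply (Hf x) (y - z) = (?g y - ?g z) - blinfun_apply (Hf x - Hf a) (y - z)"
      by (simp add: blinfun.diff_left blinfun.diff_right)
    have "norm (gf y - gf z - blinfun_apply (Hf x) (y - z)) \<le>
        norm (?g y - ?g z) + norm (blinfun_apply (Hf x - Hf a) (y - z))"
      unfolding eq by (rule norm_triangle_ineq4)
    ultimately show ?thesis by linarith
  qed
  then show ?thesis using \<open>\<delta> > 0\<close> by blast
qed

lemma C2_gradient_lipschitz:
  assumes "C2_smooth_with f gf Hf"
  shows "\<exists>\<delta>>0. \<exists>l>0. \<forall>y z. norm (y - a) < \<delta> \<longrightarrow> norm (z - a) < \<delta> \<longrightarrow> norm (gf y - gf z) \<le> l * norm (y - z)"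
proof -
  obtain \<delta> where "\<delta> > 0" and \<delta>: "\<forall>x y z. norm (x - a) < \<delta> \<longrightarrow> norm (y - a) < \<delta> \<longrightarrow> norm (z - a) < \<delta> \<longrightarrow>
      norm (gf y - gf z - blinfun_apply (Hf x) (y - z)) \<le> 1 * norm (y - z)"
    using C2_gradient_strict[OF assms zero_less_one, of a] by blast
  have "norm (gf y - gf z) \<le> (norm (Hf a) + 1) * norm (y - z)" if "norm (y - a) < \<delta>" "norm (z - a) < \<delta>" for y z
  proof -
    have "norm (gf y - gf z - blinfun_apply (Hf a) (y - z)) \<le> 1 * norm (y - z)"
      using \<delta>[rule_format, of a y z] that \<open>\<delta> > 0\<close> by simp
    moreover have "norm (blinfun_apply (Hf a) (y - z)) \<le> norm (Hf a) * norm (y - z)" by (rule norm_blinfun)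
    ultimately show ?thesis
      using norm_triangle_sub[of "gf y - gf z" "blinfun_apply (Hf a) (y - z)"] by (simp add: distrib_right)
  qed
  moreover have "norm (Hf a) + 1 > 0" by (smt (verit) norm_ge_zero)
  ultimately show ?thesis using \<open>\<delta> > 0\<close> by blast
qed

text \<open>
  Both \<open>\<langle>\<nabla>\<^sup>2f x w, u\<rangle>\<close> and \<open>\<langle>\<nabla>\<^sup>2f x u, w\<rangle>\<close> are limits of the same mixed difference quotient of \<open>f\<close>.
\<close>

lemma C2_hessian_symmetric:
  assumes "C2_smooth_with f gf Hf"
  shows "inner (blinfun_apply (Hf x) u) w = inner u (blinfun_apply (Hf x) w)"
proof -
  have grad: "(f has_derivative (\<lambda>k. inner (gf y) k)) (at y)" for y
    using assms by (simp add: C2_smooth_with_def gderiv_def inner_commute)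
  let ?H = "blinfun_apply (Hf x)"
  have "\<bar>inner (?H u) w - inner u (?H w)\<bar> \<le> 0 + \<epsilon>" if "\<epsilon> > 0" for \<epsilon>
  proof -
    define M where "M = 2 * (norm u * norm w) + 1"
    have "norm u * norm w \<ge> 0" by simp
    then have M: "M > 0" unfolding M_def by linarith
    have "\<epsilon> / M > 0" using that M by simp
    from C2_gradient_strict[OF assms this, of x]
    obtain \<delta> where "\<delta> > 0" and d: "\<forall>a y z. norm (a - x) < \<delta> \<longrightarrow> norm (y - x) < \<delta> \<longrightarrow> norm (z - x) < \<delta> \<longrightarrow>
        norm (gf y - gf z - blinfun_apply (Hf a) (y - z)) \<le> \<epsilon> / M * norm (y - z)"
      by blast
    have \<delta>: "norm (gf y - gf z - ?H (y - z)) \<le> \<epsilon> / M * norm (y - z)"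
      if "norm (y - x) < \<delta>" "norm (z - x) < \<delta>" for y z using d[rule_format, of x y z] that \<open>\<delta> > 0\<close> by simp
    define t where "t = \<delta> / (norm u + norm w + 1)"
    have nn: "norm u + norm w + 1 > 0" by (smt (verit) norm_ge_zero)
    have t: "t > 0" using \<open>\<delta> > 0\<close> nn by (simp add: t_def)
    have "t * (norm u + norm w + 1) = \<delta>" using nn by (simp add: t_def)
    then have t': "t * norm u + t * norm w < \<delta>" using t by (simp add: algebra_simps)
    define \<Delta> where "\<Delta> a b = f (x + t *\<^sub>R a + t *\<^sub>R b) - f (x + t *\<^sub>R a) - (f (x + t *\<^sub>R b) - f x)" for a b
    have est: "\<bar>\<Delta> a b - t\<^sup>2 * inner (?H b) a\<bar> \<le> t\<^sup>2 * (\<epsilon> / M * (norm a * norm b))"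
      if ab: "t * norm a + t * norm b < \<delta>" for a b
    proof -
      obtain \<tau> where \<tau>: "0 < \<tau>" "\<tau> < 1" and eq:
        "\<Delta> a b = inner (gf (x + \<tau> *\<^sub>R (t *\<^sub>R a) + t *\<^sub>R b) - gf (x + \<tau> *\<^sub>R (t *\<^sub>R a))) (t *\<^sub>R a)"
        using mixed_difference_mean_value[where E = f and P = gf and S = UNIV and a = x and h = "t *\<^sub>R a" and s = "t *\<^sub>R b"]
          grad unfolding \<Delta>_def by blast
      let ?y = "x + \<tau> *\<^sub>R (t *\<^sub>R a) + t *\<^sub>R b" and ?z = "x + \<tau> *\<^sub>R (t *\<^sub>R a)"
      have "norm (\<tau> *\<^sub>R (t *\<^sub>R a)) \<le> 1 * norm (t *\<^sub>R a)"
        unfolding norm_scaleR[of \<tau>] using \<tau> by (intro mult_right_mono) auto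
      then have na: "norm (\<tau> *\<^sub>R (t *\<^sub>R a)) \<le> t * norm a" using t by simp
      have "norm (?z - x) < \<delta>" using na ab t by (smt (verit) add_diff_cancel_left' mult_nonneg_nonneg norm_ge_zero)
      moreover have "norm (?y - x) < \<delta>"
        using na ab t norm_triangle_ineq[of "\<tau> *\<^sub>R (t *\<^sub>R a)" "t *\<^sub>R b"] by (simp add: add.assoc)
      ultimately have "norm (gf ?y - gf ?z - ?H (?y - ?z)) \<le> \<epsilon> / M * norm (?y - ?z)" by (intro \<delta>)
      moreover have yz: "?y - ?z = t *\<^sub>R b" by simp
      ultimately have n: "norm (gf ?y - gf ?z - t *\<^sub>R ?H b) \<le> \<epsilon> / M * (t * norm b)"
        using t by (simp add: blinfun.scaleR_right)
      have "\<Delta> a b - t\<^sup>2 * inner (?H b) a = inner (gf ?y - gf ?z - t *\<^sub>R ?H b) (t *\<^sub>R a)"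
        unfolding eq by (simp add: inner_diff_left power2_eq_square algebra_simps)
      also have "\<bar>\<dots>\<bar> \<le> norm (gf ?y - gf ?z - t *\<^sub>R ?H b) * norm (t *\<^sub>R a)" by (rule Cauchy_Schwarz_ineq2)
      also have "\<dots> \<le> (\<epsilon> / M * (t * norm b)) * (t * norm a)"
        using n t M \<open>\<epsilon> > 0\<close> by (intro mult_mono) auto
      finally show ?thesis by (simp add: power2_eq_square mult_ac)
    qed
    have sym: "\<Delta> u w = \<Delta> w u" by (simp add: \<Delta>_def add_ac)
    have "t\<^sup>2 * \<bar>inner (?H w) u - inner (?H u) w\<bar> = \<bar>t\<^sup>2 * inner (?H w) u - t\<^sup>2 * inner (?H u) w\<bar>"
      by (simp add: right_diff_distrib[symmetric] abs_mult)
    also have "\<dots> \<le> t\<^sup>2 * (\<epsilon> / M * (norm u * norm w)) + t\<^sup>2 * (\<epsilon> / M * (norm w * norm u))"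
      using est[of u w] est[of w u] t' sym by linarith
    also have "\<dots> = t\<^sup>2 * (\<epsilon> / M * (2 * (norm u * norm w)))" by (simp add: algebra_simps)
    finally have "\<bar>inner (?H w) u - inner (?H u) w\<bar> \<le> \<epsilon> / M * (2 * (norm u * norm w))"
      by (rule mult_left_le_imp_le) (use t in simp)
    also have "\<dots> \<le> \<epsilon> / M * M" using \<open>\<epsilon> > 0\<close> M by (intro mult_left_mono) (auto simp: M_def)
    also have "\<dots> = \<epsilon>" using M by simp
    finally show ?thesis by (simp add: inner_commute abs_minus_commute)
  qed
  then have "\<bar>inner (?H u) w - inner u (?H w)\<bar> \<le> 0" by (rule field_le_epsilon)
  then show ?thesis by simp
qed

text \<open>
  Metric regularity of \<open>\<nabla>f + \<partial>g\<close> used as a solvability statement: every small perturbation \<open>y\<close> of a value is attained on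
  the graph of \<open>\<partial>g\<close>, and both components move by at most a multiple of the perturbation.
\<close>

lemma metric_regularity_graph:
  fixes g :: "'a::euclidean_space \<Rightarrow> ereal"
  assumes C2: "C2_smooth_with f gf Hf" and stat: "gf xb + vb = 0"
    and mr: "metrically_regular (\<lambda>x. {gf x + v | v. v \<in> subdifferential g x}) xb 0"
  shows "\<exists>C>0. \<exists>\<delta>>0. \<forall>x v y. (x, v) \<in> gph (subdifferential g) \<longrightarrow> norm (x - xb) < \<delta> \<longrightarrow> norm (v - vb) < \<delta> \<longrightarrow>
      norm (y - (gf x + v)) < \<delta> \<longrightarrow>
      (\<exists>x' v'. (x', v') \<in> gph (subdifferential g) \<and> gf x' + v' = y \<and>
         norm (x' - x) + norm (v' - v) \<le> C * norm (y - (gf x + v)))"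
proof -
  let ?M = "\<lambda>x. {gf x + v | v. v \<in> subdifferential g x}"
  obtain \<mu> U V where \<mu>: "0 < \<mu>" and UV: "open U" "xb \<in> U" "open V" "0 \<in> V"
    and mrd: "\<And>x y. x \<in> U \<Longrightarrow> y \<in> V \<Longrightarrow> edist_set x {x'. y \<in> ?M x'} \<le> ereal \<mu> * edist_set y (?M x)"
    using mr unfolding metrically_regular_def by blast
  obtain \<rho>1 where \<rho>1: "\<rho>1 > 0" "ball xb \<rho>1 \<subseteq> U" using UV open_contains_ball by metis
  obtain \<rho>2 where \<rho>2: "\<rho>2 > 0" "ball 0 \<rho>2 \<subseteq> V" using UV open_contains_ball by metis
  obtain \<delta>2 l where \<delta>2: "\<delta>2 > 0" and l: "l > 0"
    and lip: "\<And>y z. norm (y - xb) < \<delta>2 \<Longrightarrow> norm (z - xb) < \<delta>2 \<Longrightarrow> norm (gf y - gf z) \<le> l * norm (y - z)"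
    using C2_gradient_lipschitz[OF C2, of xb] by blast
  define \<mu>' where "\<mu>' = \<mu> + 1"
  define C where "C = \<mu>' + 1 + l * \<mu>'"
  define \<delta> where "\<delta> = min (min \<rho>1 (\<rho>2 / (2 + l))) (min \<delta>2 (\<delta>2 / (1 + \<mu>')))"
  have pos: "\<mu>' > 0" "C > 0" using \<mu> l by (auto simp: \<mu>'_def C_def intro!: add_pos_pos)
  have "\<delta> > 0" using \<rho>1 \<rho>2 \<delta>2 l pos by (simp add: \<delta>_def)
  then have \<delta>: "\<delta> > 0" "\<delta> \<le> \<rho>1" "\<delta> \<le> \<rho>2 / (2 + l)" "\<delta> \<le> \<delta>2" "\<delta> \<le> \<delta>2 / (1 + \<mu>')"
    by (simp_all only: \<delta>_def min.coboundedI1[OF min.cobounded1] min.coboundedI1[OF min.cobounded2]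
        min.coboundedI2[OF min.cobounded1] min.coboundedI2[OF min.cobounded2])
  have main: "\<exists>x' v'. (x', v') \<in> gph (subdifferential g) \<and> gf x' + v' = y \<and>
         norm (x' - x) + norm (v' - v) \<le> C * norm (y - (gf x + v))"
    if xv: "(x, v) \<in> gph (subdifferential g)" "norm (x - xb) < \<delta>" "norm (v - vb) < \<delta>"
      and y: "norm (y - (gf x + v)) < \<delta>" for x v y
  proof (cases "y = gf x + v")
    case True
    then show ?thesis using xv(1) by (intro exI[of _ x] exI[of _ v]) auto
  next
    case False
    define n where "n = norm (y - (gf x + v))"
    have n: "n > 0" "n < \<delta>" using False y by (auto simp: n_def)
    have xU: "x \<in> U" using \<rho>1(2) xv(2) \<delta>(2) by (auto simp: dist_norm norm_minus_commute)
    have x2: "norm (x - xb) < \<delta>2" using xv(2) \<delta>(4) by simp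
    have "y = (y - (gf x + v)) + ((gf x - gf xb) + (v - vb))" using stat by (simp add: algebra_simps)
    then have "norm y \<le> n + (norm (gf x - gf xb) + norm (v - vb))"
      unfolding n_def by (metis (no_types, lifting) add_left_mono norm_triangle_ineq order_trans)
    also have "norm (gf x - gf xb) \<le> l * norm (x - xb)" using x2 \<delta>2 by (intro lip) auto
    also have "l * norm (x - xb) \<le> l * \<delta>" using xv(2) l by (intro mult_left_mono) auto
    finally have "norm y < \<delta> + (l * \<delta> + \<delta>)" using n(2) xv(3) by simp
    also have "\<dots> = (2 + l) * \<delta>" by (simp add: algebra_simps)
    also have "\<dots> \<le> \<rho>2" using \<delta>(3) l by (simp add: field_simps)
    finally have yV: "y \<in> V" using \<rho>2(2) by auto
    have "edist_set y (?M x) \<le> ereal (dist y (gf x + v))"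
      unfolding edist_set_def using xv(1) by (intro INF_lower) (auto simp: gph_def)
    then have "edist_set x {x'. y \<in> ?M x'} \<le> ereal \<mu> * ereal (dist y (gf x + v))"
      using mrd[OF xU yV] \<mu> by (meson ereal_mult_left_mono ereal_less_eq(5) less_imp_le order_trans)
    also have "\<dots> < ereal (\<mu>' * n)" using n(1) by (simp add: \<mu>'_def n_def dist_norm)
    finally obtain x' where x': "y \<in> ?M x'" "dist x x' < \<mu>' * n"
      unfolding edist_set_def INF_less_iff by auto
    then obtain v' where v': "v' \<in> subdifferential g x'" "y = gf x' + v'" by blast
    have nx: "norm (x' - x) \<le> \<mu>' * n" using x'(2) by (simp add: dist_norm norm_minus_commute)
    have "\<mu>' * n \<le> \<mu>' * \<delta>" using n pos by (intro mult_left_mono) auto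
    then have "norm (x' - xb) < \<mu>' * \<delta> + \<delta>"
      using nx xv(2) norm_triangle_ineq[of "x' - x" "x - xb"] by simp
    also have "\<dots> \<le> \<delta>2" using \<delta>(5) pos by (simp add: field_simps)
    finally have "norm (gf x' - gf x) \<le> l * norm (x' - x)" using x2 by (intro lip) auto
    also have "\<dots> \<le> l * (\<mu>' * n)" using nx l by (intro mult_left_mono) auto
    finally have gl: "norm (gf x' - gf x) \<le> l * (\<mu>' * n)" .
    have dv: "v' - v = (y - (gf x + v)) - (gf x' - gf x)" using v'(2) by simp
    have "norm (v' - v) \<le> n + norm (gf x' - gf x)"
      unfolding dv n_def by (rule norm_triangle_ineq4)
    then have "norm (v' - v) \<le> n + l * (\<mu>' * n)" using gl by linarith
    then have "norm (x' - x) + norm (v' - v) \<le> C * n" using nx by (simp add: C_def algebra_simps)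
    then show ?thesis using v' unfolding n_def by (intro exI[of _ x'] exI[of _ v']) (simp add: gph_def)
  qed
  show ?thesis
    by (rule exI[of _ C], rule conjI[OF pos(2)], rule exI[of _ \<delta>], rule conjI[OF \<delta>(1)]) (use main in blast)
qed

section \<open>Symmetry of the proximal chart\<close>

text \<open>
  A set \<open>G\<close> that is, near \<open>(xb, vb)\<close>, the graph of the Lipschitz map \<open>z \<mapsto> P z\<close> in the coordinates \<open>z = x + lam v\<close>, where \<open>P\<close> is
  a gradient. For the graph of \<open>\<partial>g\<close>, \<open>P\<close> is the proximal map and \<open>E\<close> is \<open>|\<cdot>|\<^sup>2/2\<close> minus \<open>lam\<close> times the Moreau envelope.
\<close>

locale prox_chart =
  fixes G :: "('a::euclidean_space \<times> 'a) set"
    and P :: "'a \<Rightarrow> 'a" and E :: "'a \<Rightarrow> real"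
    and xb vb :: 'a and lam L \<delta>0 :: real
  assumes lam_pos: "0 < lam" and L_pos: "0 < L" and \<delta>0_pos: "0 < \<delta>0"
    and base: "(xb, vb) \<in> G"
    and chart: "z \<in> ball (xb + lam *\<^sub>R vb) \<delta>0 \<Longrightarrow> (P z, (1 / lam) *\<^sub>R (z - P z)) \<in> G"
    and chart_unique: "(x, v) \<in> G \<Longrightarrow> norm (x - xb) < \<delta>0 \<Longrightarrow> norm (v - vb) < \<delta>0 \<Longrightarrow> P (x + lam *\<^sub>R v) = x"
    and P_lipschitz: "z \<in> ball (xb + lam *\<^sub>R vb) \<delta>0 \<Longrightarrow> z' \<in> ball (xb + lam *\<^sub>R vb) \<delta>0 \<Longrightarrow>
      norm (P z - P z') \<le> L * norm (z - z')"
    and E_gradient: "z \<in> ball (xb + lam *\<^sub>R vb) \<delta>0 \<Longrightarrow> (E has_derivative (\<lambda>k. inner (P z) k)) (at z)"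
begin

definition zb where "zb = xb + lam *\<^sub>R vb"

definition V where "V z = (1 / lam) *\<^sub>R (z - P z)"

lemma P_zb: "P zb = xb"
  using chart_unique[OF base] \<delta>0_pos by (simp add: zb_def)

lemma V_zb: "V zb = vb"
  using lam_pos by (simp add: V_def P_zb) (simp add: zb_def)

lemma P_plus_V: "P z + lam *\<^sub>R V z = z"
  using lam_pos by (simp add: V_def)

lemma chart_mem: "z \<in> ball zb \<delta>0 \<Longrightarrow> (P z, V z) \<in> G"
  using chart by (simp add: V_def zb_def)

lemma V_eq: "P (x + lam *\<^sub>R v) = x \<Longrightarrow> V (x + lam *\<^sub>R v) = v"
  using lam_pos by (simp add: V_def)

lemma P_lip: "z \<in> ball zb \<delta>0 \<Longrightarrow> z' \<in> ball zb \<delta>0 \<Longrightarrow> norm (P z - P z') \<le> L * norm (z - z')"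
  using P_lipschitz by (simp add: zb_def)

lemma V_lip:
  assumes "z \<in> ball zb \<delta>0" "z' \<in> ball zb \<delta>0"
  shows "norm (V z - V z') \<le> (1 + L) / lam * norm (z - z')"
proof -
  have "V z - V z' = (1 / lam) *\<^sub>R ((z - z') - (P z - P z'))" by (simp add: V_def algebra_simps)
  then have "norm (V z - V z') = (1 / lam) * norm ((z - z') - (P z - P z'))" using lam_pos by simp
  also have "\<dots> \<le> (1 / lam) * (norm (z - z') + L * norm (z - z'))"
    using lam_pos P_lip[OF assms] norm_triangle_ineq4[of "z - z'" "P z - P z'"]
    by (intro mult_left_mono) auto
  finally show ?thesis by (simp add: field_simps)
qed

lemma zb_in: "zb \<in> ball zb \<delta>0" using \<delta>0_pos by simp

lemma graph_to_chart:
  assumes "(x, v) \<in> G" "norm (x - xb) < \<delta>0" "norm (v - vb) < \<delta>0"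
  shows "P (x + lam *\<^sub>R v) = x" "V (x + lam *\<^sub>R v) = v"
  using chart_unique[OF assms] V_eq by auto

lemma norm_chart_diff_le:
  "norm ((x + lam *\<^sub>R v) - (x' + lam *\<^sub>R v')) \<le> (1 + lam) * (norm (x - x') + norm (v - v'))"
proof -
  have "(x + lam *\<^sub>R v) - (x' + lam *\<^sub>R v') = (x - x') + lam *\<^sub>R (v - v')" by (simp add: algebra_simps)
  also have "norm \<dots> \<le> norm (x - x') + lam * norm (v - v')"
    using norm_triangle_ineq[of "x - x'" "lam *\<^sub>R (v - v')"] lam_pos by simp
  also have "\<dots> \<le> (1 + lam) * (norm (x - x') + norm (v - v'))"
    using lam_pos by (simp add: algebra_simps)
  finally show ?thesis .
qed

lemma chart_radius:
  assumes "0 < \<beta>"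
  obtains \<delta> where "0 < \<delta>" "\<delta> \<le> \<delta>0" "\<And>z. z \<in> ball zb \<delta> \<Longrightarrow> norm (P z - xb) < \<beta> \<and> norm (V z - vb) < \<beta>"
proof -
  define C where "C = 1 + L + (1 + L) / lam"
  have "(1 + L) / lam > 0" using L_pos lam_pos by simp
  then have C: "C > 0" "L \<le> C" "(1 + L) / lam \<le> C" using L_pos by (auto simp: C_def)
  define \<delta> where "\<delta> = min \<delta>0 (\<beta> / C)"
  show thesis
  proof (rule that[of \<delta>])
    show "0 < \<delta>" "\<delta> \<le> \<delta>0" using \<delta>0_pos assms C by (auto simp: \<delta>_def)
    fix z assume z: "z \<in> ball zb \<delta>"
    then have zin: "z \<in> ball zb \<delta>0" by (auto simp: \<delta>_def)
    have n: "norm (z - zb) < \<beta> / C" using z by (auto simp: \<delta>_def dist_norm norm_minus_commute)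
    then have Cn: "C * norm (z - zb) < \<beta>" using C by (simp add: field_simps)
    have "norm (P z - xb) \<le> C * norm (z - zb)"
      using P_lip[OF zin zb_in] C(2) by (smt (verit) P_zb mult_right_mono norm_ge_zero)
    moreover have "norm (V z - vb) \<le> C * norm (z - zb)"
      using V_lip[OF zin zb_in] C(3) by (smt (verit) V_zb mult_right_mono norm_ge_zero)
    ultimately show "norm (P z - xb) < \<beta> \<and> norm (V z - vb) < \<beta>" using Cn by linarith
  qed
qed

lemma subgradient_norm_le:
  assumes z: "z \<in> ball zb \<delta>0" and c: "proximal_subgradient (\<lambda>y. inner h (P y)) z c"
  shows "norm c \<le> L * norm h"
proof -
  obtain K \<delta> where "0 < \<delta>"
    and sub: "\<And>y. norm (y - z) < \<delta> \<Longrightarrow> inner h (P z) + inner c (y - z) - K * (norm (y - z))\<^sup>2 \<le> inner h (P y)"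
    using c unfolding proximal_subgradient_def by blast
  show ?thesis
  proof (rule tendsto_upperbound)
  show "((\<lambda>t. norm c - t * (K * norm c)) \<longlongrightarrow> norm c) (at_right 0)"
    by (rule tendsto_eq_intros | simp)+
  obtain e where e: "e > 0" "ball z e \<subseteq> ball zb \<delta>0" using z open_contains_ball open_ball by metis
  have nc: "norm c + 1 > 0" by (smt (verit) norm_ge_zero)
  have "min e \<delta> / (norm c + 1) > 0" using e nc \<open>0 < \<delta>\<close> by simp
  then show "\<forall>\<^sub>F t in at_right 0. norm c - t * (K * norm c) \<le> L * norm h"
  proof (rule eventually_at_rightI[rotated])
    fix t assume "t \<in> {0<..<min e \<delta> / (norm c + 1)}"
    then have t: "0 < t" "t * (norm c + 1) < min e \<delta>" using nc by (auto simp: less_divide_eq)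
    then have tc: "t * norm c < e" "t * norm c < \<delta>" by (auto simp: algebra_simps)
    let ?y = "z + t *\<^sub>R c"
    have "?y \<in> ball z e" using tc t by (simp add: dist_norm)
    then have yin: "?y \<in> ball zb \<delta>0" using e(2) by blast
    have "t * (norm c)\<^sup>2 - K * (t * norm c)\<^sup>2 \<le> inner h (P ?y - P z)"
      using sub[of ?y] tc t by (simp add: inner_diff power2_norm_eq_inner power_mult_distrib)
    also have "\<dots> \<le> norm h * norm (P ?y - P z)" by (rule norm_cauchy_schwarz)
    also have "\<dots> \<le> norm h * (L * norm (?y - z))" by (intro mult_left_mono P_lip yin z) simp
    finally have "(t * norm c) * (norm c - t * (K * norm c)) \<le> (t * norm c) * (L * norm h)"
      using t by (simp add: algebra_simps power2_eq_square)
    then show "norm c - t * (K * norm c) \<le> L * norm h"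
      using t(1) L_pos by (cases "c = 0") auto
  qed
qed simp
qed

text \<open>
  In the coordinates \<open>z = x + lam v\<close> a subgradient inequality for \<open>\<langle>h, P\<rangle>\<close> is a normal inequality for \<open>G\<close>.
\<close>

lemma subgradient_regular_normal:
  assumes z: "z \<in> ball zb \<delta>0" "norm (P z - xb) < \<delta>0" "norm (V z - vb) < \<delta>0"
    and c: "proximal_subgradient (\<lambda>y. inner h (P y)) z c"
  shows "(c - h, lam *\<^sub>R c) \<in> regular_normal_cone G (P z, V z)"
proof -
  obtain K \<delta> where "0 < \<delta>"
    and sub: "\<And>y. norm (y - z) < \<delta> \<Longrightarrow> inner h (P z) + inner c (y - z) - K * (norm (y - z))\<^sup>2 \<le> inner h (P y)"
    using c unfolding proximal_subgradient_def by blast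
  show ?thesis
  proof (rule regular_normal_coneI_quadratic)
  define \<beta> where "\<beta> = min (\<delta>0 - norm (P z - xb)) (min (\<delta>0 - norm (V z - vb)) (\<delta> / (2 * (1 + lam))))"
  show "0 < \<beta>" using z \<open>0 < \<delta>\<close> lam_pos by (simp add: \<beta>_def)
  show "(P z, V z) \<in> G" using z by (intro chart_mem)
  fix w assume w: "w \<in> G" "dist w (P z, V z) < \<beta>"
  obtain x v where xv: "w = (x, v)" by force
  let ?N = "norm (w - (P z, V z))"
  have wN: "?N < \<beta>" using w(2) by (simp add: dist_norm)
  have nx: "norm (x - P z) \<le> ?N" using norm_fst_le[of "x - P z" "v - V z"] by (simp add: xv)
  have nv: "norm (v - V z) \<le> ?N" using norm_snd_le[of "v - V z" "x - P z"] by (simp add: xv)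
  have "norm (x - xb) < \<delta>0" using nx wN norm_triangle_ineq[of "x - P z" "P z - xb"] by (simp add: \<beta>_def)
  moreover have "norm (v - vb) < \<delta>0" using nv wN norm_triangle_ineq[of "v - V z" "V z - vb"] by (simp add: \<beta>_def)
  ultimately have Px: "P (x + lam *\<^sub>R v) = x" using graph_to_chart w(1) xv by blast
  let ?y = "x + lam *\<^sub>R v"
  have "norm (?y - (P z + lam *\<^sub>R V z)) \<le> (1 + lam) * (norm (x - P z) + norm (v - V z))"
    by (rule norm_chart_diff_le)
  also have "\<dots> \<le> (1 + lam) * (?N + ?N)" using lam_pos nx nv by (intro mult_left_mono) auto
  finally have yz: "norm (?y - z) \<le> 2 * (1 + lam) * ?N" by (simp add: P_plus_V algebra_simps)
  also have "\<dots> < \<delta>" using wN lam_pos by (simp add: \<beta>_def field_simps)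
  finally have "inner h x \<ge> inner h (P z) + inner c (?y - z) - K * (norm (?y - z))\<^sup>2"
    using sub[of ?y] Px by simp
  moreover have "inner c (?y - z) = inner c (x - P z) + lam * inner c (v - V z)"
  proof -
    have "?y - z = (x - P z) + lam *\<^sub>R (v - V z)"
      using P_plus_V[of z] by (simp add: algebra_simps)
    then show ?thesis by (simp only: inner_add_right inner_scaleR_right)
  qed
  ultimately have "inner (c - h, lam *\<^sub>R c) (w - (P z, V z)) \<le> K * (norm (?y - z))\<^sup>2"
    by (simp add: xv inner_diff right_diff_distrib)
  also have "\<dots> \<le> \<bar>K\<bar> * (2 * (1 + lam) * ?N)\<^sup>2"
    using yz by (intro mult_mono power_mono) auto
  finally show "inner (c - h, lam *\<^sub>R c) (w - (P z, V z)) \<le> (\<bar>K\<bar> * (2 * (1 + lam))\<^sup>2) * ?N\<^sup>2"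
    by (simp add: power_mult_distrib mult.assoc)
qed
qed

text \<open>
  Semismoothness\<open>\<^sup>*\<close> of the set-valued map with graph \<open>G\<close>; the coderivative convention puts a minus sign on the second component.
\<close>

definition semismooth where
  "semismooth \<longleftrightarrow> (\<forall>d n. n \<in> directional_normal_cone G (xb, vb) d \<longrightarrow> inner n d = 0)"

text \<open>
  The normals of \<open>subgradient_regular_normal\<close> are inserted into the uniform form of semismoothness.
\<close>

lemma P_semismooth:
  assumes semismooth "0 < \<epsilon>"
  shows "\<exists>\<delta>>0. \<delta> \<le> \<delta>0 \<and> (\<forall>z\<in>ball zb \<delta>. \<forall>c h. proximal_subgradient (\<lambda>y. inner h (P y)) z c \<longrightarrow>
       inner c (z - zb) \<le> inner h (P z - xb) + \<epsilon> * norm h * norm (z - zb))"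
proof -
  define C where "C = L + 1 + lam * L"
  define C' where "C' = L + (1 + L) / lam"
  have CC: "C > 0" "C' > 0" using L_pos lam_pos by (auto simp: C_def C'_def intro!: add_pos_pos divide_pos_pos)
  have "\<epsilon> / (C * C') > 0" using CC \<open>0 < \<epsilon>\<close> by simp
  from semismooth_uniform[OF base _ this]
  obtain \<beta> where "\<beta> > 0" and \<beta>: "\<And>w n. w \<in> G \<Longrightarrow> dist w (xb, vb) < \<beta> \<Longrightarrow> n \<in> regular_normal_cone G w \<Longrightarrow>
      \<bar>inner n (w - (xb, vb))\<bar> \<le> \<epsilon> / (C * C') * norm n * norm (w - (xb, vb))"
    using assms(1) unfolding semismooth_def by metis
  have "min \<delta>0 (\<beta> / 2) > 0" using \<open>\<beta> > 0\<close> \<delta>0_pos by simp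
  then obtain \<delta> where \<delta>: "0 < \<delta>" "\<delta> \<le> \<delta>0"
    "\<And>z. z \<in> ball zb \<delta> \<Longrightarrow> norm (P z - xb) < min \<delta>0 (\<beta> / 2) \<and> norm (V z - vb) < min \<delta>0 (\<beta> / 2)"
    by (rule chart_radius) blast
  show ?thesis
  proof (intro exI[of _ \<delta>] conjI ballI allI impI \<delta>(1,2))
    fix z c h assume z: "z \<in> ball zb \<delta>" and sub: "proximal_subgradient (\<lambda>y. inner h (P y)) z c"
    have zin: "z \<in> ball zb \<delta>0" using z \<delta>(2) by auto
    have near: "norm (P z - xb) < min \<delta>0 (\<beta> / 2)" "norm (V z - vb) < min \<delta>0 (\<beta> / 2)"
      using \<delta>(3)[OF z] by auto
    have n: "(c - h, lam *\<^sub>R c) \<in> regular_normal_cone G (P z, V z)"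
      using near by (intro subgradient_regular_normal[OF zin _ _ sub]) auto
    let ?w = "(P z - xb, V z - vb)" and ?n = "(c - h, lam *\<^sub>R c)"
    have w: "(P z, V z) - (xb, vb) = ?w" by simp
    have nw: "norm ?w \<le> norm (P z - xb) + norm (V z - vb)" by (rule norm_Pair_le)
    then have "dist (P z, V z) (xb, vb) < \<beta>" using near by (simp add: dist_norm)
    from \<beta>[OF chart_mem[OF zin] this n]
    have ss: "inner ?n ?w \<le> \<epsilon> / (C * C') * norm ?n * norm ?w" unfolding w by simp
    have "norm ?w \<le> L * norm (z - zb) + (1 + L) / lam * norm (z - zb)"
      using nw P_lip[OF zin zb_in] V_lip[OF zin zb_in] by (simp add: P_zb V_zb)
    then have w': "norm ?w \<le> C' * norm (z - zb)" by (simp add: C'_def distrib_right)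
    have c: "norm c \<le> L * norm h" by (rule subgradient_norm_le[OF zin sub])
    have "norm ?n \<le> norm (c - h) + norm (lam *\<^sub>R c)" by (rule norm_Pair_le)
    also have "\<dots> \<le> norm c + norm h + lam * norm c"
      using norm_triangle_ineq4[of c h] lam_pos by simp
    also have "\<dots> \<le> L * norm h + norm h + lam * (L * norm h)"
      using c lam_pos by (intro add_mono mult_left_mono) auto
    finally have n': "norm ?n \<le> C * norm h" by (simp add: C_def algebra_simps)
    have "inner c (z - zb) - inner h (P z - xb) = inner ?n ?w"
    proof -
      have "z - zb = (P z - xb) + lam *\<^sub>R (V z - vb)"
        using P_plus_V[of z] by (simp add: zb_def algebra_simps)
      then have "inner c (z - zb) = inner c (P z - xb) + lam * inner c (V z - vb)"
        by (simp only: inner_add_right inner_scaleR_right)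
      then show ?thesis by (simp add: inner_diff_left)
    qed
    also have "\<dots> \<le> \<epsilon> / (C * C') * (norm ?n * norm ?w)" using ss by (simp add: mult.assoc)
    also have "\<dots> \<le> \<epsilon> / (C * C') * ((C * norm h) * (C' * norm (z - zb)))"
      using n' w' CC \<open>0 < \<epsilon>\<close> by (intro mult_left_mono mult_mono) auto
    also have "\<dots> = \<epsilon> * norm h * norm (z - zb)" using CC by simp
    finally show "inner c (z - zb) \<le> inner h (P z - xb) + \<epsilon> * norm h * norm (z - zb)" by simp
  qed
qed

text \<open>
  With \<open>q = z - zb\<close> and \<open>h = z' - z''\<close>, the increment \<open>\<langle>q, P z' - P z''\<rangle>\<close> is the limit for \<open>s \<rightarrow> 0\<close> of mixed differences of \<open>E\<close> in
  the directions \<open>s q\<close> and \<open>h\<close>, divided by \<open>s\<close>. By symmetry such a difference equals \<open>\<langle>h, P (z3 + s q) - P z3\<rangle>\<close> for some \<open>z3\<close>. The mean value inequality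
  bounds it by \<open>s \<langle>\<xi>, q\<rangle>\<close> for a proximal subgradient \<open>\<xi>\<close> of \<open>\<langle>h, P\<rangle>\<close> near \<open>z\<close>, to which semismoothness applies.
  Exchanging \<open>z'\<close> and \<open>z''\<close> gives the reverse inequality.
\<close>

lemma P_increment:
  assumes semismooth "0 < \<epsilon>"
  shows "\<exists>\<delta>>0. \<delta> \<le> \<delta>0 \<and> (\<forall>z\<in>ball zb \<delta>. z \<noteq> zb \<longrightarrow> (\<exists>\<rho>>0. \<forall>z'\<in>ball z \<rho>. \<forall>z''\<in>ball z \<rho>.
       inner (z - zb) (P z' - P z'') - inner (P z - xb) (z' - z'') \<le> \<epsilon> * norm (z - zb) * norm (z' - z'')))"
proof -
  have "\<epsilon> / 4 > 0" using \<open>0 < \<epsilon>\<close> by simp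
  from P_semismooth[OF assms(1) this] obtain \<delta> where \<delta>: "0 < \<delta>" "\<delta> \<le> \<delta>0" and ss:
    "\<And>z c h. z \<in> ball zb \<delta> \<Longrightarrow> proximal_subgradient (\<lambda>y. inner h (P y)) z c \<Longrightarrow>
       inner c (z - zb) \<le> inner h (P z - xb) + \<epsilon> / 4 * norm h * norm (z - zb)"
    by blast
  show ?thesis
  proof (rule exI[of _ \<delta>], intro conjI ballI impI \<delta>)
    fix z assume z: "z \<in> ball zb \<delta>" "z \<noteq> zb"
    let ?q = "z - zb"
    define D where "D = norm ?q"
    have D: "D > 0" using z(2) by (simp add: D_def)
    define \<rho> where "\<rho> = min (D / 3) (min (\<epsilon> * D / (24 * L)) ((\<delta> - D) / 3))"
    have zD: "D < \<delta>" using z(1) by (simp add: D_def dist_norm norm_minus_commute)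
    have \<rho>: "\<rho> > 0" using D \<open>0 < \<epsilon>\<close> L_pos zD by (simp add: \<rho>_def)
    have \<rho>D: "3 * \<rho> \<le> D" by (simp add: \<rho>_def)
    have \<rho>L: "6 * L * \<rho> \<le> \<epsilon> / 4 * D"
    proof -
      have "\<rho> \<le> \<epsilon> * D / (24 * L)" by (simp add: \<rho>_def)
      then have "\<rho> * (24 * L) \<le> \<epsilon> * D" using L_pos by (simp add: field_simps)
      then show ?thesis by (simp add: mult_ac)
    qed
    have in3: "y \<in> ball zb \<delta>" if "norm (y - z) < 3 * \<rho>" for y
    proof -
      have "\<rho> \<le> (\<delta> - D) / 3" unfolding \<rho>_def by (intro min.coboundedI2 order_refl)
      then show ?thesis using that norm_triangle_ineq[of "y - z" ?q]
        by (simp add: D_def dist_norm norm_minus_commute)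
    qed
    have "inner ?q (P z' - P z'') - inner (P z - xb) (z' - z'') \<le> \<epsilon> * D * norm (z' - z'')"
      if z': "z' \<in> ball z \<rho>" "z'' \<in> ball z \<rho>" for z' z''
    proof (cases "z' = z''")
      case False
      let ?h = "z' - z''"
      define H where "H = norm ?h"
      have H: "H > 0" using False by (simp add: H_def)
      define A where "A = inner ?q (P z' - P z'')"
      define \<theta> where "\<theta> = \<epsilon> / 4 * D * H"
      have \<theta>: "\<theta> > 0" using D H \<open>0 < \<epsilon>\<close> by (simp add: \<theta>_def)
      have dir: "((\<lambda>s. (E (y + s *\<^sub>R ?q) - E y) / s) \<longlongrightarrow> inner (P y) ?q) (at_right 0)"
        if "y \<in> ball zb \<delta>0" for y
      proof -
        have "((\<lambda>s. y + s *\<^sub>R ?q) has_derivative (\<lambda>t. t *\<^sub>R ?q)) (at 0)"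
          by (auto intro!: derivative_eq_intros)
        moreover have "(E has_derivative (\<lambda>k. inner (P y) k)) (at (y + 0 *\<^sub>R ?q))"
          using E_gradient that by (simp add: zb_def)
        ultimately have "((\<lambda>s. E (y + s *\<^sub>R ?q)) has_derivative (\<lambda>t. inner (P y) (t *\<^sub>R ?q))) (at 0)"
          by (rule has_derivative_compose)
        then have "((\<lambda>s. E (y + s *\<^sub>R ?q)) has_real_derivative inner (P y) ?q) (at 0)"
          by (rule has_derivative_imp_has_field_derivative) (simp add: mult.commute)
        then have "((\<lambda>s. (E (y + s *\<^sub>R ?q) - E y) / s) \<longlongrightarrow> inner (P y) ?q) (at 0)"
          by (simp add: DERIV_def)
        then show ?thesis by (rule filterlim_mono) (simp_all add: at_le)
      qed
      have in0: "y \<in> ball zb \<delta>0" if "norm (y - z) < 3 * \<rho>" for y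
        using in3[OF that] \<delta>(2) by auto
      have zz: "norm (z' - z) < \<rho>" "norm (z'' - z) < \<rho>" using z' by (auto simp: dist_norm norm_minus_commute)
      have "((\<lambda>s. (E (z' + s *\<^sub>R ?q) - E z') / s - (E (z'' + s *\<^sub>R ?q) - E z'') / s) \<longlongrightarrow>
          inner (P z') ?q - inner (P z'') ?q) (at_right 0)"
        by (intro tendsto_diff dir in0) (use zz \<rho> in auto)
      moreover have "inner (P z') ?q - inner (P z'') ?q > A - \<theta>"
        using \<theta> by (simp add: A_def inner_diff inner_commute)
      ultimately have "\<forall>\<^sub>F s in at_right 0. A - \<theta> <
          (E (z' + s *\<^sub>R ?q) - E z') / s - (E (z'' + s *\<^sub>R ?q) - E z'') / s"
        by (rule order_tendstoD)
      moreover have "\<forall>\<^sub>F s in at_right 0. s \<in> {0<..<\<rho> / D}"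
        using \<rho> D by (intro eventually_at_rightI[of 0 "\<rho> / D"]) auto
      ultimately have "\<forall>\<^sub>F s in at_right 0. s \<in> {0<..<\<rho> / D} \<and> A - \<theta> <
          (E (z' + s *\<^sub>R ?q) - E z') / s - (E (z'' + s *\<^sub>R ?q) - E z'') / s"
        by eventually_elim blast
      then obtain s where s: "0 < s" "s < \<rho> / D"
        and As: "A - \<theta> < (E (z' + s *\<^sub>R ?q) - E z') / s - (E (z'' + s *\<^sub>R ?q) - E z'') / s"
        using eventually_happens'[OF trivial_limit_at_right_real] by (metis (lifting) greaterThanLessThan_iff)
      have sD: "norm (s *\<^sub>R ?q) < \<rho>"
        using s D unfolding norm_scaleR by (simp add: D_def less_divide_eq)
      have seg: "norm (z'' + \<tau> *\<^sub>R ?h - z) < \<rho>" if "0 \<le> \<tau>" "\<tau> \<le> 1" for \<tau>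
      proof -
        have "z'' + \<tau> *\<^sub>R ?h = (1 - \<tau>) *\<^sub>R z'' + \<tau> *\<^sub>R z'" by (simp add: algebra_simps)
        moreover have "(1 - \<tau>) *\<^sub>R z'' + \<tau> *\<^sub>R z' \<in> ball z \<rho>"
          using z' that by (intro convexD[OF convex_ball]) auto
        ultimately show ?thesis by (simp add: dist_norm norm_minus_commute)
      qed
      obtain \<tau> where \<tau>: "0 < \<tau>" "\<tau> < 1"
        "(E (z'' + ?h + s *\<^sub>R ?q) - E (z'' + ?h)) - (E (z'' + s *\<^sub>R ?q) - E z'') =
          inner (P (z'' + \<tau> *\<^sub>R ?h + s *\<^sub>R ?q) - P (z'' + \<tau> *\<^sub>R ?h)) ?h"
      proof (rule mixed_difference_mean_value[where E = E and P = P and S = "ball zb \<delta>0"])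
        show "(E has_derivative inner (P x)) (at x)" if "x \<in> ball zb \<delta>0" for x
          using E_gradient that by (simp add: zb_def)
        show "z'' + \<tau> *\<^sub>R ?h \<in> ball zb \<delta>0 \<and> z'' + \<tau> *\<^sub>R ?h + s *\<^sub>R ?q \<in> ball zb \<delta>0"
          if "0 \<le> \<tau>" "\<tau> \<le> 1" for \<tau>
          using seg[OF that] sD \<rho> norm_triangle_ineq[of "z'' + \<tau> *\<^sub>R ?h - z" "s *\<^sub>R ?q"]
          by (intro conjI in0) (auto simp: algebra_simps)
      qed blast
      define z3 where "z3 = z'' + \<tau> *\<^sub>R ?h"
      have z3: "norm (z3 - z) < \<rho>" using seg \<tau> by (simp add: z3_def)
      have gt: "inner ?h (P (z3 + s *\<^sub>R ?q)) - inner ?h (P z3) > s * (A - \<theta>)"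
      proof -
        have "s * (A - \<theta>) < (E (z' + s *\<^sub>R ?q) - E z') - (E (z'' + s *\<^sub>R ?q) - E z'')"
          using As s(1) unfolding diff_divide_distrib[symmetric]
          by (simp only: pos_less_divide_eq mult.commute[of s])
        also have "\<dots> = inner (P (z3 + s *\<^sub>R ?q) - P z3) ?h" using \<tau>(3) by (simp add: z3_def)
        finally show ?thesis by (simp add: inner_diff inner_commute)
      qed
      have tube: "norm (z3 + \<tau>' *\<^sub>R (s *\<^sub>R ?q) + u - z) < 3 * \<rho>"
        if "\<tau>' \<in> {0..1}" "norm u \<le> \<rho>" for \<tau>' u
      proof -
        have "norm (\<tau>' *\<^sub>R (s *\<^sub>R ?q)) \<le> 1 * norm (s *\<^sub>R ?q)"
          unfolding norm_scaleR[of \<tau>'] using that(1) by (intro mult_right_mono) auto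
        then show ?thesis
          using z3 sD that(2) norm_triangle_ineq[of "z3 - z" "\<tau>' *\<^sub>R (s *\<^sub>R ?q)"]
            norm_triangle_ineq[of "z3 - z + \<tau>' *\<^sub>R (s *\<^sub>R ?q)" u] by (simp add: algebra_simps)
      qed
      have contP: "continuous_on (ball zb \<delta>0) P"
        using P_lip L_pos by (intro lipschitz_on_continuous_on[of L] lipschitz_onI) (auto simp: dist_norm)
      have "continuous_on {z3 + \<tau> *\<^sub>R s *\<^sub>R ?q + u |\<tau> u. \<tau> \<in> {0..1} \<and> u \<in> cball 0 \<rho>} (\<lambda>a. inner ?h (P a))"
        using in0 tube by (intro continuous_intros continuous_on_subset[OF contP]) auto
      moreover have "(\<lambda>a. inner ?h (P a)) (z3 + s *\<^sub>R ?q) - (\<lambda>a. inner ?h (P a)) z3 > s * (A - \<theta>)"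
        using gt by simp
      ultimately obtain \<tau>' z4 \<xi> where z4: "\<tau>' \<in> {0..1}" "norm (z4 - (z3 + \<tau>' *\<^sub>R (s *\<^sub>R ?q))) < \<rho>"
        "s * (A - \<theta>) \<le> inner \<xi> (s *\<^sub>R ?q)" "proximal_subgradient (\<lambda>a. inner ?h (P a)) z4 \<xi>"
        using mean_value_proximal_subgradient[OF \<rho>] by blast
      have "norm (z3 + \<tau>' *\<^sub>R (s *\<^sub>R ?q) + (z4 - (z3 + \<tau>' *\<^sub>R (s *\<^sub>R ?q))) - z) < 3 * \<rho>"
        using z4(1,2) by (intro tube) auto
      then have z4z: "norm (z4 - z) < 3 * \<rho>" by simp
      have \<xi>: "norm \<xi> \<le> L * H" unfolding H_def
        by (rule subgradient_norm_le[OF in0[OF z4z] z4(4)])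
      have "A - \<theta> \<le> inner \<xi> ?q" using z4(3) s(1) by simp
      also have "\<dots> = inner \<xi> (z4 - zb) + inner \<xi> (z - z4)" by (simp add: inner_diff_right)
      also have "inner \<xi> (z4 - zb) \<le> inner ?h (P z4 - xb) + \<epsilon> / 4 * norm ?h * norm (z4 - zb)"
        by (rule ss[OF in3[OF z4z] z4(4)])
      also have "inner ?h (P z4 - xb) = inner ?h (P z - xb) + inner ?h (P z4 - P z)"
        by (simp add: inner_diff_right)
      also have "inner ?h (P z4 - P z) \<le> H * (L * (3 * \<rho>))"
      proof -
        have "inner ?h (P z4 - P z) \<le> H * norm (P z4 - P z)" unfolding H_def by (rule norm_cauchy_schwarz)
        also have "norm (P z4 - P z) \<le> L * norm (z4 - z)" using \<rho> by (intro P_lip in0 z4z) auto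
        also have "L * norm (z4 - z) \<le> L * (3 * \<rho>)" using z4z L_pos by (intro mult_left_mono) auto
        finally show ?thesis using H by simp
      qed
      also have "inner \<xi> (z - z4) \<le> (L * H) * (3 * \<rho>)"
      proof -
        have "inner \<xi> (z - z4) \<le> norm \<xi> * norm (z - z4)" by (rule norm_cauchy_schwarz)
        also have "\<dots> \<le> (L * H) * (3 * \<rho>)"
          using \<xi> z4z L_pos H by (intro mult_mono) (auto simp: norm_minus_commute)
        finally show ?thesis .
      qed
      also have "\<epsilon> / 4 * norm ?h * norm (z4 - zb) \<le> \<epsilon> / 4 * H * (2 * D)"
      proof -
        have "norm (z4 - zb) \<le> 2 * D"
          using norm_triangle_ineq[of "z4 - z" ?q] z4z \<rho>D by (simp add: D_def)
        then show ?thesis unfolding H_def using \<open>0 < \<epsilon>\<close> by (intro mult_left_mono) auto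
      qed
      finally have "A - inner ?h (P z - xb) \<le> \<theta> + H * (6 * L * \<rho>) + \<epsilon> / 4 * H * (2 * D)"
        by (simp add: algebra_simps)
      also have "H * (6 * L * \<rho>) \<le> H * (\<epsilon> / 4 * D)" using \<rho>L H by (intro mult_left_mono) auto
      finally show ?thesis by (simp add: A_def \<theta>_def H_def inner_commute algebra_simps)
    qed simp
    then show "\<exists>\<rho>>0. \<forall>z'\<in>ball z \<rho>. \<forall>z''\<in>ball z \<rho>.
       inner (z - zb) (P z' - P z'') - inner (P z - xb) (z' - z'') \<le> \<epsilon> * norm (z - zb) * norm (z' - z'')"
      using \<rho> unfolding D_def by blast
  qed
qed

text \<open>
  The relation \<open>P_increment\<close> rewritten in \<open>x\<close> and \<open>v\<close>: the terms \<open>\<langle>x - xb, x' - x''\<rangle>\<close> cancel.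
\<close>

lemma graph_increment:
  assumes semismooth "0 < \<epsilon>"
  shows "\<exists>\<delta>>0. \<forall>x v. (x, v) \<in> G \<longrightarrow> norm (x - xb) < \<delta> \<longrightarrow> norm (v - vb) < \<delta> \<longrightarrow>
    (\<exists>\<rho>>0. \<forall>x' v' x'' v''. (x', v') \<in> G \<longrightarrow> (x'', v'') \<in> G \<longrightarrow>
       norm (x' - x) < \<rho> \<longrightarrow> norm (v' - v) < \<rho> \<longrightarrow> norm (x'' - x) < \<rho> \<longrightarrow> norm (v'' - v) < \<rho> \<longrightarrow>
       inner (v - vb) (x' - x'') - inner (x - xb) (v' - v'') \<le>
         \<epsilon> * (norm (x - xb) + norm (v - vb)) * (norm (x' - x'') + norm (v' - v'')))"
proof -
  define \<epsilon>' where "\<epsilon>' = \<epsilon> * lam / (1 + lam)\<^sup>2"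
  have l1: "1 + lam > 0" using lam_pos by simp
  have "\<epsilon>' > 0" using \<open>0 < \<epsilon>\<close> lam_pos by (simp add: \<epsilon>'_def)
  from P_increment[OF assms(1) this] obtain \<delta>1 where \<delta>1: "0 < \<delta>1" "\<delta>1 \<le> \<delta>0"
    and inc: "\<And>z. z \<in> ball zb \<delta>1 \<Longrightarrow> z \<noteq> zb \<Longrightarrow> \<exists>\<rho>>0. \<forall>z'\<in>ball z \<rho>. \<forall>z''\<in>ball z \<rho>.
       inner (z - zb) (P z' - P z'') - inner (P z - xb) (z' - z'') \<le> \<epsilon>' * norm (z - zb) * norm (z' - z'')"
    by blast
  define \<delta> where "\<delta> = min (\<delta>0 / 2) (\<delta>1 / (2 * (1 + lam)))"
  have "0 < \<delta>" using \<delta>1 \<delta>0_pos l1 by (simp add: \<delta>_def)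
  then have \<delta>: "0 < \<delta>" "\<delta> \<le> \<delta>0 / 2" "\<delta> \<le> \<delta>1 / (2 * (1 + lam))"
    by (simp_all only: \<delta>_def min.cobounded1 min.cobounded2)
  show ?thesis
  proof (rule exI[of _ \<delta>], intro conjI allI impI \<delta>(1))
    fix x v assume xv: "(x, v) \<in> G" "norm (x - xb) < \<delta>" "norm (v - vb) < \<delta>"
    define z where "z = x + lam *\<^sub>R v"
    have Pz: "P z = x" "V z = v"
      using xv \<delta>(2) \<delta>0_pos graph_to_chart[of x v] by (auto simp: z_def)
    have zle: "norm (z - zb) \<le> (1 + lam) * (norm (x - xb) + norm (v - vb))"
      unfolding z_def zb_def by (rule norm_chart_diff_le)
    also have "\<dots> < (1 + lam) * (\<delta> + \<delta>)" using xv l1 by (intro mult_strict_left_mono add_strict_mono)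
    also have "\<dots> \<le> \<delta>1" using \<delta>(3) l1 by (simp add: field_simps)
    finally have zin: "z \<in> ball zb \<delta>1" by (simp add: dist_norm norm_minus_commute)
    show "\<exists>\<rho>>0. \<forall>x' v' x'' v''. (x', v') \<in> G \<longrightarrow> (x'', v'') \<in> G \<longrightarrow>
       norm (x' - x) < \<rho> \<longrightarrow> norm (v' - v) < \<rho> \<longrightarrow> norm (x'' - x) < \<rho> \<longrightarrow> norm (v'' - v) < \<rho> \<longrightarrow>
       inner (v - vb) (x' - x'') - inner (x - xb) (v' - v'') \<le>
         \<epsilon> * (norm (x - xb) + norm (v - vb)) * (norm (x' - x'') + norm (v' - v''))"
    proof (cases "z = zb")
      case True
      then have "x = xb" "v = vb" using Pz P_zb V_zb by auto
      then show ?thesis by (intro exI[of _ 1]) auto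
    next
      case False
      from inc[OF zin False] obtain \<rho>1 where "\<rho>1 > 0"
        and \<rho>1: "\<And>z' z''. z' \<in> ball z \<rho>1 \<Longrightarrow> z'' \<in> ball z \<rho>1 \<Longrightarrow>
          inner (z - zb) (P z' - P z'') - inner (P z - xb) (z' - z'') \<le> \<epsilon>' * norm (z - zb) * norm (z' - z'')"
        by blast
      define \<rho> where "\<rho> = min (\<delta>0 / 2) (\<rho>1 / (2 * (1 + lam)))"
      have "0 < \<rho>" using \<open>\<rho>1 > 0\<close> \<delta>0_pos l1 by (simp add: \<rho>_def)
      then have \<rho>: "0 < \<rho>" "\<rho> \<le> \<delta>0 / 2" "\<rho> \<le> \<rho>1 / (2 * (1 + lam))"
        by (simp_all only: \<rho>_def min.cobounded1 min.cobounded2)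
      have pt: "x' + lam *\<^sub>R v' \<in> ball z \<rho>1 \<and> P (x' + lam *\<^sub>R v') = x'"
        if "(x', v') \<in> G" "norm (x' - x) < \<rho>" "norm (v' - v) < \<rho>" for x' v'
      proof
        have "norm ((x' + lam *\<^sub>R v') - z) \<le> (1 + lam) * (norm (x' - x) + norm (v' - v))"
          unfolding z_def by (rule norm_chart_diff_le)
        also have "\<dots> < (1 + lam) * (\<rho> + \<rho>)" using that l1 by (intro mult_strict_left_mono add_strict_mono)
        also have "\<dots> \<le> \<rho>1" using \<rho>(3) l1 by (simp add: field_simps)
        finally show "x' + lam *\<^sub>R v' \<in> ball z \<rho>1" by (simp add: dist_norm norm_minus_commute)
        have "norm (x' - xb) < \<delta>0" "norm (v' - vb) < \<delta>0"
          using that xv \<rho>(2) \<delta>(2) norm_triangle_ineq[of "x' - x" "x - xb"]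
            norm_triangle_ineq[of "v' - v" "v - vb"] by auto
        then show "P (x' + lam *\<^sub>R v') = x'" using graph_to_chart(1) that(1) by blast
      qed
      show ?thesis
      proof (rule exI[of _ \<rho>], intro conjI allI impI \<rho>(1))
        fix x' v' x'' v'' assume a: "(x', v') \<in> G" "(x'', v'') \<in> G" "norm (x' - x) < \<rho>" "norm (v' - v) < \<rho>"
          "norm (x'' - x) < \<rho>" "norm (v'' - v) < \<rho>"
        let ?z' = "x' + lam *\<^sub>R v'" and ?z'' = "x'' + lam *\<^sub>R v''"
        let ?D = "norm (x - xb) + norm (v - vb)" and ?S = "norm (x' - x'') + norm (v' - v'')"
        have "lam * (inner (v - vb) (x' - x'') - inner (x - xb) (v' - v''))
            = inner (z - zb) (x' - x'') - inner (x - xb) (?z' - ?z'')"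
        proof -
          have "z - zb = (x - xb) + lam *\<^sub>R (v - vb)" by (simp add: z_def zb_def algebra_simps)
          moreover have "?z' - ?z'' = (x' - x'') + lam *\<^sub>R (v' - v'')" by (simp add: algebra_simps)
          ultimately show ?thesis
            by (simp only: inner_add_left inner_add_right inner_scaleR_left inner_scaleR_right right_diff_distrib)
        qed
        also have "\<dots> \<le> \<epsilon>' * norm (z - zb) * norm (?z' - ?z'')"
          using \<rho>1[of ?z' ?z''] pt[OF a(1,3,4)] pt[OF a(2,5,6)] Pz(1) by simp
        also have "\<dots> \<le> \<epsilon>' * (((1 + lam) * ?D) * ((1 + lam) * ?S))"
          unfolding mult.assoc[of \<epsilon>'] using zle norm_chart_diff_le \<open>\<epsilon>' > 0\<close> l1
          by (intro mult_left_mono mult_mono) auto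
        also have "\<dots> = lam * (\<epsilon> * ?D * ?S)"
          using l1 by (simp add: \<epsilon>'_def power2_eq_square)
        finally show "inner (v - vb) (x' - x'') - inner (x - xb) (v' - v'') \<le> \<epsilon> * ?D * ?S"
          using lam_pos by simp
      qed
    qed
  qed
qed

end

section \<open>Newton directions in the proximal chart\<close>

text \<open>
  Adds the smooth part: \<open>gf\<close> and \<open>Hf\<close> are gradient and Hessian, \<open>stationary\<close> says that \<open>xb\<close> solves the inclusion \<open>0 \<in> gf xb + \<partial>g xb\<close>, and
  \<open>regular\<close> is metric regularity in the form of \<open>metric_regularity_graph\<close>.
\<close>

locale newton_chart = prox_chart G P E xb vb lam L \<delta>0
  for G :: "('a::euclidean_space \<times> 'a) set" and P E xb vb lam L \<delta>0 +
  fixes gf :: "'a \<Rightarrow> 'a" and Hf :: "'a \<Rightarrow> 'a \<Rightarrow>\<^sub>L 'a" and C \<delta>m :: real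
  assumes gf_strict: "0 < \<epsilon> \<Longrightarrow> \<exists>\<delta>>0. \<forall>x y z. norm (x - a) < \<delta> \<longrightarrow> norm (y - a) < \<delta> \<longrightarrow> norm (z - a) < \<delta> \<longrightarrow>
      norm (gf y - gf z - blinfun_apply (Hf x) (y - z)) \<le> \<epsilon> * norm (y - z)"
    and Hf_sym: "inner (blinfun_apply (Hf x) u) w = inner u (blinfun_apply (Hf x) w)"
    and Hf_cont: "isCont Hf x"
    and stationary: "gf xb + vb = 0"
    and C_pos: "0 < C" and \<delta>m_pos: "0 < \<delta>m"
    and regular: "(x, v) \<in> G \<Longrightarrow> norm (x - xb) < \<delta>m \<Longrightarrow> norm (v - vb) < \<delta>m \<Longrightarrow>
      norm (y - (gf x + v)) < \<delta>m \<Longrightarrow>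
      \<exists>x' v'. (x', v') \<in> G \<and> gf x' + v' = y \<and> norm (x' - x) + norm (v' - v) \<le> C * norm (y - (gf x + v))"
begin

text \<open>
  A Newton step from \<open>(x, v)\<close> ends at distance \<open>|w|\<close> from \<open>xb\<close>, where \<open>w = x + d - xb\<close>. Substituting \<open>d = w - (x - xb)\<close> in the normal
  inequality along increments \<open>(dx, dv)\<close> of \<open>G\<close> produces the term \<open>\<langle>x - xb, dv\<rangle>\<close>, which \<open>graph_increment\<close> replaces by
  \<open>\<langle>v - vb, dx\<rangle>\<close>. The remaining terms in \<open>dx\<close> cancel to first order because \<open>vb = - gf xb\<close> and the Hessian is
  symmetric, which leaves \<open>- \<langle>w, \<Delta>y\<rangle>\<close> for the change \<open>\<Delta>y\<close> of \<open>gf x + v\<close>. Metric regularity allows \<open>\<Delta>y = - t w\<close>.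
\<close>

lemma newton_estimate:
  assumes semismooth "0 < \<epsilon>"
  shows "\<exists>\<delta>>0. \<forall>x v d. (x, v) \<in> G \<longrightarrow> norm (x - xb) < \<delta> \<longrightarrow> norm (v - vb) < \<delta> \<longrightarrow>
    (- (gf x + v) - blinfun_apply (Hf x) d, - d) \<in> limiting_normal_cone G (x, v) \<longrightarrow>
    norm (x + d - xb) \<le> \<epsilon> * (norm (x - xb) + norm (v - vb))"
proof -
  define e where "e = \<epsilon> / (2 * C)"
  have e: "e > 0" using \<open>0 < \<epsilon>\<close> C_pos by (simp add: e_def)
  obtain \<delta>1 where "\<delta>1 > 0" and inc: "\<And>x v. (x, v) \<in> G \<Longrightarrow> norm (x - xb) < \<delta>1 \<Longrightarrow> norm (v - vb) < \<delta>1 \<Longrightarrow>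
    (\<exists>\<rho>>0. \<forall>x' v' x'' v''. (x', v') \<in> G \<longrightarrow> (x'', v'') \<in> G \<longrightarrow>
       norm (x' - x) < \<rho> \<longrightarrow> norm (v' - v) < \<rho> \<longrightarrow> norm (x'' - x) < \<rho> \<longrightarrow> norm (v'' - v) < \<rho> \<longrightarrow>
       inner (v - vb) (x' - x'') - inner (x - xb) (v' - v'') \<le>
         e * (norm (x - xb) + norm (v - vb)) * (norm (x' - x'') + norm (v' - v'')))"
    using graph_increment[OF assms(1) e] by blast
  obtain \<delta>2 where "\<delta>2 > 0" and str: "\<And>x y z. norm (x - xb) < \<delta>2 \<Longrightarrow> norm (y - xb) < \<delta>2 \<Longrightarrow> norm (z - xb) < \<delta>2 \<Longrightarrow>
      norm (gf y - gf z - blinfun_apply (Hf x) (y - z)) \<le> e * norm (y - z)"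
    using gf_strict[OF e, of xb] by blast
  define \<delta> where "\<delta> = min \<delta>1 (min \<delta>2 \<delta>m)"
  have \<delta>: "0 < \<delta>" "\<delta> \<le> \<delta>1" "\<delta> \<le> \<delta>2" "\<delta> \<le> \<delta>m"
    using \<open>\<delta>1 > 0\<close> \<open>\<delta>2 > 0\<close> \<delta>m_pos by (auto simp: \<delta>_def)
  show ?thesis
  proof (rule exI[of _ \<delta>], intro conjI allI impI \<delta>(1))
    fix x v d assume xv: "(x, v) \<in> G" "norm (x - xb) < \<delta>" "norm (v - vb) < \<delta>"
      and lim: "(- (gf x + v) - blinfun_apply (Hf x) d, - d) \<in> limiting_normal_cone G (x, v)"
    define u where "u = - (gf x + v) - blinfun_apply (Hf x) d"
    define w where "w = x + d - xb"
    define D where "D = norm (x - xb) + norm (v - vb)"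
    define H where "H = blinfun_apply (Hf x)"
    have D0: "D \<ge> 0" by (simp add: D_def)
    obtain \<rho> where "\<rho> > 0" and \<rho>: "\<And>x' v' x'' v''. (x', v') \<in> G \<Longrightarrow> (x'', v'') \<in> G \<Longrightarrow>
       norm (x' - x) < \<rho> \<Longrightarrow> norm (v' - v) < \<rho> \<Longrightarrow> norm (x'' - x) < \<rho> \<Longrightarrow> norm (v'' - v) < \<rho> \<Longrightarrow>
       inner (v - vb) (x' - x'') - inner (x - xb) (v' - v'') \<le> e * D * (norm (x' - x'') + norm (v' - v''))"
      using inc[OF xv(1)] xv(2,3) \<delta>(2) unfolding D_def by (meson less_le_trans)
    obtain z n where z: "z \<longlonglongrightarrow> (x, v)" and n: "n \<longlonglongrightarrow> (u, - d)"
      and zn: "\<And>k. n k \<in> regular_normal_cone G (z k)"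
      using lim unfolding u_def limiting_normal_cone_def by blast
    have key: "norm w \<le> \<epsilon> * D + C * (\<eta> * (2 + norm w))" if "\<eta> > 0" for \<eta>
    proof (cases "w = 0")
      case True
      then show ?thesis using D0 \<open>0 < \<epsilon>\<close> C_pos that by simp
    next
      case False
      then have w: "norm w > 0" by simp
      obtain \<delta>3 where "\<delta>3 > 0" and str3: "\<And>y z. norm (y - x) < \<delta>3 \<Longrightarrow> norm (z - x) < \<delta>3 \<Longrightarrow>
          norm (gf y - gf z - H (y - z)) \<le> \<eta> * norm (y - z)"
      proof -
        obtain \<delta>' where "\<delta>' > 0" "\<forall>a y z. norm (a - x) < \<delta>' \<longrightarrow> norm (y - x) < \<delta>' \<longrightarrow> norm (z - x) < \<delta>' \<longrightarrow>
          norm (gf y - gf z - blinfun_apply (Hf a) (y - z)) \<le> \<eta> * norm (y - z)"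
          using gf_strict[OF \<open>\<eta> > 0\<close>, of x] by blast
        moreover from this have "norm (x - x) < \<delta>'" by simp
        ultimately show thesis using that[of \<delta>'] unfolding H_def by blast
      qed
      define \<beta> where "\<beta> = min (min (\<rho> / 2) (\<delta>3 / 2)) (min (\<delta>m - norm (x - xb)) (\<delta>m - norm (v - vb)))"
      have "\<beta> > 0" using \<open>\<rho> > 0\<close> \<open>\<delta>3 > 0\<close> xv(2,3) \<delta>(4) unfolding \<beta>_def by auto
      then have \<beta>: "\<beta> > 0" "\<beta> \<le> \<rho> / 2" "\<beta> \<le> \<delta>3 / 2" "\<beta> \<le> \<delta>m - norm (x - xb)" "\<beta> \<le> \<delta>m - norm (v - vb)"
        by (simp_all only: \<beta>_def min.coboundedI1[OF min.cobounded1] min.coboundedI1[OF min.cobounded2]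
            min.coboundedI2[OF min.cobounded1] min.coboundedI2[OF min.cobounded2])
      have "\<forall>\<^sub>F k in sequentially. dist (z k) (x, v) < \<beta> \<and> dist (n k) (u, - d) < \<eta>"
        using tendstoD[OF z \<beta>(1)] tendstoD[OF n \<open>\<eta> > 0\<close>] by (rule eventually_conj)
      then obtain k where k: "dist (z k) (x, v) < \<beta>" "dist (n k) (u, - d) < \<eta>"
        by (auto simp: eventually_sequentially)
      obtain xk vk where zk: "z k = (xk, vk)" by force
      obtain uk mk where nk: "n k = (uk, mk)" by force
      have xk: "norm (xk - x) < \<beta>" "norm (vk - v) < \<beta>"
        using k(1) norm_fst_le[of "xk - x" "vk - v"] norm_snd_le[of "vk - v" "xk - x"] by (auto simp: zk dist_norm)
      have uk: "norm (uk - u) \<le> \<eta>" "norm (mk + d) \<le> \<eta>"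
        using k(2) norm_fst_le[of "uk - u" "mk + d"] norm_snd_le[of "mk + d" "uk - u"] by (auto simp: nk dist_norm)
      have reg: "(uk, mk) \<in> regular_normal_cone G (xk, vk)" using zn[of k] by (simp add: zk nk)
      then have Gk: "(xk, vk) \<in> G" by (simp add: regular_normal_cone_iff)
      obtain \<delta>4 where "\<delta>4 > 0" and r4: "\<And>a. a \<in> G \<Longrightarrow> dist a (xk, vk) < \<delta>4 \<Longrightarrow>
          inner (uk, mk) (a - (xk, vk)) \<le> \<eta> * norm (a - (xk, vk))"
        using reg \<open>\<eta> > 0\<close> unfolding regular_normal_cone_iff by meson
      define \<mu> where "\<mu> = min \<delta>m (min (\<rho> / 2) (min (\<delta>3 / 2) \<delta>4))"
      have "\<mu> > 0" using \<delta>m_pos \<open>\<rho> > 0\<close> \<open>\<delta>3 > 0\<close> \<open>\<delta>4 > 0\<close> unfolding \<mu>_def by auto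
      then have \<mu>: "\<mu> > 0" "\<mu> \<le> \<delta>m" "\<mu> \<le> \<rho> / 2" "\<mu> \<le> \<delta>3 / 2" "\<mu> \<le> \<delta>4"
        by (simp_all only: \<mu>_def min.cobounded1 min.coboundedI2[OF min.cobounded1]
            min.coboundedI2[OF min.coboundedI2[OF min.cobounded1]] min.coboundedI2[OF min.coboundedI2[OF min.cobounded2]])
      \<comment> \<open>Small enough for the perturbed point to stay where all local inequalities hold.\<close>
      define t where "t = \<mu> / ((1 + C) * norm w)"
      have t: "t > 0" using \<mu>(1) C_pos w by (simp add: t_def)
      have tw: "t * norm w = \<mu> / (1 + C)" using w by (simp add: t_def)
      have tw1: "t * norm w < \<mu>" "C * (t * norm w) < \<mu>"
        unfolding tw using \<mu>(1) C_pos by (auto simp: divide_less_eq algebra_simps)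
      have "\<exists>x' v'. (x', v') \<in> G \<and> gf x' + v' = (gf xk + vk) - t *\<^sub>R w \<and>
          norm (x' - xk) + norm (v' - vk) \<le> C * norm ((gf xk + vk) - t *\<^sub>R w - (gf xk + vk))"
      proof (rule regular[OF Gk])
        show "norm (xk - xb) < \<delta>m" using xk(1) \<beta>(4) norm_triangle_ineq[of "xk - x" "x - xb"] by simp
        show "norm (vk - vb) < \<delta>m" using xk(2) \<beta>(5) norm_triangle_ineq[of "vk - v" "v - vb"] by simp
        show "norm ((gf xk + vk) - t *\<^sub>R w - (gf xk + vk)) < \<delta>m" using tw1 \<mu>(2) t by simp
      qed
      then obtain x' v' where x': "(x', v') \<in> G" "gf x' + v' = (gf xk + vk) - t *\<^sub>R w"
        and S0: "norm (x' - xk) + norm (v' - vk) \<le> C * (t * norm w)"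
        using t by auto
      define dx where "dx = x' - xk"
      define dv where "dv = v' - vk"
      define S where "S = norm dx + norm dv"
      have S: "S \<le> C * (t * norm w)" "S < \<mu>" "0 \<le> S" "norm dx \<le> S" "norm dv \<le> S"
        using S0 tw1 by (auto simp: S_def dx_def dv_def)
      have nP: "norm (dx, dv) \<le> S" unfolding S_def by (rule norm_Pair_le)
      have x'x: "norm (x' - x) < \<mu> + \<beta>" "norm (v' - v) < \<mu> + \<beta>"
        using S(2,4,5) xk norm_triangle_ineq[of "x' - xk" "xk - x"] norm_triangle_ineq[of "v' - vk" "vk - v"]
        by (auto simp: dx_def dv_def)
      have "dist (x', v') (xk, vk) < \<delta>4" using nP S(2) \<mu>(5) by (simp add: dist_norm dx_def dv_def)
      from r4[OF x'(1) this] have "inner uk dx + inner mk dv \<le> \<eta> * norm (dx, dv)"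
        by (simp add: dx_def dv_def)
      also have "\<dots> \<le> \<eta> * S" using nP \<open>\<eta> > 0\<close> by (intro mult_left_mono) auto
      finally have i1: "inner uk dx + inner mk dv \<le> \<eta> * S" .
      have i1a: "- (inner (uk - u) dx) \<le> \<eta> * norm dx"
        using norm_cauchy_schwarz[of "- (uk - u)" dx] mult_right_mono[OF uk(1), of "norm dx"]
        by (simp add: norm_minus_commute inner_diff_left)
      have i1b: "- (inner (mk + d) dv) \<le> \<eta> * norm dv"
        using norm_cauchy_schwarz[of "- (mk + d)" dv] mult_right_mono[OF uk(2), of "norm dv"]
        by (simp only: norm_minus_cancel inner_minus_left) simp
      have i2: "inner u dx - inner d dv \<le> 2 * \<eta> * S"
        using i1 i1a i1b by (simp add: S_def inner_diff_left inner_add_left algebra_simps)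
      have i3: "inner (v - vb) dx - inner (x - xb) dv \<le> e * D * S"
        unfolding S_def dx_def dv_def
        using x'x xk \<mu>(3) \<beta>(2) \<open>\<rho> > 0\<close> by (intro \<rho> x'(1) Gk) auto
      define r1 where "r1 = gf x - gf xb - H (x - xb)"
      define r2 where "r2 = gf x' - gf xk - H dx"
      have "norm r1 \<le> e * norm (x - xb)"
        unfolding r1_def H_def using xv(2) \<delta>(1,3) by (intro str) auto
      also have "\<dots> \<le> e * D" using e by (intro mult_left_mono) (auto simp: D_def)
      finally have r1: "norm r1 \<le> e * D" .
      have r2: "norm r2 \<le> \<eta> * norm dx"
        unfolding r2_def dx_def using x'x(1) xk(1) \<mu>(4) \<beta>(3) \<open>\<delta>3 > 0\<close> by (intro str3) auto
      \<comment> \<open>Stationarity of \<open>xb\<close> enters here: only the linearisation error \<open>r1\<close> and \<open>H w\<close> remain.\<close>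
      have uv: "u + (v - vb) = - r1 - H w"
      proof -
        have "H d = H w - H (x - xb)"
          unfolding H_def blinfun.diff_right[symmetric] by (simp add: w_def)
        moreover have "vb = - gf xb" using stationary by (simp add: eq_neg_iff_add_eq_0 add.commute)
        ultimately show ?thesis by (simp add: u_def r1_def H_def[symmetric])
      qed
      have dv: "dv = - (t *\<^sub>R w) - (r2 + H dx)"
        using x'(2) by (simp add: dv_def r2_def algebra_simps)
      have dw: "d = w - (x - xb)" by (simp add: w_def)
      have i4: "inner (u + (v - vb)) dx - inner w dv \<le> 2 * \<eta> * S + e * D * S"
        using i2 i3 unfolding dw by (simp add: inner_diff_left inner_add_left)
      have "inner (u + (v - vb)) dx - inner w dv = - inner r1 dx + t * (norm w)\<^sup>2 + inner w r2"
        unfolding uv using Hf_sym[of x w dx]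
        by (subst dv) (simp add: H_def inner_diff_left inner_diff_right inner_add_right power2_norm_eq_inner)
      then have i5: "t * (norm w)\<^sup>2 \<le> 2 * \<eta> * S + e * D * S + inner r1 dx - inner w r2" using i4 by linarith
      have i6: "inner r1 dx \<le> e * D * S"
      proof -
        have "inner r1 dx \<le> norm r1 * norm dx" by (rule norm_cauchy_schwarz)
        also have "\<dots> \<le> (e * D) * S" using r1 S e D0 by (intro mult_mono) auto
        finally show ?thesis .
      qed
      have i7: "- inner w r2 \<le> norm w * (\<eta> * S)"
      proof -
        have "- inner w r2 \<le> norm w * norm r2" using norm_cauchy_schwarz[of w "- r2"] by simp
        also have "\<dots> \<le> norm w * (\<eta> * S)"
          using r2 S(4) \<open>\<eta> > 0\<close> by (intro mult_left_mono order_trans[OF r2]) auto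
        finally show ?thesis .
      qed
      have "t * (norm w)\<^sup>2 \<le> 2 * \<eta> * S + e * D * S + e * D * S + norm w * (\<eta> * S)"
        using i5 i6 i7 by linarith
      also have "\<dots> = (2 * e * D + \<eta> * (2 + norm w)) * S" by (simp add: algebra_simps)
      also have "\<dots> \<le> (2 * e * D + \<eta> * (2 + norm w)) * (C * (t * norm w))"
        using S(1) e D0 \<open>\<eta> > 0\<close> by (intro mult_left_mono) auto
      finally have "(t * norm w) * norm w \<le> (t * norm w) * (C * (2 * e * D + \<eta> * (2 + norm w)))"
        by (simp add: power2_eq_square mult_ac)
      then have "norm w \<le> C * (2 * e * D + \<eta> * (2 + norm w))" using t w by simp
      also have "\<dots> = \<epsilon> * D + C * (\<eta> * (2 + norm w))" using C_pos by (simp add: e_def field_simps)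
      finally show ?thesis .
    qed
    have "norm w \<le> \<epsilon> * D"
    proof (rule field_le_epsilon)
      fix \<epsilon>' :: real assume "\<epsilon>' > 0"
      have c: "2 + norm w > 0" by (smt (verit) norm_ge_zero)
      then have "\<epsilon>' / (C * (2 + norm w)) > 0" using \<open>\<epsilon>' > 0\<close> C_pos by simp
      from key[OF this] c C_pos show "norm w \<le> \<epsilon> * D + \<epsilon>'" by simp
    qed
    then show "norm (x + d - xb) \<le> \<epsilon> * (norm (x - xb) + norm (v - vb))" by (simp add: w_def D_def)
  qed
qed

text \<open>
  The map \<open>gf + \<partial>g\<close> in the coordinate \<open>z\<close>.
\<close>

definition F where "F z = gf (P z) + V z"

text \<open>
  A radius around \<open>zb\<close> on which metric regularity and the chart are both available, with one Lipschitz constant for all coordinate maps.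
\<close>

definition newton_radius where
  "newton_radius \<delta> \<Lambda> \<longleftrightarrow> 0 < \<delta> \<and> \<delta> \<le> \<delta>0 \<and> 0 < \<Lambda> \<and>
     (\<forall>z\<in>ball zb \<delta>. norm (P z - xb) < min \<delta>0 \<delta>m \<and> norm (V z - vb) < min \<delta>0 \<delta>m) \<and>
     (\<forall>z\<in>ball zb \<delta>. \<forall>z'\<in>ball zb \<delta>. norm (F z - F z') \<le> \<Lambda> * norm (z - z') \<and>
        norm (P z - P z') \<le> \<Lambda> * norm (z - z') \<and> norm (V z - V z') \<le> \<Lambda> * norm (z - z'))"

lemma newton_radius_exists: "\<exists>\<delta>1 \<Lambda>. newton_radius \<delta>1 \<Lambda>"
proof -
  obtain \<delta>2 where "\<delta>2 > 0" and str: "\<And>x y z. norm (x - xb) < \<delta>2 \<Longrightarrow> norm (y - xb) < \<delta>2 \<Longrightarrow> norm (z - xb) < \<delta>2 \<Longrightarrow>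
      norm (gf y - gf z - blinfun_apply (Hf x) (y - z)) \<le> 1 * norm (y - z)"
    using gf_strict[OF zero_less_one, of xb] by blast
  define ell where "ell = norm (Hf xb) + 1"
  have l: "ell > 0" unfolding ell_def by (smt (verit) norm_ge_zero)
  have gf_lip: "norm (gf y - gf z) \<le> ell * norm (y - z)" if "norm (y - xb) < \<delta>2" "norm (z - xb) < \<delta>2" for y z
  proof -
    have "norm (gf y - gf z - blinfun_apply (Hf xb) (y - z)) \<le> 1 * norm (y - z)"
      using that \<open>\<delta>2 > 0\<close> by (intro str) auto
    moreover have "norm (blinfun_apply (Hf xb) (y - z)) \<le> norm (Hf xb) * norm (y - z)" by (rule norm_blinfun)
    ultimately show ?thesis
      using norm_triangle_sub[of "gf y - gf z" "blinfun_apply (Hf xb) (y - z)"]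
      by (simp add: ell_def distrib_right)
  qed
  have "min (min \<delta>0 \<delta>m) \<delta>2 > 0" using \<delta>0_pos \<delta>m_pos \<open>\<delta>2 > 0\<close> by simp
  then obtain \<delta>1 where \<delta>1: "0 < \<delta>1" "\<delta>1 \<le> \<delta>0"
    "\<And>z. z \<in> ball zb \<delta>1 \<Longrightarrow> norm (P z - xb) < min (min \<delta>0 \<delta>m) \<delta>2 \<and> norm (V z - vb) < min (min \<delta>0 \<delta>m) \<delta>2"
    by (rule chart_radius) blast
  define \<Lambda> where "\<Lambda> = ell * L + (1 + L) / lam + L"
  have L': "(1 + L) / lam > 0" "ell * L > 0" using L_pos lam_pos l by auto
  have "newton_radius \<delta>1 \<Lambda>"
    unfolding newton_radius_def
  proof (intro conjI ballI \<delta>1(1,2))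
    show "\<Lambda> > 0" using L' L_pos by (simp add: \<Lambda>_def)
    show "norm (P z - xb) < min \<delta>0 \<delta>m" "norm (V z - vb) < min \<delta>0 \<delta>m" if "z \<in> ball zb \<delta>1" for z
      using \<delta>1(3)[OF that] by simp_all
    fix z z' assume z: "z \<in> ball zb \<delta>1" "z' \<in> ball zb \<delta>1"
    then have zin: "z \<in> ball zb \<delta>0" "z' \<in> ball zb \<delta>0" using \<delta>1(2) by auto
    let ?n = "norm (z - z')"
    note Pl = P_lip[OF zin] and Vl = V_lip[OF zin]
    have "norm (F z - F z') \<le> norm (gf (P z) - gf (P z')) + norm (V z - V z')"
      using norm_triangle_ineq[of "gf (P z) - gf (P z')" "V z - V z'"] by (simp add: F_def algebra_simps)
    also have "norm (gf (P z) - gf (P z')) \<le> ell * norm (P z - P z')"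
      using \<delta>1(3)[OF z(1)] \<delta>1(3)[OF z(2)] by (intro gf_lip) auto
    also have "ell * norm (P z - P z') \<le> ell * (L * ?n)" using Pl l by (intro mult_left_mono) auto
    finally have "norm (F z - F z') \<le> (ell * L + (1 + L) / lam) * ?n" using Vl by (simp add: distrib_right)
    also have "\<dots> \<le> \<Lambda> * ?n" unfolding \<Lambda>_def using L_pos by (intro mult_right_mono) auto
    finally have "norm (F z - F z') \<le> \<Lambda> * ?n" .
    moreover have "L * ?n \<le> \<Lambda> * ?n"
      unfolding \<Lambda>_def using L' L_pos by (intro mult_right_mono) auto
    moreover have "(1 + L) / lam * ?n \<le> \<Lambda> * ?n"
      unfolding \<Lambda>_def using L' L_pos by (intro mult_right_mono) auto
    ultimately show "norm (F z - F z') \<le> \<Lambda> * ?n" "norm (P z - P z') \<le> \<Lambda> * ?n" "norm (V z - V z') \<le> \<Lambda> * ?n"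
      using Pl Vl by linarith+
  qed
  then show ?thesis by blast
qed

text \<open>
  Openness of \<open>F\<close> with a linear rate.
\<close>

lemma F_solve:
  assumes z: "z \<in> ball zb \<delta>0" "norm (P z - xb) < min \<delta>0 \<delta>m" "norm (V z - vb) < min \<delta>0 \<delta>m"
    and S: "open S" "z \<in> S"
  shows "\<exists>\<epsilon>>0. \<forall>y. norm (y - F z) < \<epsilon> \<longrightarrow> (\<exists>z'\<in>S. F z' = y \<and> norm (P z' - P z) \<le> C * norm (y - F z))"
proof -
  obtain \<sigma> where \<sigma>: "\<sigma> > 0" "ball z \<sigma> \<subseteq> S" using S open_contains_ball by metis
  define s where "s = min (\<delta>0 - norm (P z - xb)) (\<delta>0 - norm (V z - vb))"
  have s: "s > 0" "norm (P z - xb) \<le> \<delta>0 - s" "norm (V z - vb) \<le> \<delta>0 - s" using z by (auto simp: s_def)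
  have l1: "1 + lam > 0" using lam_pos by simp
  define \<epsilon> where "\<epsilon> = min \<delta>m (min (s / C) (\<sigma> / ((1 + lam) * C)))"
  have "\<epsilon> > 0" using \<delta>m_pos s \<sigma> C_pos l1 by (simp add: \<epsilon>_def)
  moreover have "\<exists>z'\<in>S. F z' = y \<and> norm (P z' - P z) \<le> C * norm (y - F z)" if y: "norm (y - F z) < \<epsilon>" for y
  proof -
    let ?n = "norm (y - F z)"
    have n: "?n < \<delta>m" "C * ?n < s" "(1 + lam) * (C * ?n) < \<sigma>"
      using y C_pos l1 by (auto simp: \<epsilon>_def less_divide_eq mult_ac)
    obtain x' v' where x': "(x', v') \<in> G" "gf x' + v' = y" "norm (x' - P z) + norm (v' - V z) \<le> C * ?n"
      using regular[OF chart_mem[OF z(1)], of y] z n(1) by (auto simp: F_def)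
    have "norm (x' - P z) < s" "norm (v' - V z) < s"
      using x'(3) n(2) norm_ge_zero[of "x' - P z"] norm_ge_zero[of "v' - V z"] by linarith+
    then have "norm (x' - xb) < \<delta>0" "norm (v' - vb) < \<delta>0"
      using s norm_triangle_ineq[of "x' - P z" "P z - xb"] norm_triangle_ineq[of "v' - V z" "V z - vb"] by auto
    note ch = graph_to_chart[OF x'(1) this]
    let ?z = "x' + lam *\<^sub>R v'"
    have "norm (?z - (P z + lam *\<^sub>R V z)) \<le> (1 + lam) * (norm (x' - P z) + norm (v' - V z))"
      by (rule norm_chart_diff_le)
    also have "\<dots> \<le> (1 + lam) * (C * ?n)" using x'(3) l1 by (intro mult_left_mono) auto
    also have "\<dots> < \<sigma>" by (rule n(3))
    finally have "?z \<in> S" using \<sigma>(2) by (auto simp: P_plus_V dist_norm norm_minus_commute)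
    moreover have "F ?z = y" using ch x'(2) by (simp add: F_def)
    moreover have "norm (P ?z - P z) \<le> C * ?n" using x'(3) ch(1) by (smt (verit) norm_ge_zero)
    ultimately show ?thesis by blast
  qed
  ultimately show ?thesis by blast
qed

text \<open>
  Choose \<open>z'\<close> near \<open>z0\<close> isolated in its fibre and minimise \<open>\<langle>w, P z\<rangle> + K |F z - F z'|\<^sup>2\<close> on a small ball around \<open>z'\<close>.
  On the boundary of the ball \<open>|F z - F z'|\<close> is bounded away from \<open>0\<close>, so for large \<open>K\<close> the minimiser is interior, and
  optimality is the normal inequality with \<open>d = 2 K (F z - F z')\<close>. Moving \<open>F\<close> towards \<open>F z'\<close>, which \<open>F_solve\<close> permits, bounds \<open>d\<close>
  independently of \<open>K\<close>.
\<close>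

lemma approximate_newton_normal:
  assumes radius: "newton_radius \<delta>1 \<Lambda>"
    and z0: "z0 \<in> ball zb \<delta>1" and "0 < \<eta>"
  shows "\<exists>z\<in>ball z0 \<eta>. \<exists>d. z \<in> ball zb \<delta>1 \<and> norm d \<le> C * norm w \<and>
    (- w - blinfun_apply (Hf (P z)) d, - d) \<in> regular_normal_cone G (P z, V z)"
proof -
  have \<delta>1: "\<delta>1 \<le> \<delta>0" and \<Lambda>: "0 < \<Lambda>"
    and near: "\<And>z. z \<in> ball zb \<delta>1 \<Longrightarrow> norm (P z - xb) < min \<delta>0 \<delta>m \<and> norm (V z - vb) < min \<delta>0 \<delta>m"
    and lip: "\<And>z z'. z \<in> ball zb \<delta>1 \<Longrightarrow> z' \<in> ball zb \<delta>1 \<Longrightarrow>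
       norm (F z - F z') \<le> \<Lambda> * norm (z - z') \<and> norm (P z - P z') \<le> \<Lambda> * norm (z - z')"
    using radius by (auto simp: newton_radius_def)
  obtain \<rho>' where \<rho>': "\<rho>' > 0" "ball z0 \<rho>' \<subseteq> ball zb \<delta>1" using z0 open_ball open_contains_ball by metis
  define \<rho> where "\<rho> = min \<rho>' \<eta>"
  have \<rho>: "\<rho> > 0" "ball z0 \<rho> \<subseteq> ball zb \<delta>1" "ball z0 \<rho> \<subseteq> ball z0 \<eta>"
    using \<rho>' \<open>0 < \<eta>\<close> by (auto simp: \<rho>_def)
  have sub0: "z \<in> ball zb \<delta>0" if "z \<in> ball zb \<delta>1" for z using that \<delta>1 by auto
  have "\<exists>z s. 0 < s \<and> cball z s \<subseteq> ball z0 \<rho> \<and> (\<forall>y\<in>cball z s. F y = F z \<longrightarrow> y = z)"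
  proof (rule open_lipschitz_map_isolated_fibre_point[OF \<rho>(1) \<Lambda>])
    show "norm (F x - F y) \<le> \<Lambda> * norm (x - y)" if "x \<in> ball z0 \<rho>" "y \<in> ball z0 \<rho>" for x y
      using lip that \<rho>(2) by blast
    show "open (F ` S)" if S: "open S" "S \<subseteq> ball z0 \<rho>" for S
      unfolding open_contains_ball
    proof
      fix a assume "a \<in> F ` S"
      then obtain z where z: "z \<in> S" "a = F z" by blast
      then have z1: "z \<in> ball zb \<delta>1" using S \<rho>(2) by blast
      obtain \<epsilon> where "\<epsilon> > 0" "\<forall>y. norm (y - F z) < \<epsilon> \<longrightarrow> (\<exists>z'\<in>S. F z' = y \<and> norm (P z' - P z) \<le> C * norm (y - F z))"
        using F_solve[OF sub0[OF z1] _ _ S(1) z(1)] near[OF z1] by blast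
      then have "ball a \<epsilon> \<subseteq> F ` S" unfolding z(2) by (force simp: dist_norm norm_minus_commute)
      then show "\<exists>e>0. ball a e \<subseteq> F ` S" using \<open>\<epsilon> > 0\<close> by blast
    qed
  qed
  then obtain z' s where s: "0 < s" "cball z' s \<subseteq> ball z0 \<rho>"
    and iso: "\<And>y. y \<in> cball z' s \<Longrightarrow> F y = F z' \<Longrightarrow> y = z'" by blast
  have cb: "cball z' s \<subseteq> ball zb \<delta>1" using s \<rho> by blast
  have z'c: "z' \<in> cball z' s" using s by simp
  have contF: "continuous_on (cball z' s) F"
    using lip cb \<Lambda> by (intro lipschitz_on_continuous_on[of \<Lambda>] lipschitz_onI) (auto simp: dist_norm subset_iff)
  have contP: "continuous_on (cball z' s) P"
    using lip cb \<Lambda> by (intro lipschitz_on_continuous_on[of \<Lambda>] lipschitz_onI) (auto simp: dist_norm subset_iff)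
  obtain \<mu> where \<mu>: "\<mu> > 0" "\<And>z. z \<in> sphere z' s \<Longrightarrow> \<mu> \<le> norm (F z - F z')"
  proof (cases "sphere z' s = {}")
    case True
    then show thesis using that[of 1] by auto
  next
    case False
    have "continuous_on (sphere z' s) (\<lambda>z. norm (F z - F z'))"
      by (intro continuous_intros continuous_on_subset[OF contF]) auto
    then obtain a where a: "a \<in> sphere z' s" "\<And>z. z \<in> sphere z' s \<Longrightarrow> norm (F a - F z') \<le> norm (F z - F z')"
      using continuous_attains_inf[OF compact_sphere False] by blast
    have "a \<noteq> z'" "a \<in> cball z' s" using a(1) s(1) by auto
    then have "F a \<noteq> F z'" using iso by blast
    then show thesis using a(2) by (intro that[of "norm (F a - F z')"]) auto
  qed
  \<comment> \<open>On the sphere the penalty exceeds the largest possible gain \<open>|w| \<Lambda> s\<close> of the linear term.\<close>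
  define K where "K = (norm w * (\<Lambda> * s) + 1) / \<mu>\<^sup>2"
  have "norm w * (\<Lambda> * s) \<ge> 0" using \<Lambda> s by simp
  then have K: "K > 0" "norm w * (\<Lambda> * s) < K * \<mu>\<^sup>2" using \<mu>(1) by (auto simp: K_def intro!: divide_pos_pos)
  define \<Psi> where "\<Psi> z = inner w (P z) + K * (norm (F z - F z'))\<^sup>2" for z
  have "continuous_on (cball z' s) \<Psi>" unfolding \<Psi>_def by (intro continuous_intros contF contP)
  then obtain z2 where z2: "z2 \<in> cball z' s" "\<And>z. z \<in> cball z' s \<Longrightarrow> \<Psi> z2 \<le> \<Psi> z"
    using continuous_attains_inf[OF compact_cball, of z' s \<Psi>] z'c by blast
  have z2b: "z2 \<in> ball z' s"
  proof (rule ccontr)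
    assume "z2 \<notin> ball z' s"
    then have sp: "z2 \<in> sphere z' s" using z2(1) by auto
    have "K * \<mu>\<^sup>2 \<le> K * (norm (F z2 - F z'))\<^sup>2"
      using \<mu>(2)[OF sp] \<mu>(1) K(1) by (intro mult_left_mono power_mono) auto
    also have "\<dots> \<le> inner w (P z' - P z2)" using z2(2)[OF z'c] by (simp add: \<Psi>_def inner_diff_right)
    also have "\<dots> \<le> norm w * norm (P z' - P z2)" by (rule norm_cauchy_schwarz)
    also have "\<dots> \<le> norm w * (\<Lambda> * s)"
    proof (intro mult_left_mono)
      have "norm (P z' - P z2) \<le> \<Lambda> * norm (z' - z2)" using lip cb z'c z2(1) by blast
      also have "\<dots> = \<Lambda> * s" using sp by (simp add: dist_norm)
      finally show "norm (P z' - P z2) \<le> \<Lambda> * s" .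
    qed simp
    finally show False using K(2) by simp
  qed
  have z21: "z2 \<in> ball zb \<delta>1" using cb z2(1) by blast
  define \<theta> where "\<theta> = F z2 - F z'"
  define d where "d = (2 * K) *\<^sub>R \<theta>"
  \<comment> \<open>Optimality of \<open>z2\<close>, with the square expanded around \<open>F z2\<close>.\<close>
  have opt: "0 \<le> inner w (P z - P z2) + inner d (F z - F z2) + K * (norm (F z - F z2))\<^sup>2" if "z \<in> cball z' s" for z
  proof -
    have "F z - F z' = \<theta> + (F z - F z2)" by (simp add: \<theta>_def)
    moreover have "(norm (\<theta> + b))\<^sup>2 = (norm \<theta>)\<^sup>2 + 2 * inner \<theta> b + (norm b)\<^sup>2" for b
      by (simp add: power2_norm_eq_inner inner_add_left inner_add_right inner_commute)
    ultimately have "(norm (F z - F z'))\<^sup>2 = (norm \<theta>)\<^sup>2 + 2 * inner \<theta> (F z - F z2) + (norm (F z - F z2))\<^sup>2"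
      by (simp only:)
    then show ?thesis using z2(2)[OF that]
      by (simp add: \<Psi>_def d_def \<theta>_def[symmetric] inner_diff_right distrib_left) (simp add: algebra_simps)
  qed
  obtain \<epsilon>0 where "\<epsilon>0 > 0" and solve: "\<And>y. norm (y - F z2) < \<epsilon>0 \<Longrightarrow>
      \<exists>z\<in>ball z' s. F z = y \<and> norm (P z - P z2) \<le> C * norm (y - F z2)"
    using F_solve[OF sub0[OF z21] _ _ open_ball z2b] near[OF z21] by blast
  have dle: "norm d \<le> C * norm w"
  proof (cases "\<theta> = 0")
    case True
    then show ?thesis using C_pos by (simp add: d_def)
  next
    case False
    have "2 * K * norm \<theta> \<le> C * norm w"
    proof (rule tendsto_upperbound)
      show "((\<lambda>t. 2 * K * norm \<theta> - t * (K * norm \<theta>)) \<longlongrightarrow> 2 * K * norm \<theta>) (at_right 0)"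
        by (rule tendsto_eq_intros | simp)+
      have "\<epsilon>0 / norm \<theta> > 0" using \<open>\<epsilon>0 > 0\<close> False by simp
      then show "\<forall>\<^sub>F t in at_right 0. 2 * K * norm \<theta> - t * (K * norm \<theta>) \<le> C * norm w"
      proof (rule eventually_at_rightI[rotated])
        fix t assume "t \<in> {0<..<\<epsilon>0 / norm \<theta>}"
        then have t: "0 < t" "t * norm \<theta> < \<epsilon>0" using False by (auto simp: less_divide_eq)
        then obtain z where z: "z \<in> ball z' s" "F z = F z2 - t *\<^sub>R \<theta>"
          "norm (P z - P z2) \<le> C * (t * norm \<theta>)"
          using solve[of "F z2 - t *\<^sub>R \<theta>"] by auto
        have "0 \<le> inner w (P z - P z2) + inner d (F z - F z2) + K * (norm (F z - F z2))\<^sup>2"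
          using z(1) by (intro opt) auto
        moreover have "inner d (F z - F z2) = - (2 * K * t * (norm \<theta>)\<^sup>2)"
          by (simp add: z(2) d_def power2_norm_eq_inner)
        moreover have "(norm (F z - F z2))\<^sup>2 = (t * norm \<theta>)\<^sup>2" using t by (simp add: z(2))
        moreover have "inner w (P z - P z2) \<le> norm w * (C * (t * norm \<theta>))"
          using norm_cauchy_schwarz[of w "P z - P z2"] mult_left_mono[OF z(3), of "norm w"] by simp
        ultimately have "2 * K * t * (norm \<theta>)\<^sup>2 \<le> norm w * (C * (t * norm \<theta>)) + K * (t * norm \<theta>)\<^sup>2" by simp
        then have "(t * norm \<theta>) * (2 * K * norm \<theta> - t * (K * norm \<theta>)) \<le> (t * norm \<theta>) * (C * norm w)"
          by (simp add: power2_eq_square algebra_simps)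
        then show "2 * K * norm \<theta> - t * (K * norm \<theta>) \<le> C * norm w" using t False by simp
      qed
    qed simp
    then show ?thesis using K(1) by (simp add: d_def)
  qed
  let ?H = "blinfun_apply (Hf (P z2))"
  have "(- w - ?H d, - d) \<in> regular_normal_cone G (P z2, V z2)"
    unfolding regular_normal_cone_iff
  proof (intro conjI allI impI)
    show "(P z2, V z2) \<in> G" by (rule chart_mem[OF sub0[OF z21]])
    fix \<epsilon> :: real assume "\<epsilon> > 0"
    have nd: "norm d + 1 > 0" by (smt (verit) norm_ge_zero)
    define \<epsilon>1 where "\<epsilon>1 = \<epsilon> / (2 * (norm d + 1))"
    have \<epsilon>1: "\<epsilon>1 > 0" "norm d * \<epsilon>1 \<le> \<epsilon> / 2"
      using \<open>\<epsilon> > 0\<close> nd by (auto simp: \<epsilon>1_def field_simps)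
    obtain \<delta>5 where "\<delta>5 > 0" and str: "\<And>y. norm (y - P z2) < \<delta>5 \<Longrightarrow>
        norm (gf y - gf (P z2) - ?H (y - P z2)) \<le> \<epsilon>1 * norm (y - P z2)"
    proof -
      obtain \<delta>' where "\<delta>' > 0" "\<forall>x y z. norm (x - P z2) < \<delta>' \<longrightarrow> norm (y - P z2) < \<delta>' \<longrightarrow> norm (z - P z2) < \<delta>' \<longrightarrow>
        norm (gf y - gf z - blinfun_apply (Hf x) (y - z)) \<le> \<epsilon>1 * norm (y - z)"
        using gf_strict[OF \<epsilon>1(1), of "P z2"] by blast
      moreover from this have "norm (P z2 - P z2) < \<delta>'" by simp
      ultimately show thesis using that[of \<delta>'] by blast
    qed
    define A where "A = norm (Hf (P z2)) + \<epsilon>1 + 1"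
    have A: "A > 0" using \<epsilon>1(1) unfolding A_def by (smt (verit) norm_ge_zero)
    define sl where "sl = min (\<delta>0 - norm (P z2 - xb)) (\<delta>0 - norm (V z2 - vb))"
    have sl: "sl > 0" "norm (P z2 - xb) \<le> \<delta>0 - sl" "norm (V z2 - vb) \<le> \<delta>0 - sl"
      using near[OF z21] by (auto simp: sl_def)
    define r where "r = min (min sl \<delta>5) (min ((s - dist z' z2) / (2 * (1 + lam))) (\<epsilon> / (2 * (K * A\<^sup>2))))"
    have r0: "r > 0"
      using sl(1) \<open>\<delta>5 > 0\<close> z2b lam_pos \<open>\<epsilon> > 0\<close> K(1) A by (simp add: r_def)
    have "inner (- w - ?H d, - d) (a - (P z2, V z2)) \<le> \<epsilon> * norm (a - (P z2, V z2))"
      if a: "a \<in> G" "dist a (P z2, V z2) < r" for a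
    proof -
      obtain x v where xv: "a = (x, v)" by force
      define N where "N = norm (a - (P z2, V z2))"
      have "N < r" using a(2) by (simp add: N_def dist_norm)
      then have N: "N < sl" "N < \<delta>5" "N < (s - dist z' z2) / (2 * (1 + lam))" "N < \<epsilon> / (2 * (K * A\<^sup>2))"
        unfolding r_def min_less_iff_conj by blast+
      have nx: "norm (x - P z2) \<le> N" using norm_fst_le[of "x - P z2" "v - V z2"] by (simp add: xv N_def)
      have nv: "norm (v - V z2) \<le> N" using norm_snd_le[of "v - V z2" "x - P z2"] by (simp add: xv N_def)
      have "norm (x - xb) < \<delta>0" "norm (v - vb) < \<delta>0"
        using nx nv N(1) sl norm_triangle_ineq[of "x - P z2" "P z2 - xb"]
          norm_triangle_ineq[of "v - V z2" "V z2 - vb"] by auto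
      note ch = graph_to_chart[OF a(1)[unfolded xv] this]
      let ?z = "x + lam *\<^sub>R v"
      have "norm (?z - (P z2 + lam *\<^sub>R V z2)) \<le> (1 + lam) * (norm (x - P z2) + norm (v - V z2))"
        by (rule norm_chart_diff_le)
      also have "\<dots> \<le> (1 + lam) * (N + N)" using nx nv lam_pos by (intro mult_left_mono) auto
      also have "\<dots> \<le> s - dist z' z2" using N(3) lam_pos by (simp add: field_simps)
      finally have "dist z2 ?z \<le> s - dist z' z2" by (simp add: P_plus_V dist_norm norm_minus_commute)
      then have "?z \<in> cball z' s" using dist_triangle[of z' ?z z2] by simp
      from opt[OF this] have o1: "0 \<le> inner w (x - P z2) + inner d (F ?z - F z2) + K * (norm (F ?z - F z2))\<^sup>2"
        using ch by simp
      define q where "q = gf x - gf (P z2) - ?H (x - P z2)"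
      have q: "norm q \<le> \<epsilon>1 * norm (x - P z2)" unfolding q_def using nx N(2) by (intro str) auto
      also have "\<dots> \<le> \<epsilon>1 * N" using nx \<epsilon>1(1) by (intro mult_left_mono) auto
      finally have qN: "norm q \<le> \<epsilon>1 * N" .
      have FF: "F ?z - F z2 = (v - V z2) + (?H (x - P z2) + q)" using ch by (simp add: F_def q_def)
      have "norm (F ?z - F z2) \<le> norm (v - V z2) + (norm (?H (x - P z2)) + norm q)"
        unfolding FF by (intro order_trans[OF norm_triangle_ineq] add_mono norm_triangle_ineq order_refl)
      also have "\<dots> \<le> N + (norm (Hf (P z2)) * N + \<epsilon>1 * N)"
        using nv qN order_trans[OF norm_blinfun mult_left_mono[OF nx norm_ge_zero]] by (intro add_mono) auto
      also have "\<dots> = A * N" by (simp add: A_def algebra_simps)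
      finally have FA: "norm (F ?z - F z2) \<le> A * N" .
      have "inner (- w - ?H d, - d) (a - (P z2, V z2)) = - inner w (x - P z2) - inner d (?H (x - P z2)) - inner d (v - V z2)"
        using Hf_sym[of "P z2" d "x - P z2"] by (simp add: xv inner_diff_left)
      also have "\<dots> \<le> inner d q + K * (norm (F ?z - F z2))\<^sup>2"
        using o1 unfolding FF by (simp add: inner_add_right)
      also have "\<dots> \<le> norm d * (\<epsilon>1 * N) + K * (A * N)\<^sup>2"
        using FA K(1) norm_cauchy_schwarz[of d q] mult_left_mono[OF qN, of "norm d"]
        by (intro add_mono mult_left_mono power_mono) auto
      also have "\<dots> = (norm d * \<epsilon>1) * N + (K * A\<^sup>2 * N) * N" by (simp add: power2_eq_square mult_ac)
      also have "\<dots> \<le> (\<epsilon> / 2) * N + (\<epsilon> / 2) * N"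
      proof (intro add_mono mult_right_mono \<epsilon>1(2))
        show "K * A\<^sup>2 * N \<le> \<epsilon> / 2" using N(4) K(1) A by (simp add: field_simps)
      qed (auto simp: N_def)
      finally show ?thesis by (simp add: N_def)
    qed
    then show "\<exists>\<delta>>0. \<forall>a\<in>G. dist a (P z2, V z2) < \<delta> \<longrightarrow>
        inner (- w - ?H d, - d) (a - (P z2, V z2)) \<le> \<epsilon> * norm (a - (P z2, V z2))"
      using r0 by blast
  qed
  moreover have "z2 \<in> ball z0 \<eta>" using z2(1) s(2) \<rho>(3) by blast
  ultimately show ?thesis using dle z21 by blast
qed

lemma newton_direction_exists:
  "\<exists>\<delta>>0. \<forall>x v w. (x, v) \<in> G \<longrightarrow> norm (x - xb) < \<delta> \<longrightarrow> norm (v - vb) < \<delta> \<longrightarrow>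
    (\<exists>d. (- w - blinfun_apply (Hf x) d, - d) \<in> limiting_normal_cone G (x, v))"
proof -
  obtain \<delta>1 \<Lambda> where radius: "newton_radius \<delta>1 \<Lambda>" using newton_radius_exists by blast
  then have \<delta>1: "0 < \<delta>1" and \<Lambda>: "0 < \<Lambda>" and lip: "\<And>z z'. z \<in> ball zb \<delta>1 \<Longrightarrow> z' \<in> ball zb \<delta>1 \<Longrightarrow>
       norm (P z - P z') \<le> \<Lambda> * norm (z - z') \<and> norm (V z - V z') \<le> \<Lambda> * norm (z - z')"
    by (auto simp: newton_radius_def)
  have l1: "1 + lam > 0" using lam_pos by simp
  define \<delta> where "\<delta> = min \<delta>0 (\<delta>1 / (2 * (1 + lam)))"
  have "0 < \<delta>" using \<delta>1 \<delta>0_pos l1 by (simp add: \<delta>_def)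
  then have \<delta>: "0 < \<delta>" "\<delta> \<le> \<delta>0" "\<delta> \<le> \<delta>1 / (2 * (1 + lam))"
    by (simp_all only: \<delta>_def min.cobounded1 min.cobounded2)
  show ?thesis
  proof (rule exI[of _ \<delta>], intro conjI allI impI \<delta>(1))
    fix x v w assume xv: "(x, v) \<in> G" "norm (x - xb) < \<delta>" "norm (v - vb) < \<delta>"
    define z0 where "z0 = x + lam *\<^sub>R v"
    have Pz: "P z0 = x" "V z0 = v"
      using xv \<delta>(2) graph_to_chart[of x v] by (auto simp: z0_def)
    have "norm (z0 - zb) \<le> (1 + lam) * (norm (x - xb) + norm (v - vb))"
      unfolding z0_def zb_def by (rule norm_chart_diff_le)
    also have "\<dots> < (1 + lam) * (\<delta> + \<delta>)" using xv l1 by (intro mult_strict_left_mono add_strict_mono)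
    also have "\<dots> \<le> \<delta>1" using \<delta>(3) l1 by (simp add: field_simps)
    finally have z0: "z0 \<in> ball zb \<delta>1" by (simp add: dist_norm norm_minus_commute)
    have "\<forall>k. \<exists>z d. z \<in> ball z0 (inverse (real (Suc k))) \<and> z \<in> ball zb \<delta>1 \<and> norm d \<le> C * norm w \<and>
      (- w - blinfun_apply (Hf (P z)) d, - d) \<in> regular_normal_cone G (P z, V z)"
    proof
      fix k
      have "inverse (real (Suc k)) > 0" by simp
      from approximate_newton_normal[OF radius z0 this]
      show "\<exists>z d. z \<in> ball z0 (inverse (real (Suc k))) \<and> z \<in> ball zb \<delta>1 \<and> norm d \<le> C * norm w \<and>
        (- w - blinfun_apply (Hf (P z)) d, - d) \<in> regular_normal_cone G (P z, V z)" by blast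
    qed
    then obtain z d where zd: "\<And>k. z k \<in> ball z0 (inverse (real (Suc k)))" "\<And>k. z k \<in> ball zb \<delta>1"
      "\<And>k. norm (d k) \<le> C * norm w"
      "\<And>k. (- w - blinfun_apply (Hf (P (z k))) (d k), - d k) \<in> regular_normal_cone G (P (z k), V (z k))"
      by metis
    have zlim: "z \<longlonglongrightarrow> z0"
    proof (rule metric_LIMSEQ_I)
      fix r :: real assume "r > 0"
      then obtain n where n: "inverse (real (Suc n)) < r" using reals_Archimedean by blast
      have "dist (z k) z0 < r" if "k \<ge> n" for k
      proof -
        have "dist (z k) z0 < inverse (real (Suc k))" using zd(1)[of k] by (simp add: dist_commute)
        also have "\<dots> \<le> inverse (real (Suc n))" using that by (intro le_imp_inverse_le) auto
        finally show ?thesis using n by simp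
      qed
      then show "\<exists>n. \<forall>k\<ge>n. dist (z k) z0 < r" by blast
    qed
    have "\<forall>k. d k \<in> cball 0 (C * norm w)" using zd(3) by simp
    with compact_imp_seq_compact[OF compact_cball]
    obtain l \<phi> where l: "l \<in> cball 0 (C * norm w)" "strict_mono \<phi>" "(d \<circ> \<phi>) \<longlonglongrightarrow> l"
      by (rule seq_compactE)
    have dl: "(\<lambda>k. d (\<phi> k)) \<longlonglongrightarrow> l" using l(3) by (simp add: o_def)
    have zl: "(\<lambda>k. z (\<phi> k)) \<longlonglongrightarrow> z0" using LIMSEQ_subseq_LIMSEQ[OF zlim l(2)] by (simp add: o_def)
    have lim0: "(\<lambda>k. \<Lambda> * norm (z (\<phi> k) - z0)) \<longlonglongrightarrow> 0"
      using tendsto_mult_right_zero[OF tendsto_norm_zero[OF LIM_zero[OF zl]]] by simp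
    have Pl: "(\<lambda>k. P (z (\<phi> k))) \<longlonglongrightarrow> x"
      by (rule LIM_zero_cancel, rule tendsto_0_le[OF lim0, of _ 1])
         (use lip[OF zd(2) z0] Pz \<Lambda> in \<open>auto intro!: always_eventually\<close>)
    have Vl: "(\<lambda>k. V (z (\<phi> k))) \<longlonglongrightarrow> v"
      by (rule LIM_zero_cancel, rule tendsto_0_le[OF lim0, of _ 1])
         (use lip[OF zd(2) z0] Pz \<Lambda> in \<open>auto intro!: always_eventually\<close>)
    have Hl: "(\<lambda>k. Hf (P (z (\<phi> k)))) \<longlonglongrightarrow> Hf x" using Hf_cont Pl by (rule isCont_tendsto_compose)
    have "(- w - blinfun_apply (Hf x) l, - l) \<in> limiting_normal_cone G (x, v)"
      unfolding limiting_normal_cone_def mem_Collect_eq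
    proof (intro conjI exI allI)
      show "(\<lambda>k. (P (z (\<phi> k)), V (z (\<phi> k)))) \<longlonglongrightarrow> (x, v)" using Pl Vl by (rule tendsto_Pair)
      show "(\<lambda>k. (- w - blinfun_apply (Hf (P (z (\<phi> k)))) (d (\<phi> k)), - d (\<phi> k))) \<longlonglongrightarrow> (- w - blinfun_apply (Hf x) l, - l)"
        by (intro tendsto_intros dl Hl)
      show "(- w - blinfun_apply (Hf (P (z (\<phi> k)))) (d (\<phi> k)), - d (\<phi> k)) \<in> regular_normal_cone G (P (z (\<phi> k)), V (z (\<phi> k)))" for k
        by (rule zd(4))
      then show "(P (z (\<phi> k)), V (z (\<phi> k))) \<in> G" for k by (simp add: regular_normal_cone_iff)
    qed (rule xv(1))
    then show "\<exists>d. (- w - blinfun_apply (Hf x) d, - d) \<in> limiting_normal_cone G (x, v)" by blast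
  qed
qed

end

section \<open>Proximal points near a critical point\<close>

lemma lsc_attains_inf_cball:
  fixes \<phi> :: "'a::euclidean_space \<Rightarrow> ereal"
  assumes "lsc \<phi>" "0 \<le> R"
  shows "\<exists>x\<in>cball a R. \<forall>y\<in>cball a R. \<phi> x \<le> \<phi> y"
proof -
  let ?m = "INF y\<in>cball a R. \<phi> y"
  have ne: "\<phi> ` cball a R \<noteq> {}" using \<open>0 \<le> R\<close> by auto
  obtain u where u: "\<And>n. u n \<in> \<phi> ` cball a R" "u \<longlonglongrightarrow> ?m"
    using Inf_as_limit[OF ne] by metis
  then have "\<forall>n. \<exists>x. x \<in> cball a R \<and> u n = \<phi> x" by blast
  then obtain x where x: "\<And>n. x n \<in> cball a R" "\<And>n. u n = \<phi> (x n)" by metis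
  have "\<forall>n. x n \<in> cball a R" using x(1) ..
  with compact_imp_seq_compact[OF compact_cball]
  obtain l \<rho> where l: "l \<in> cball a R" "strict_mono \<rho>" "(x \<circ> \<rho>) \<longlonglongrightarrow> l"
    by (rule seq_compactE)
  have "\<phi> l \<le> ?m"
  proof (rule ccontr)
    assume "\<not> \<phi> l \<le> ?m"
    then obtain c where c: "?m < c" "c < \<phi> l" using dense[of ?m "\<phi> l"] unfolding not_le by auto
    have "\<phi> l \<le> Liminf (at l) \<phi>" using \<open>lsc \<phi>\<close> by (simp add: lsc_def)
    then have "\<forall>\<^sub>F y in at l. c < \<phi> y" using c(2) unfolding le_Liminf_iff by blast
    then have "\<forall>\<^sub>F y in nhds l. c < \<phi> y" using c(2) by (auto simp: eventually_nhds_conv_at)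
    then have "\<forall>\<^sub>F n in sequentially. c < \<phi> ((x \<circ> \<rho>) n)" using l(3) by (rule eventually_compose_filterlim)
    moreover have "(\<lambda>n. \<phi> ((x \<circ> \<rho>) n)) \<longlonglongrightarrow> ?m"
      using LIMSEQ_subseq_LIMSEQ[OF u(2) l(2)] x(2) by (simp add: o_def)
    then have "\<forall>\<^sub>F n in sequentially. \<phi> ((x \<circ> \<rho>) n) < c" using c(1) by (rule order_tendstoD)
    ultimately have "\<forall>\<^sub>F n in sequentially. False"
      by eventually_elim (meson less_asym)
    then show False by simp
  qed
  moreover have "?m \<le> \<phi> y" if "y \<in> cball a R" for y using that by (rule INF_lower)
  ultimately show ?thesis using l(1) order_trans by blast
qed

lemma lsc_add_continuous:
  fixes \<phi> :: "'a::euclidean_space \<Rightarrow> ereal" and h :: "'a \<Rightarrow> real"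
  assumes "lsc \<phi>" and ninf: "\<And>x. \<phi> x \<noteq> -\<infinity>" and h: "continuous_on UNIV h"
  shows "lsc (\<lambda>x. \<phi> x + ereal (h x))"
  unfolding lsc_def le_Liminf_iff
proof (intro allI impI)
  fix x c assume c: "c < \<phi> x + ereal (h x)"
  show "\<forall>\<^sub>F y in at x. c < \<phi> y + ereal (h y)"
  proof (cases c)
    case (real c')
    then have "ereal (c' - h x) < \<phi> x" using c by (cases "\<phi> x") auto
    then obtain b where b: "ereal (c' - h x) < ereal b" "ereal b < \<phi> x"
      using ereal_dense2 by blast
    have "\<forall>\<^sub>F y in at x. ereal b < \<phi> y"
      using \<open>lsc \<phi>\<close> b(2) unfolding lsc_def le_Liminf_iff by blast
    moreover have "(h \<longlongrightarrow> h x) (at x)"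
      using h by (auto simp: continuous_on_eq_continuous_at continuous_at)
    then have "\<forall>\<^sub>F y in at x. c' - b < h y" using b(1) by (intro order_tendstoD) auto
    ultimately show ?thesis
    proof eventually_elim
      case (elim y)
      then show ?case using real by (cases "\<phi> y") auto
    qed
  next
    case MInf
    have "- \<infinity> < \<phi> y + ereal (h y)" for y using ninf[of y] by (cases "\<phi> y") auto
    then show ?thesis using MInf by simp
  qed (use c in auto)
qed

text \<open>
  The quadratic minorant with parameter \<open>lb\<close> is the criticality of \<open>xb\<close>; the proximal parameter \<open>lam\<close> is strictly smaller, and the
  difference \<open>c\<close> of the curvatures is what drives all estimates.
\<close>

locale prox_growth =
  fixes g :: "'a::euclidean_space \<Rightarrow> ereal" and xb vb :: 'a and \<gamma> lb lam :: real
  assumes g_lsc: "lsc g" and g_ninf: "g x \<noteq> -\<infinity>" and g_xb: "g xb = ereal \<gamma>"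
    and minorant: "ereal (\<gamma> + inner vb (y - xb) - 1 / (2 * lb) * (norm (y - xb))\<^sup>2) \<le> g y"
    and lam_pos: "0 < lam" and lam_less: "lam < lb"
begin

definition c where "c = 1 / (2 * lam) - 1 / (2 * lb)"

lemma c_pos: "c > 0"
proof -
  have "1 / (2 * lb) < 1 / (2 * lam)" using lam_pos lam_less by (intro divide_strict_left_mono) auto
  then show ?thesis by (simp add: c_def)
qed

definition zb where "zb = xb + lam *\<^sub>R vb"

lemma prox_objective_growth:
  "ereal (\<gamma> + 1 / (2 * lam) * (norm (xb - z))\<^sup>2 + c * (norm (y - xb))\<^sup>2 - 1 / lam * inner (z - zb) (y - xb))
     \<le> prox_objective lam g z y"
proof -
  have n: "(norm (y - z))\<^sup>2 = (norm (y - xb))\<^sup>2 + 2 * inner (xb - z) (y - xb) + (norm (xb - z))\<^sup>2"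
  proof -
    have "(norm (a + b))\<^sup>2 = (norm a)\<^sup>2 + 2 * inner b a + (norm b)\<^sup>2" for a b :: 'a
      by (simp add: power2_norm_eq_inner inner_add_left inner_add_right inner_commute)
    from this[of "y - xb" "xb - z"] show ?thesis by simp
  qed
  have i: "1 / lam * inner (z - zb) (y - xb) = - (1 / lam * inner (xb - z) (y - xb)) - inner vb (y - xb)"
  proof -
    have "inner (z - zb) (y - xb) = - inner (xb - z) (y - xb) - lam * inner vb (y - xb)"
      by (simp add: zb_def inner_diff_left inner_add_left)
    then show ?thesis using lam_pos by (simp add: field_simps)
  qed
  have "\<gamma> + 1 / (2 * lam) * (norm (xb - z))\<^sup>2 + c * (norm (y - xb))\<^sup>2 - 1 / lam * inner (z - zb) (y - xb)
      = (\<gamma> + inner vb (y - xb) - 1 / (2 * lb) * (norm (y - xb))\<^sup>2) + 1 / (2 * lam) * (norm (y - z))\<^sup>2"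
    unfolding n i c_def using lam_pos by (simp add: field_simps)
  then have "ereal (\<gamma> + 1 / (2 * lam) * (norm (xb - z))\<^sup>2 + c * (norm (y - xb))\<^sup>2 - 1 / lam * inner (z - zb) (y - xb))
      = ereal (\<gamma> + inner vb (y - xb) - 1 / (2 * lb) * (norm (y - xb))\<^sup>2) + ereal (1 / (2 * lam) * (norm (y - z))\<^sup>2)"
    by simp
  also have "\<dots> \<le> prox_objective lam g z y"
    unfolding prox_objective_def by (intro add_right_mono minorant)
  finally show ?thesis .
qed

lemma prox_objective_xb: "prox_objective lam g z xb = ereal (\<gamma> + 1 / (2 * lam) * (norm (xb - z))\<^sup>2)"
  by (simp add: prox_objective_def g_xb)

lemma mem_Prox_iff: "y \<in> Prox lam g z \<longleftrightarrow> (\<forall>y'. prox_objective lam g z y \<le> prox_objective lam g z y')"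
  by (auto simp: Prox_def is_arg_min_def not_less)

lemma far_from_xb:
  assumes "norm (z - zb) / (lam * c) \<le> norm (y - xb)"
  shows "prox_objective lam g z xb \<le> prox_objective lam g z y"
proof -
  have "inner (z - zb) (y - xb) \<le> norm (z - zb) * norm (y - xb)" by (rule norm_cauchy_schwarz)
  also have "\<dots> \<le> (lam * c * norm (y - xb)) * norm (y - xb)"
    using assms lam_pos c_pos by (intro mult_right_mono) (auto simp: field_simps)
  finally have "1 / lam * inner (z - zb) (y - xb) \<le> c * (norm (y - xb))\<^sup>2"
    using lam_pos by (simp add: field_simps power2_eq_square)
  then have "ereal (\<gamma> + 1 / (2 * lam) * (norm (xb - z))\<^sup>2) \<le>
      ereal (\<gamma> + 1 / (2 * lam) * (norm (xb - z))\<^sup>2 + c * (norm (y - xb))\<^sup>2 - 1 / lam * inner (z - zb) (y - xb))"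
    by simp
  then show ?thesis using prox_objective_growth order_trans unfolding prox_objective_xb by blast
qed

lemma Prox_nonempty: "Prox lam g z \<noteq> {}"
proof -
  define R where "R = norm (z - zb) / (lam * c)"
  have R: "R \<ge> 0" using lam_pos c_pos by (simp add: R_def)
  have "lsc (\<lambda>y. g y + ereal (1 / (2 * lam) * (norm (y - z))\<^sup>2))"
    by (intro lsc_add_continuous g_lsc g_ninf continuous_intros)
  then obtain y where y: "y \<in> cball xb R" "\<And>y'. y' \<in> cball xb R \<Longrightarrow> prox_objective lam g z y \<le> prox_objective lam g z y'"
    using lsc_attains_inf_cball[OF _ R] unfolding prox_objective_def by blast
  have "prox_objective lam g z y \<le> prox_objective lam g z y'" for y'
  proof (cases "y' \<in> cball xb R")
    case False
    then have "prox_objective lam g z xb \<le> prox_objective lam g z y'"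
      by (intro far_from_xb) (simp add: R_def dist_norm norm_minus_commute)
    moreover have "prox_objective lam g z y \<le> prox_objective lam g z xb" using R by (intro y(2)) simp
    ultimately show ?thesis by (rule order_trans[rotated])
  qed (rule y(2))
  then show ?thesis using mem_Prox_iff by blast
qed

text \<open>
  Compare the growth of the objective with its value at \<open>xb\<close>. The estimate is global in \<open>z\<close>.
\<close>

lemma Prox_bound:
  assumes "y \<in> Prox lam g z"
  shows "norm (y - xb) \<le> 1 / (lam * c) * norm (z - zb)"
proof -
  have "prox_objective lam g z y \<le> prox_objective lam g z xb" using assms mem_Prox_iff by blast
  then have "ereal (\<gamma> + 1 / (2 * lam) * (norm (xb - z))\<^sup>2 + c * (norm (y - xb))\<^sup>2 - 1 / lam * inner (z - zb) (y - xb))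
      \<le> ereal (\<gamma> + 1 / (2 * lam) * (norm (xb - z))\<^sup>2)"
    using prox_objective_growth[of z y] unfolding prox_objective_xb by (rule order_trans[rotated])
  then have "c * (norm (y - xb))\<^sup>2 \<le> 1 / lam * inner (z - zb) (y - xb)" by simp
  also have "\<dots> \<le> 1 / lam * (norm (z - zb) * norm (y - xb))"
    using lam_pos norm_cauchy_schwarz by (intro mult_left_mono) auto
  finally have "norm (y - xb) * (lam * c * norm (y - xb)) \<le> norm (y - xb) * norm (z - zb)"
    using lam_pos by (simp add: field_simps power2_eq_square)
  then have "lam * c * norm (y - xb) \<le> norm (z - zb)"
    by (cases "y = xb") auto
  then show ?thesis using lam_pos c_pos by (simp add: field_simps)
qed

lemma xb_in_Prox: "xb \<in> Prox lam g zb"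
  unfolding mem_Prox_iff by (intro allI far_from_xb) simp

lemma Prox_finite:
  assumes "y \<in> Prox lam g z"
  shows "g y = ereal (real_of_ereal (g y))"
proof -
  have "prox_objective lam g z y \<le> prox_objective lam g z xb" using assms mem_Prox_iff by blast
  then have "g y \<noteq> \<infinity>" unfolding prox_objective_xb by (auto simp: prox_objective_def)
  then show ?thesis using g_ninf[of y] by (cases "g y") auto
qed

lemma Prox_subgradient:
  assumes y: "y \<in> Prox lam g z"
  shows "(y, (1 / lam) *\<^sub>R (z - y)) \<in> gph (subdifferential g)"
proof -
  have "(1 / lam) *\<^sub>R (z - y) \<in> subdifferential g y"
  proof (rule proximal_subgradient_in_subdifferential[where \<gamma> = "real_of_ereal (g y)" and K = "1 / (2 * lam)"])
    show "g y = ereal (real_of_ereal (g y))" by (rule Prox_finite[OF y])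
    show "0 \<le> 1 / (2 * lam)" using lam_pos by simp
    fix y'
    let ?r = "real_of_ereal (g y)"
    have "ereal ?r + ereal (1 / (2 * lam) * (norm (y - z))\<^sup>2) \<le> g y' + ereal (1 / (2 * lam) * (norm (y' - z))\<^sup>2)"
      using y unfolding mem_Prox_iff prox_objective_def Prox_finite[OF y, symmetric] by blast
    moreover have "(norm (y' - z))\<^sup>2 = (norm (y' - y))\<^sup>2 - 2 * inner (z - y) (y' - y) + (norm (y - z))\<^sup>2"
    proof -
      have "(norm (a - b))\<^sup>2 = (norm a)\<^sup>2 - 2 * inner b a + (norm b)\<^sup>2" for a b :: 'a
        by (simp add: power2_norm_eq_inner inner_diff_left inner_diff_right inner_commute)
      from this[of "y' - y" "z - y"] show ?thesis by (simp add: norm_minus_commute)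
    qed
    then have "1 / (2 * lam) * (norm (y' - z))\<^sup>2 =
        1 / (2 * lam) * (norm (y' - y))\<^sup>2 - inner ((1 / lam) *\<^sub>R (z - y)) (y' - y) + 1 / (2 * lam) * (norm (y - z))\<^sup>2"
      unfolding inner_scaleR_left using lam_pos by (simp add: field_simps)
    ultimately show "ereal (?r + inner ((1 / lam) *\<^sub>R (z - y)) (y' - y) - 1 / (2 * lam) * (norm (y' - y))\<^sup>2) \<le> g y'"
      by (cases "g y'") (auto simp: g_ninf)
  qed
  then show ?thesis by (simp add: gph_def)
qed

definition P where "P z = (SOME y. y \<in> Prox lam g z)"

lemma P_in_Prox: "P z \<in> Prox lam g z"
  using Prox_nonempty[of z] by (simp add: P_def some_in_eq)

definition E where "E z = inner z (P z) - lam * real_of_ereal (g (P z)) - (norm (P z))\<^sup>2 / 2"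

text \<open>
  The function \<open>E\<close> is a supremum of affine functions of \<open>z\<close>, with \<open>P z\<close> as a maximising slope.
\<close>

lemma E_subgradient: "E z + inner (P z) (z' - z) \<le> E z'"
proof -
  obtain a b where ab: "g (P z) = ereal a" "g (P z') = ereal b"
    using Prox_finite[OF P_in_Prox] by blast
  have "prox_objective lam g z' (P z') \<le> prox_objective lam g z' (P z)"
    using P_in_Prox[of z'] mem_Prox_iff by blast
  then have "b + 1 / (2 * lam) * (norm (P z' - z'))\<^sup>2 \<le> a + 1 / (2 * lam) * (norm (P z - z'))\<^sup>2"
    unfolding prox_objective_def ab by simp
  then have "lam * (b + 1 / (2 * lam) * (norm (P z' - z'))\<^sup>2) \<le> lam * (a + 1 / (2 * lam) * (norm (P z - z'))\<^sup>2)"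
    using lam_pos by (intro mult_left_mono) auto
  then have "lam * b + (norm (P z' - z'))\<^sup>2 / 2 \<le> lam * a + (norm (P z - z'))\<^sup>2 / 2"
    using lam_pos by (simp add: distrib_left)
  moreover have "(norm (p - z'))\<^sup>2 = (norm p)\<^sup>2 - 2 * inner z' p + (norm z')\<^sup>2" for p
    by (simp add: power2_norm_eq_inner inner_diff_left inner_diff_right inner_commute)
  ultimately have "lam * b + (norm (P z'))\<^sup>2 / 2 - inner z' (P z') \<le> lam * a + (norm (P z))\<^sup>2 / 2 - inner z' (P z)"
    by (simp add: add_divide_distrib diff_divide_distrib)
  then show ?thesis by (simp add: E_def ab inner_commute[of "P z"] inner_diff_left)
qed

text \<open>
  Hypomonotonicity with \<open>r lam < 1\<close> makes \<open>(x, v) \<mapsto> x + lam v\<close> injective on the graph near \<open>(xb, vb)\<close>, with Lipschitz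
  inverse; proximal points show that it is onto a neighbourhood. A Lipschitz selection of subgradients of \<open>E\<close> is its gradient.
\<close>

lemma prox_chart_exists:
  assumes r: "0 < r" "r * lam < 1" and vb: "vb \<in> subdifferential g xb"
    and "0 < \<delta>" and hypomonotone: "hypomonotone_on r (gph (subdifferential g) \<inter> (ball xb \<delta> \<times> ball vb \<delta>))"
  shows "\<exists>\<delta>0 L. prox_chart (gph (subdifferential g)) P E xb vb lam L \<delta>0"
proof -
  let ?G = "gph (subdifferential g)"
  define L where "L = 1 / (1 - r * lam)"
  have L: "L > 0" using r by (simp add: L_def)
  have lipG: "norm (x - x') \<le> L * norm ((x + lam *\<^sub>R v) - (x' + lam *\<^sub>R v'))"
    if "(x, v) \<in> ?G" "(x', v') \<in> ?G" "norm (x - xb) < \<delta>" "norm (v - vb) < \<delta>" "norm (x' - xb) < \<delta>" "norm (v' - vb) < \<delta>"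
    for x v x' v'
  proof -
    let ?z = "(x + lam *\<^sub>R v) - (x' + lam *\<^sub>R v')"
    have "?z = (x - x') + lam *\<^sub>R (v - v')" by (simp add: algebra_simps)
    then have "inner ?z (x - x') = (norm (x - x'))\<^sup>2 + lam * inner (v - v') (x - x')"
      by (simp only: inner_add_left inner_scaleR_left power2_norm_eq_inner)
    moreover have "lam * (- r * (norm (x - x'))\<^sup>2) \<le> lam * inner (v - v') (x - x')"
    proof (rule mult_left_mono)
      have "(x, v) \<in> ?G \<inter> (ball xb \<delta> \<times> ball vb \<delta>)" "(x', v') \<in> ?G \<inter> (ball xb \<delta> \<times> ball vb \<delta>)"
        using that by (auto simp: dist_norm norm_minus_commute)
      then show "- r * (norm (x - x'))\<^sup>2 \<le> inner (v - v') (x - x')"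
        using hypomonotone unfolding hypomonotone_on_def by blast
    qed (use lam_pos in simp)
    moreover have "inner ?z (x - x') \<le> norm ?z * norm (x - x')" by (rule norm_cauchy_schwarz)
    ultimately have "(norm (x - x'))\<^sup>2 + lam * (- r * (norm (x - x'))\<^sup>2) \<le> norm ?z * norm (x - x')" by linarith
    then have "norm (x - x') * ((1 - r * lam) * norm (x - x')) \<le> norm (x - x') * norm ?z"
      by (simp add: power2_eq_square algebra_simps)
    then have "(1 - r * lam) * norm (x - x') \<le> norm ?z" by (cases "x = x'") auto
    then show ?thesis using r by (simp add: L_def field_simps)
  qed
  define K where "K = 1 / (lam * c)"
  have K: "K > 0" using lam_pos c_pos by (simp add: K_def)
  let ?V = "\<lambda>z. (1 / lam) *\<^sub>R (z - P z)"
  define \<delta>c where "\<delta>c = min (\<delta> / K) (\<delta> / ((1 + K) / lam))"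
  have K1: "(1 + K) / lam > 0" using K lam_pos by simp
  have "\<delta>c > 0"
    unfolding \<delta>c_def min_less_iff_conj using divide_pos_pos[OF \<open>0 < \<delta>\<close> K] divide_pos_pos[OF \<open>0 < \<delta>\<close> K1] by blast
  have PG: "(P z, ?V z) \<in> ?G" for z by (rule Prox_subgradient[OF P_in_Prox])
  have near: "norm (P z - xb) < \<delta> \<and> norm (?V z - vb) < \<delta>" if "norm (z - zb) < \<delta>c" for z
  proof
    have b: "norm (P z - xb) \<le> K * norm (z - zb)" unfolding K_def by (rule Prox_bound[OF P_in_Prox])
    have n1: "norm (z - zb) < \<delta> / K" and n2: "norm (z - zb) < \<delta> / ((1 + K) / lam)"
      using that unfolding \<delta>c_def min_less_iff_conj by blast+
    have "K * norm (z - zb) < \<delta>" using n1 K by (simp add: pos_less_divide_eq mult.commute)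
    with b show "norm (P z - xb) < \<delta>" by simp
    have "?V z - vb = (1 / lam) *\<^sub>R ((z - zb) - (P z - xb))"
      using lam_pos by (simp add: zb_def algebra_simps)
    then have "norm (?V z - vb) = 1 / lam * norm ((z - zb) - (P z - xb))" using lam_pos by simp
    also have "\<dots> \<le> 1 / lam * (norm (z - zb) + K * norm (z - zb))"
      using b lam_pos norm_triangle_ineq4[of "z - zb" "P z - xb"] by (intro mult_left_mono) auto
    also have "\<dots> = (1 + K) / lam * norm (z - zb)" by (simp add: field_simps)
    also have "\<dots> < \<delta>" using n2 K1 by (simp only: pos_less_divide_eq[OF K1] mult.commute)
    finally show "norm (?V z - vb) < \<delta>" .
  qed
  define \<delta>0 where "\<delta>0 = min (min \<delta> \<delta>c) (\<delta>c / (2 * (1 + lam)))"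
  have l1: "1 + lam > 0" using lam_pos by simp
  have "\<delta>0 > 0" using \<open>0 < \<delta>\<close> \<open>\<delta>c > 0\<close> l1 by (simp add: \<delta>0_def)
  then have d0: "\<delta>0 > 0" "\<delta>0 \<le> \<delta>" "\<delta>0 \<le> \<delta>c" "\<delta>0 \<le> \<delta>c / (2 * (1 + lam))"
    by (simp_all only: \<delta>0_def min.coboundedI1[OF min.cobounded1] min.coboundedI1[OF min.cobounded2] min.cobounded2)
  have recompose: "P z + lam *\<^sub>R ?V z = z" for z using lam_pos by simp
  have Plip: "norm (P z - P z') \<le> L * norm (z - z')" if z: "norm (z - zb) < \<delta>c" "norm (z' - zb) < \<delta>c" for z z'
    using lipG[OF PG PG, of z z'] near[OF z(1)] near[OF z(2)] unfolding recompose by blast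
  have "prox_chart ?G P E xb vb lam L \<delta>0"
  proof
    show "(xb, vb) \<in> ?G" using vb by (simp add: gph_def)
    fix z assume z: "z \<in> ball (xb + lam *\<^sub>R vb) \<delta>0"
    then have zn: "norm (z - zb) < \<delta>c" using d0(3) by (simp add: zb_def dist_norm norm_minus_commute)
    show "(P z, ?V z) \<in> ?G" by (rule PG)
    show "norm (P z - P z') \<le> L * norm (z - z')" if "z' \<in> ball (xb + lam *\<^sub>R vb) \<delta>0" for z'
      using that d0(3) by (intro Plip zn) (simp add: zb_def dist_norm norm_minus_commute)
    show "(E has_derivative (\<lambda>k. inner (P z) k)) (at z)"
      unfolding has_derivative_at_alt
    proof (intro conjI allI impI)
      show "bounded_linear (\<lambda>k. inner (P z) k)" by (rule bounded_linear_inner_right)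
      fix e :: real assume "e > 0"
      have "norm (E y - E z - inner (P z) (y - z)) \<le> e * norm (y - z)"
        if y: "norm (y - z) < min (\<delta>c - norm (z - zb)) (e / L)" for y
      proof -
        have yn: "norm (y - zb) < \<delta>c" using y norm_triangle_ineq[of "y - z" "z - zb"] by simp
        have "0 \<le> E y - E z - inner (P z) (y - z)" using E_subgradient[of z y] by simp
        moreover have "E y - E z - inner (P z) (y - z) \<le> inner (P y - P z) (y - z)"
          using E_subgradient[of y z] by (simp add: inner_diff)
        moreover have "inner (P y - P z) (y - z) \<le> norm (P y - P z) * norm (y - z)" by (rule norm_cauchy_schwarz)
        moreover have "norm (P y - P z) * norm (y - z) \<le> e * norm (y - z)"
        proof (rule mult_right_mono)
          have "norm (P y - P z) \<le> L * norm (y - z)" by (rule Plip[OF yn zn])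
          also have "\<dots> \<le> e" using y L by (simp add: less_divide_eq mult.commute)
          finally show "norm (P y - P z) \<le> e" .
        qed simp
        ultimately show ?thesis by simp
      qed
      moreover have "min (\<delta>c - norm (z - zb)) (e / L) > 0" using zn L \<open>e > 0\<close> by simp
      ultimately show "\<exists>d>0. \<forall>y. norm (y - z) < d \<longrightarrow> norm (E y - E z - inner (P z) (y - z)) \<le> e * norm (y - z)"
        by blast
    qed
  next
    fix x v assume xv: "(x, v) \<in> ?G" "norm (x - xb) < \<delta>0" "norm (v - vb) < \<delta>0"
    let ?z = "x + lam *\<^sub>R v"
    have dz: "?z - zb = (x - xb) + lam *\<^sub>R (v - vb)" by (simp add: zb_def algebra_simps)
    have "norm (?z - zb) \<le> norm (x - xb) + lam * norm (v - vb)"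
      unfolding dz using norm_triangle_ineq[of "x - xb" "lam *\<^sub>R (v - vb)"] lam_pos by simp
    also have "\<dots> < \<delta>0 + lam * \<delta>0" using xv lam_pos by (intro add_strict_mono mult_strict_left_mono)
    also have "\<dots> \<le> \<delta>c"
    proof -
      have "2 * (\<delta>0 + lam * \<delta>0) \<le> \<delta>c" using d0(4) l1 by (simp add: field_simps)
      moreover have "0 < \<delta>0 + lam * \<delta>0" using lam_pos d0(1) by (simp add: add_pos_pos)
      moreover have "e \<le> b" if "2 * e \<le> b" "0 < e" for e b :: real using that by linarith
      ultimately show ?thesis by blast
    qed
    finally have zn: "norm (?z - zb) < \<delta>c" .
    have "norm (P ?z - x) \<le> L * norm ((P ?z + lam *\<^sub>R ?V ?z) - ?z)"
      using near[OF zn] xv d0(2) by (intro lipG PG) auto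
    then show "P ?z = x" unfolding recompose by simp
  qed (fact lam_pos L d0(1))+
  then show ?thesis by blast
qed

end

section \<open>Local superlinear convergence\<close>

text \<open>
  Halving drives the sequence into ever smaller balls, on which the ratio is at most any given \<open>\<epsilon>\<close>.
\<close>

lemma halving_sequence_Q_superlinear:
  fixes X :: "nat \<Rightarrow> 'a::real_normed_vector"
  assumes ne: "\<And>k. X k \<noteq> xb" and start: "norm (X 0 - xb) < \<delta>0"
    and half: "\<And>k. norm (X k - xb) < \<delta>0 \<Longrightarrow> norm (X (Suc k) - xb) \<le> 1 / 2 * norm (X k - xb)"
    and small: "\<And>\<epsilon>. 0 < \<epsilon> \<Longrightarrow> \<exists>\<delta>>0. \<forall>k. norm (X k - xb) < \<delta> \<longrightarrow> norm (X (Suc k) - xb) \<le> \<epsilon> * norm (X k - xb)"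
  shows "Q_superlinear X xb"
proof -
  have geo: "norm (X k - xb) \<le> (1 / 2) ^ k * norm (X 0 - xb)" for k
  proof (induction k)
    case (Suc k)
    have "(1 / 2) ^ k * norm (X 0 - xb) \<le> 1 * norm (X 0 - xb)"
      by (intro mult_right_mono power_le_one) auto
    then have "norm (X k - xb) < \<delta>0" using Suc start by linarith
    from half[OF this] Suc show ?case by simp
  qed simp
  have "(\<lambda>k. (1 / 2) ^ k * norm (X 0 - xb)) \<longlonglongrightarrow> 0"
    by (intro tendsto_mult_left_zero LIMSEQ_realpow_zero) auto
  then have "(\<lambda>k. X k - xb) \<longlonglongrightarrow> 0"
    by (rule tendsto_0_le[of _ _ _ 1]) (use geo in \<open>simp add: abs_mult\<close>)
  then have lim: "X \<longlonglongrightarrow> xb" by (rule LIM_zero_cancel)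
  have "(\<lambda>k. norm (X (Suc k) - xb) / norm (X k - xb)) \<longlonglongrightarrow> 0"
  proof (rule LIMSEQ_I)
    fix \<epsilon> :: real assume "\<epsilon> > 0"
    then obtain \<delta> where "\<delta> > 0" and \<delta>: "\<And>k. norm (X k - xb) < \<delta> \<Longrightarrow> norm (X (Suc k) - xb) \<le> \<epsilon> / 2 * norm (X k - xb)"
      using small[of "\<epsilon> / 2"] by auto
    obtain N where "\<And>k. k \<ge> N \<Longrightarrow> norm (X k - xb) < \<delta>"
      using LIMSEQ_D[OF lim \<open>\<delta> > 0\<close>] by blast
    then have q: "norm (X (Suc k) - xb) / norm (X k - xb) \<le> \<epsilon> / 2" if "k \<ge> N" for k
      using \<delta>[of k] that ne[of k] by (simp add: divide_le_eq)
    have "norm (norm (X (Suc k) - xb) / norm (X k - xb) - 0) < \<epsilon>" if "k \<ge> N" for k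
    proof -
      have "norm (norm (X (Suc k) - xb) / norm (X k - xb) - 0) = norm (X (Suc k) - xb) / norm (X k - xb)" by simp
      also have "\<dots> < \<epsilon>" using q[OF that] \<open>\<epsilon> > 0\<close> by linarith
      finally show ?thesis .
    qed
    then show "\<exists>N. \<forall>k\<ge>N. norm (norm (X (Suc k) - xb) / norm (X k - xb) - 0) < \<epsilon>" by blast
  qed
  then show ?thesis using lim ne by (simp add: Q_superlinear_def)
qed

theorem theorem4p10:
  fixes f :: "'a::euclidean_space \<Rightarrow> real"
    and gf :: "'a \<Rightarrow> 'a"
    and Hf :: "'a \<Rightarrow> 'a \<Rightarrow>\<^sub>L 'a"
    and g :: "'a \<Rightarrow> ereal"
    and xbar :: 'a
    and r lambdabar :: real
  assumes "C2_smooth_with f gf Hf"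
    and "proper g" and "lsc g" and "prox_bounded g"
    and "0 \<in> subdifferential (\<lambda>x. ereal (f x) + g x) xbar"
    and "metrically_regular (\<lambda>x. {gf x + v | v. v \<in> subdifferential g x}) xbar 0"
    and "semismooth_star (subdifferential g) xbar (- gf xbar)"
    and "0 < r"
    and "continuously_level_prox_regular r g xbar (- gf xbar)"
    and "0 < lambdabar" and "lambdabar \<le> 1 / r"
    and "lambda_critical f gf g lambdabar xbar"
  shows "\<forall>lam. 0 < lam \<and> lam < lambdabar \<longrightarrow>
    (\<exists>U. open U \<and> xbar \<in> U \<and>
      (\<forall>x0\<in>U.
         newton_well_defined gf Hf g lam x0 \<and>
         (\<forall>X. X 0 = x0 \<and> (\<forall>k. newton_step gf Hf g lam (X k) (X (Suc k)))
              \<longrightarrow> Q_superlinear X xbar)))"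
proof (intro allI impI)
  fix lam assume lam: "0 < lam \<and> lam < lambdabar"
  note C2 = assms(1)
  define G where "G = gph (subdifferential g)"
  define vb where "vb = - gf xbar"
  have stat: "gf xbar + vb = 0" by (simp add: vb_def)
  have vb: "vb \<in> subdifferential g xbar"
    using assms(9) by (simp add: vb_def continuously_level_prox_regular_def level_prox_regular_def variationally_s_convex_def)
  have ninf: "g x \<noteq> -\<infinity>" for x using assms(2) by (simp add: proper_def)
  obtain \<gamma> where \<gamma>: "g xbar = ereal \<gamma>"
    using vb ninf[of xbar] by (cases "g xbar") (auto simp: subdifferential_def edom_def)
  have minorant: "ereal (\<gamma> + inner vb (y - xbar) - 1 / (2 * lambdabar) * (norm (y - xbar))\<^sup>2) \<le> g y" for y
  proof -
    let ?z = "xbar - lambdabar *\<^sub>R gf xbar"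
    have "xbar \<in> Prox lambdabar g ?z" using assms(12) by (simp add: lambda_critical_def)
    then have "prox_objective lambdabar g ?z xbar \<le> prox_objective lambdabar g ?z y"
      by (auto simp: Prox_def is_arg_min_def not_less)
    then have le: "ereal \<gamma> + ereal (1 / (2 * lambdabar) * (norm (xbar - ?z))\<^sup>2) \<le> g y + ereal (1 / (2 * lambdabar) * (norm (y - ?z))\<^sup>2)"
      by (simp only: prox_objective_def \<gamma>)
    have "(norm (a - b))\<^sup>2 = (norm a)\<^sup>2 - 2 * inner b a + (norm b)\<^sup>2" for a b :: 'a
      by (simp add: power2_norm_eq_inner inner_diff_left inner_diff_right inner_commute)
    from this[of "y - xbar" "lambdabar *\<^sub>R vb"]
    have "1 / (2 * lambdabar) * (norm (y - ?z))\<^sup>2 = 1 / (2 * lambdabar) * (norm (y - xbar))\<^sup>2 - inner vb (y - xbar)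
        + 1 / (2 * lambdabar) * (norm (xbar - ?z))\<^sup>2"
      using assms(10) by (simp add: vb_def field_simps)
    with le show ?thesis by (cases "g y") (auto simp: ninf)
  qed
  \<comment> \<open>The proximal objective with parameter \<open>lambdabar\<close> is minimal at \<open>xbar\<close>, which is the quadratic minorant.\<close>
  interpret pg: prox_growth g xbar vb \<gamma> lambdabar lam
    using assms(3) ninf \<gamma> minorant lam by unfold_locales auto
  have zb: "pg.zb = xbar - lam *\<^sub>R gf xbar" unfolding pg.zb_def by (simp add: vb_def)
  have r_lam: "r * lam < 1"
  proof -
    have "r * lam < r * lambdabar" using lam \<open>0 < r\<close> by simp
    also have "\<dots> \<le> 1" using assms(8,11) by (simp add: field_simps)
    finally show ?thesis .
  qed
  obtain \<delta>r where "0 < \<delta>r"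
    and hypomonotone: "hypomonotone_on r (gph (subdifferential g) \<inter> (ball xbar \<delta>r \<times> ball vb \<delta>r))"
    using level_prox_regular_hypomonotone[OF assms(9,2), folded vb_def] by blast
  from pg.prox_chart_exists[OF assms(8) r_lam vb \<open>0 < \<delta>r\<close> hypomonotone]
  obtain \<delta>0 L where "prox_chart G pg.P pg.E xbar vb lam L \<delta>0" unfolding G_def by blast
  then interpret pc: prox_chart G pg.P pg.E xbar vb lam L \<delta>0 .
  obtain C \<delta>m where "0 < C" "0 < \<delta>m" and mr: "\<And>x v y. (x, v) \<in> G \<Longrightarrow> norm (x - xbar) < \<delta>m \<Longrightarrow> norm (v - vb) < \<delta>m \<Longrightarrow>
      norm (y - (gf x + v)) < \<delta>m \<Longrightarrow>
      \<exists>x' v'. (x', v') \<in> G \<and> gf x' + v' = y \<and> norm (x' - x) + norm (v' - v) \<le> C * norm (y - (gf x + v))"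
    using metric_regularity_graph[OF C2 stat assms(6)] unfolding G_def by blast
  interpret nc: newton_chart G pg.P pg.E xbar vb lam L \<delta>0 gf Hf C \<delta>m
  proof
    show "isCont Hf x" for x using C2 by (simp add: C2_smooth_with_def continuous_on_eq_continuous_at)
  qed (fact C2_gradient_strict[OF C2] C2_hessian_symmetric[OF C2] stat \<open>0 < C\<close> \<open>0 < \<delta>m\<close> mr)+
  have ss: pc.semismooth
    unfolding pc.semismooth_def
  proof (intro allI impI)
    fix d n assume n: "n \<in> directional_normal_cone G (xbar, vb) d"
    obtain us vs u v where nd: "n = (us, vs)" "d = (u, v)" by (cases n, cases d) blast
    have "us \<in> directional_coderivative (subdifferential g) xbar (- gf xbar) u v (- vs)"
      using n by (simp add: directional_coderivative_def G_def vb_def nd)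
    then have "inner us u = inner (- vs) v" using assms(7) unfolding semismooth_star_def by blast
    then show "inner n d = 0" by (simp add: nd)
  qed
  let ?v = "\<lambda>x xh. gf xh - gf x + (1 / lam) *\<^sub>R (x - xh) - gf xh"
  obtain \<delta>g l where "\<delta>g > 0" "l > 0"
    and gl: "\<And>y z. norm (y - xbar) < \<delta>g \<Longrightarrow> norm (z - xbar) < \<delta>g \<Longrightarrow> norm (gf y - gf z) \<le> l * norm (y - z)"
    using C2_gradient_lipschitz[OF C2, of xbar] by blast
  define K where "K = 1 / (lam * pg.c)"
  have K: "K > 0" using lam pg.c_pos by (simp add: K_def)
  \<comment> \<open>Bounds for \<open>|xh - xbar|\<close> and \<open>|v - vb|\<close> relative to \<open>|z - zb|\<close>, times the Lipschitz constant of \<open>x \<mapsto> x - lam gf x\<close>.\<close>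
  define B where "B = (K + (1 + K) / lam) * (1 + lam * l)"
  have "(1 + K) / lam > 0" "1 + lam * l > 0" using K lam \<open>l > 0\<close> by (auto intro!: add_pos_pos divide_pos_pos)
  then have B: "B > 0" using K by (simp add: B_def add_pos_pos)
  have prox: "(xh, ?v x xh) \<in> G \<and> norm (xh - xbar) + norm (?v x xh - vb) \<le> B * norm (x - xbar)"
    if x: "norm (x - xbar) < \<delta>g" and xh: "xh \<in> prox_points gf g lam x" for x xh
  proof
    let ?z = "x - lam *\<^sub>R gf x"
    have xhP: "xh \<in> Prox lam g ?z" using xh by (simp add: prox_points_def)
    have v: "?v x xh = (1 / lam) *\<^sub>R (?z - xh)" using lam by (simp add: algebra_simps)
    show "(xh, ?v x xh) \<in> G" unfolding v G_def by (rule pg.Prox_subgradient[OF xhP])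
    have zz: "?z - pg.zb = (x - xbar) - lam *\<^sub>R (gf x - gf xbar)" by (simp add: zb algebra_simps)
    have "norm (?z - pg.zb) \<le> norm (x - xbar) + lam * norm (gf x - gf xbar)"
      unfolding zz using norm_triangle_ineq4[of "x - xbar" "lam *\<^sub>R (gf x - gf xbar)"] lam by simp
    also have "\<dots> \<le> norm (x - xbar) + lam * (l * norm (x - xbar))"
      using gl[OF x, of xbar] \<open>\<delta>g > 0\<close> lam by (intro add_left_mono mult_left_mono) auto
    finally have zn: "norm (?z - pg.zb) \<le> (1 + lam * l) * norm (x - xbar)" by (simp add: algebra_simps)
    have a: "norm (xh - xbar) \<le> K * norm (?z - pg.zb)" unfolding K_def by (rule pg.Prox_bound[OF xhP])
    have "?v x xh - vb = (1 / lam) *\<^sub>R ((?z - pg.zb) - (xh - xbar))"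
      unfolding v using lam by (simp add: pg.zb_def algebra_simps)
    then have "norm (?v x xh - vb) = 1 / lam * norm ((?z - pg.zb) - (xh - xbar))" using lam by simp
    also have "\<dots> \<le> 1 / lam * (norm (?z - pg.zb) + K * norm (?z - pg.zb))"
      using a lam norm_triangle_ineq4[of "?z - pg.zb" "xh - xbar"] by (intro mult_left_mono) auto
    also have "\<dots> = (1 + K) / lam * norm (?z - pg.zb)" by (simp add: field_simps)
    finally have "norm (xh - xbar) + norm (?v x xh - vb) \<le> (K + (1 + K) / lam) * norm (?z - pg.zb)"
      using a by (simp add: distrib_right)
    also have "\<dots> \<le> (K + (1 + K) / lam) * ((1 + lam * l) * norm (x - xbar))"
      using zn K \<open>(1 + K) / lam > 0\<close> by (intro mult_left_mono) auto
    finally show "norm (xh - xbar) + norm (?v x xh - vb) \<le> B * norm (x - xbar)" by (simp add: B_def mult.assoc)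
  qed
  have dirs: "newton_directions gf Hf g lam x xh =
      {d. (- (gf xh + ?v x xh) - blinfun_apply (Hf xh) d, - d) \<in> limiting_normal_cone G (xh, ?v x xh)}" for x xh
  proof -
    have "gf xh + ?v x xh = gf xh - gf x + (1 / lam) *\<^sub>R (x - xh)" by simp
    then show ?thesis
      unfolding newton_directions_def second_order_subdifferential_def coderivative_def G_def Let_def
      by (simp only: mem_Collect_eq)
  qed
  have near: "norm (xh - xbar) < \<delta> \<and> norm (?v x xh - vb) < \<delta>"
    if "norm (x - xbar) < min \<delta>g (\<delta> / B)" "xh \<in> prox_points gf g lam x" for x xh \<delta>
  proof -
    have "norm (xh - xbar) + norm (?v x xh - vb) \<le> B * norm (x - xbar)" using prox that by auto
    also have "\<dots> < \<delta>" using that(1) B by (simp add: less_divide_eq mult.commute)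
    finally show ?thesis using norm_ge_zero[of "xh - xbar"] norm_ge_zero[of "?v x xh - vb"] by linarith
  qed
  have step: "\<exists>\<delta>>0. \<forall>x x'. norm (x - xbar) < \<delta> \<longrightarrow> newton_step gf Hf g lam x x' \<longrightarrow> norm (x' - xbar) \<le> \<epsilon> * norm (x - xbar)"
    if "\<epsilon> > 0" for \<epsilon>
  proof -
    have eB: "\<epsilon> / B > 0" using that B by simp
    from nc.newton_estimate[OF ss this] obtain \<delta> where "\<delta> > 0"
      and \<delta>: "\<And>x v d. (x, v) \<in> G \<Longrightarrow> norm (x - xbar) < \<delta> \<Longrightarrow> norm (v - vb) < \<delta> \<Longrightarrow>
        (- (gf x + v) - blinfun_apply (Hf x) d, - d) \<in> limiting_normal_cone G (x, v) \<Longrightarrow>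
        norm (x + d - xbar) \<le> \<epsilon> / B * (norm (x - xbar) + norm (v - vb))"
      by blast
    have "norm (x' - xbar) \<le> \<epsilon> * norm (x - xbar)"
      if x: "norm (x - xbar) < min \<delta>g (\<delta> / B)" and st: "newton_step gf Hf g lam x x'" for x x'
    proof -
      obtain xh d where xh: "xh \<in> prox_points gf g lam x" and d: "d \<in> newton_directions gf Hf g lam x xh"
        and x': "x' = xh + d"
        using st by (auto simp: newton_step_def)
      have p: "(xh, ?v x xh) \<in> G" "norm (xh - xbar) + norm (?v x xh - vb) \<le> B * norm (x - xbar)"
        using prox[of x xh] x xh by auto
      have "norm (x' - xbar) \<le> \<epsilon> / B * (norm (xh - xbar) + norm (?v x xh - vb))"
        unfolding x' using near[OF x xh] d unfolding dirs by (intro \<delta> p(1)) auto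
      also have "\<dots> \<le> \<epsilon> / B * (B * norm (x - xbar))" using p(2) eB by (intro mult_left_mono) auto
      finally show ?thesis using B by simp
    qed
    moreover have "min \<delta>g (\<delta> / B) > 0" using \<open>\<delta>g > 0\<close> \<open>\<delta> > 0\<close> B by simp
    ultimately show ?thesis by blast
  qed
  obtain \<delta>d where "\<delta>d > 0" and ex: "\<And>x v w. (x, v) \<in> G \<Longrightarrow> norm (x - xbar) < \<delta>d \<Longrightarrow> norm (v - vb) < \<delta>d \<Longrightarrow>
      \<exists>d. (- w - blinfun_apply (Hf x) d, - d) \<in> limiting_normal_cone G (x, v)"
    using nc.newton_direction_exists by blast
  have wd: "prox_points gf g lam x \<noteq> {} \<and> (\<forall>xh\<in>prox_points gf g lam x. newton_directions gf Hf g lam x xh \<noteq> {})"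
    if x: "norm (x - xbar) < min \<delta>g (\<delta>d / B)" for x
  proof (intro conjI ballI)
    show "prox_points gf g lam x \<noteq> {}" unfolding prox_points_def by (rule pg.Prox_nonempty)
    fix xh assume xh: "xh \<in> prox_points gf g lam x"
    have "(xh, ?v x xh) \<in> G" using prox[of x xh] x xh by auto
    then have "\<exists>d. (- (gf xh + ?v x xh) - blinfun_apply (Hf xh) d, - d) \<in> limiting_normal_cone G (xh, ?v x xh)"
      using near[OF x xh] by (intro ex) auto
    then show "newton_directions gf Hf g lam x xh \<noteq> {}" unfolding dirs by blast
  qed
  obtain \<delta>h where "\<delta>h > 0" and half: "\<And>x x'. norm (x - xbar) < \<delta>h \<Longrightarrow> newton_step gf Hf g lam x x' \<Longrightarrow>
      norm (x' - xbar) \<le> 1 / 2 * norm (x - xbar)"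
    using step[of "1 / 2"] by auto
  define \<delta> where "\<delta> = min \<delta>h (min \<delta>g (\<delta>d / B))"
  have \<delta>: "\<delta> > 0" "\<delta> \<le> \<delta>h" "\<delta> \<le> min \<delta>g (\<delta>d / B)"
    using \<open>\<delta>h > 0\<close> \<open>\<delta>g > 0\<close> \<open>\<delta>d > 0\<close> B unfolding \<delta>_def by auto
  \<comment> \<open>The stopping test succeeds at \<open>xbar\<close>, so an infinite run never hits \<open>xbar\<close> and the quotients are meaningful.\<close>
  have xb_stop: "xbar \<in> prox_points gf g lam xbar"
    using pg.xb_in_Prox by (simp add: prox_points_def zb)
  show "\<exists>U. open U \<and> xbar \<in> U \<and>
      (\<forall>x0\<in>U.
         newton_well_defined gf Hf g lam x0 \<and>
         (\<forall>X. X 0 = x0 \<and> (\<forall>k. newton_step gf Hf g lam (X k) (X (Suc k)))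
              \<longrightarrow> Q_superlinear X xbar))"
  proof (intro exI[of _ "ball xbar \<delta>"] conjI ballI)
    show "open (ball xbar \<delta>)" "xbar \<in> ball xbar \<delta>" using \<delta>(1) by auto
    fix x0 assume "x0 \<in> ball xbar \<delta>"
    then have x0: "norm (x0 - xbar) < \<delta>" by (simp add: dist_norm norm_minus_commute)
    have reach: "norm (x - xbar) < \<delta>" if "(newton_step gf Hf g lam)\<^sup>*\<^sup>* x0 x" for x
      using that
    proof (induction rule: rtranclp_induct)
      case (step y z)
      then have "norm (z - xbar) \<le> 1 / 2 * norm (y - xbar)" using \<delta>(2) by (intro half) auto
      then show ?case using step.IH norm_ge_zero[of "y - xbar"] by linarith
    qed (rule x0)
    show "newton_well_defined gf Hf g lam x0"
      unfolding newton_well_defined_def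
    proof (intro allI impI)
      fix x assume "(newton_step gf Hf g lam)\<^sup>*\<^sup>* x0 x"
      from reach[OF this] show "prox_points gf g lam x \<noteq> {} \<and>
          (\<forall>xh\<in>prox_points gf g lam x. newton_directions gf Hf g lam x xh \<noteq> {})"
        using \<delta>(3) by (intro wd) auto
    qed
    show "\<forall>X. X 0 = x0 \<and> (\<forall>k. newton_step gf Hf g lam (X k) (X (Suc k))) \<longrightarrow> Q_superlinear X xbar"
    proof (intro allI impI)
      fix X assume X: "X 0 = x0 \<and> (\<forall>k. newton_step gf Hf g lam (X k) (X (Suc k)))"
      show "Q_superlinear X xbar"
      proof (rule halving_sequence_Q_superlinear)
        show "X k \<noteq> xbar" for k
        proof -
          have "X k \<notin> prox_points gf g lam (X k)" using X by (simp add: newton_step_def)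
          then show ?thesis using xb_stop by auto
        qed
        show "norm (X 0 - xbar) < \<delta>h" using X x0 \<delta>(2) by simp
        show "norm (X (Suc k) - xbar) \<le> 1 / 2 * norm (X k - xbar)" if "norm (X k - xbar) < \<delta>h" for k
          using half[OF that] X by blast
        show "\<exists>\<delta>>0. \<forall>k. norm (X k - xbar) < \<delta> \<longrightarrow> norm (X (Suc k) - xbar) \<le> \<epsilon> * norm (X k - xbar)" if "0 < \<epsilon>" for \<epsilon>
          using step[OF that] X by meson
      qed
    qed
  qed
qed

end
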